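(* Let $(\Xi,d)$ be a Polish space in which every bounded subset is totally bounded, $p\in[1,\infty)$, $\nu\in\mathcal P(\Xi)$, $\theta>0$, and let $\Psi:\Xi\to\mathbb R$ be upper semicontinuous with $\int|\Psi|\,d\nu<\infty$ and growth rate $\kappa<\infty$. Then the following hold. (i) [Existence] A worst-case distribution exists if and only if one of the following conditions holds: (a) there exists a dual minimizer $\lambda^*>\kappa$; (b) $\lambda^*=\kappa>0$ is the unique dual minimizer, $\nu\big(\{\zeta\in\Xi:\arg\min_{\xi\in\Xi}\{\kappa d^p(\xi,\zeta)-\Psi(\xi)\}=\varnothing\}\big)=0$, and $\int_\Xi\underline D_0(\kappa,\zeta)\,\nu(d\zeta)\le\theta^p\le\int_\Xi\overline D_0(\kappa,\zeta)\,\nu(d\zeta)$; (c) $\lambda^*=\kappa=0$ is the unique dual minimizer, $\arg\max_{\xi\in\Xi}\Psi(\xi)$ is nonempty, and $\int_\Xi\underline D_0(0,\zeta)\,\nu(d\zeta)\le\theta^p$. In addition, if $\nu\big(\{\zeta\in\Xi:-\Psi(\zeta)>\inf_{\xi\in\Xi}\{\kappa d^p(\xi,\zeta)-\Psi(\xi)\}\}\big)=0$, then for every $\theta>0$ the dual minimizer is $\lambda^*=\kappa$; otherwise there is $\theta_0>0$ such that for every $\theta\in(0,\theta_0)$ the dual minimizer satisfies $\lambda^*>\kappa$. (ii) [Structure] Whenever a worst-case distribution exists, there are a dual minimizer $\lambda^*$, a number $p^*\in[0,1]$ and $\nu$-measurable maps $\overline T^*,\underline T^*:\Xi\to\Xi$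 such that for $\nu$-almost every $\zeta$ both $\overline T^*(\zeta)$ and $\underline T^*(\zeta)$ belong to $\arg\min_{\xi\in\Xi}\{\lambda^*d^p(\xi,\zeta)-\Psi(\xi)\}$, and $$\mu^*=p^*\,\overline T^*_\#\nu+(1-p^* )\,\underline T^*_\#\nu$$ is a worst-case distribution. Moreover, define $\gamma^T\in\mathcal P(\Xi\times\Xi)$ by $\gamma^T(A)=p^*\,\nu(\{\zeta:(\zeta,\overline T^*(\zeta))\in A\})+(1-p^* )\,\nu(\{\zeta:(\zeta,\underline T^*(\zeta))\in A\})$ for measurable $A\subset\Xi\times\Xi$. If $\lambda^*>0$, then $\gamma^T$ is an optimal coupling of $\nu$ and $\mu^*$, i.e. it attains the minimum defining $W_p^p(\mu^*,\nu)$. (iii) Suppose that $\Xi$ is convex, $\Psi$ is concave, and $d^p(\cdot,\zeta)$ is convex for $\nu$-almost all $\zeta\in\Xi$. Then $$v_P=v_D=\sup\big\{\mathbb E_{T_\#\nu}[\Psi(\xi)]\;:\;T:\Xi\to\Xi\ \nu\text{-measurable},\ W_p(T_\#\nu,\nu)\le\theta\big\}.$$ Moreover, whenever a worst-case distribution exists, there is a map $T^*:\Xi\to\Xi$ such that $T^*_\#\nu$ is a worst-case distribution and $T^*(\zeta)\in\arg\min_{\xi\in\Xi}\{\lambda^*d^p(\xi,\zeta)-\Psi(\xi)\}$ for $\nu$-almost every $\zeta$, where $\lambda^*$ is a dual minimizer.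
   Context: $\mathcal P(\Xi)$ is the set of Borel probability measures, $d^p(\xi,\zeta):=d(\xi,\zeta)^p$, and $W_p^p(\mu,\nu)=\min_\gamma\int d^p\,d\gamma\in[0,\infty]$ over couplings $\gamma\in\mathcal P(\Xi\times\Xi)$ of $\mu,\nu$. A map is $\nu$-measurable if it is measurable from the $\nu$-completion of the Borel $\sigma$-algebra to the Borel $\sigma$-algebra; $T_\#\nu(A)=\nu(T^{-1}(A))$. Primal: $v_P=\sup\{\int\Psi\,d\mu:\mu\in\mathcal P(\Xi),\ W_p(\mu,\nu)\le\theta\}$; a worst-case distribution is a feasible $\mu$ attaining this supremum. Let $\Phi(\lambda,\zeta):=\inf_{\xi\in\Xi}\{\lambda d^p(\xi,\zeta)-\Psi(\xi)\}$ for $\lambda\ge0$, $h(\lambda):=\lambda\theta^p-\int_\Xi\Phi(\lambda,\zeta)\,\nu(d\zeta)\in(-\infty,\infty]$, and $v_D=\inf_{\lambda\ge0}h(\lambda)$; a dual minimizer is a minimizer of $h$ over $[0,\infty)$. The growth rate is $\kappa:=\inf\{\lambda\ge0:\int_\Xi\Phi(\lambda,\zeta)\,\nu(d\zeta)>-\infty\}$ ($\inf\varnothing=\infty$). When $\arg\min_{\xi}\{\lambda d^p(\xi,\zeta)-\Psi(\xi)\}\neq\varnothing$, define $\overline D_0(\lambda,\zeta)$ (possibly $+\infty$) and $\underline D_0(\lambda,\zeta)$ as the supremum and infimum, respectively, of $d^p(\xi,\zeta)$ over $\xi\in\Xi$ with $\lambda d^p(\xi,\zeta)-\Psi(\xi)=\Phi(\lambda,\zeta)$.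 In (iii), "$\Xi$ is convex" means that $\Xi$ is a convex subset of a real topological vector space whose topology on $\Xi$ is the one induced by $d$. *)

theory Defs
  imports "HOL-Probability.Probability"
begin

definition borel_probs :: "'a::topological_space measure set" where
  "borel_probs = {\<mu>. sets \<mu> = sets borel \<and> prob_space \<mu>}"

definition usc :: "('a::topological_space \<Rightarrow> real) \<Rightarrow> bool" where
  "usc f \<longleftrightarrow> (\<forall>x c. f x < c \<longrightarrow> (\<forall>\<^sub>F y in at x. f y < c))"

(* Note that \<infinity> - \<infinity> = \<infinity> in ereal. For an upper semicontinuous, \<nu>-integrable \<Psi> of
   finite growth rate this case does not arise: \<Phi>(l,\<cdot>) \<le> -\<Psi> has a \<nu>-integrable
   positive part for l \<ge> 0, and the positive part of \<Psi> is \<mu>-integrable whenever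
   W_p(\<mu>,\<nu>) < \<infinity>. *)
definition ereal_integral :: "'a measure \<Rightarrow> ('a \<Rightarrow> ereal) \<Rightarrow> ereal" where
  "ereal_integral M f =
     enn2ereal (\<integral>\<^sup>+x. e2ennreal (f x) \<partial>M) - enn2ereal (\<integral>\<^sup>+x. e2ennreal (- f x) \<partial>M)"

definition couplings ::
    "'a::metric_space measure \<Rightarrow> 'a measure \<Rightarrow> ('a \<times> 'a) measure set" where
  "couplings \<mu> \<nu> = {\<gamma> \<in> borel_probs. distr \<gamma> borel fst = \<mu> \<and> distr \<gamma> borel snd = \<nu>}"

definition transport_cost :: "real \<Rightarrow> ('a::metric_space \<times> 'a) measure \<Rightarrow> ennreal" where
  "transport_cost p \<gamma> = (\<integral>\<^sup>+(\<xi>, \<zeta>). ennreal (dist \<xi> \<zeta> powr p) \<partial>\<gamma>)"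

definition Wpp :: "real \<Rightarrow> 'a::metric_space measure \<Rightarrow> 'a measure \<Rightarrow> ennreal" where
  "Wpp p \<mu> \<nu> = (INF \<gamma>\<in>couplings \<mu> \<nu>. transport_cost p \<gamma>)"

definition wasserstein :: "real \<Rightarrow> 'a::metric_space measure \<Rightarrow> 'a measure \<Rightarrow> ennreal" where
  "wasserstein p \<mu> \<nu> =
     (if Wpp p \<mu> \<nu> = \<infinity> then \<infinity> else ennreal (enn2real (Wpp p \<mu> \<nu>) powr (1 / p)))"

definition primal_feasible ::
    "real \<Rightarrow> 'a::metric_space measure \<Rightarrow> real \<Rightarrow> 'a measure set" where
  "primal_feasible p \<nu> \<theta> = {\<mu> \<in> borel_probs. wasserstein p \<mu> \<nu> \<le> ennreal \<theta>}"

definition primal_value ::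
    "real \<Rightarrow> ('a::metric_space \<Rightarrow> real) \<Rightarrow> 'a measure \<Rightarrow> real \<Rightarrow> ereal" where
  "primal_value p \<Psi> \<nu> \<theta> =
     (SUP \<mu>\<in>primal_feasible p \<nu> \<theta>. ereal_integral \<mu> (\<lambda>\<xi>. ereal (\<Psi> \<xi>)))"

definition worst_case ::
    "real \<Rightarrow> ('a::metric_space \<Rightarrow> real) \<Rightarrow> 'a measure \<Rightarrow> real \<Rightarrow> 'a measure \<Rightarrow> bool" where
  "worst_case p \<Psi> \<nu> \<theta> \<mu> \<longleftrightarrow>
     \<mu> \<in> primal_feasible p \<nu> \<theta> \<and>
     ereal_integral \<mu> (\<lambda>\<xi>. ereal (\<Psi> \<xi>)) = primal_value p \<Psi> \<nu> \<theta>"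

definition Phi ::
    "real \<Rightarrow> ('a::metric_space \<Rightarrow> real) \<Rightarrow> real \<Rightarrow> 'a \<Rightarrow> ereal" where
  "Phi p \<Psi> l \<zeta> = (INF \<xi>. ereal (l * dist \<xi> \<zeta> powr p - \<Psi> \<xi>))"

definition dual_objective ::
    "real \<Rightarrow> ('a::metric_space \<Rightarrow> real) \<Rightarrow> 'a measure \<Rightarrow> real \<Rightarrow> real \<Rightarrow> ereal" where
  "dual_objective p \<Psi> \<nu> \<theta> l =
     ereal (l * \<theta> powr p) - ereal_integral \<nu> (Phi p \<Psi> l)"

definition dual_value ::
    "real \<Rightarrow> ('a::metric_space \<Rightarrow> real) \<Rightarrow> 'a measure \<Rightarrow> real \<Rightarrow> ereal" where
  "dual_value p \<Psi> \<nu> \<theta> = (INF l\<in>{0..}. dual_objective p \<Psi> \<nu> \<theta> l)"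

definition dual_minimizers ::
    "real \<Rightarrow> ('a::metric_space \<Rightarrow> real) \<Rightarrow> 'a measure \<Rightarrow> real \<Rightarrow> real set" where
  "dual_minimizers p \<Psi> \<nu> \<theta> =
     {l\<in>{0..}. \<forall>l'\<in>{0..}. dual_objective p \<Psi> \<nu> \<theta> l \<le> dual_objective p \<Psi> \<nu> \<theta> l'}"

definition growth_rate ::
    "real \<Rightarrow> ('a::metric_space \<Rightarrow> real) \<Rightarrow> 'a measure \<Rightarrow> ereal" where
  "growth_rate p \<Psi> \<nu> = Inf (ereal ` {l\<in>{0..}. ereal_integral \<nu> (Phi p \<Psi> l) > -\<infinity>})"

definition argmin_set ::
    "real \<Rightarrow> ('a::metric_space \<Rightarrow> real) \<Rightarrow> real \<Rightarrow> 'a \<Rightarrow> 'a set" where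
  "argmin_set p \<Psi> l \<zeta> = {\<xi>. ereal (l * dist \<xi> \<zeta> powr p - \<Psi> \<xi>) = Phi p \<Psi> l \<zeta>}"

(* Where argmin_set is empty the values below are 0 (upper) and \<infinity> (lower). *)
definition D0_upper ::
    "real \<Rightarrow> ('a::metric_space \<Rightarrow> real) \<Rightarrow> real \<Rightarrow> 'a \<Rightarrow> ennreal" where
  "D0_upper p \<Psi> l \<zeta> = (SUP \<xi>\<in>argmin_set p \<Psi> l \<zeta>. ennreal (dist \<xi> \<zeta> powr p))"

definition D0_lower ::
    "real \<Rightarrow> ('a::metric_space \<Rightarrow> real) \<Rightarrow> real \<Rightarrow> 'a \<Rightarrow> ennreal" where
  "D0_lower p \<Psi> l \<zeta> = (INF \<xi>\<in>argmin_set p \<Psi> l \<zeta>. ennreal (dist \<xi> \<zeta> powr p))"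

definition nu_measurable :: "'a::topological_space measure \<Rightarrow> ('a \<Rightarrow> 'b::topological_space) \<Rightarrow> bool" where
  "nu_measurable \<nu> T \<longleftrightarrow> T \<in> measurable (completion \<nu>) borel"

definition push :: "'a::topological_space measure \<Rightarrow> ('a \<Rightarrow> 'b::topological_space) \<Rightarrow> 'b measure" where
  "push \<nu> T = distr (completion \<nu>) borel T"

definition mixture :: "real \<Rightarrow> 'a measure \<Rightarrow> 'a measure \<Rightarrow> 'a measure" where
  "mixture q M N =
     measure_of (space M) (sets M)
       (\<lambda>A. ennreal q * emeasure M A + ennreal (1 - q) * emeasure N A)"

(* The Hausdorff axiom is not imposed. *)
definition tvs_topology :: "'v::real_vector topology \<Rightarrow> bool" where
  "tvs_topology X \<longleftrightarrow>
     topspace X = UNIV \<and>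
     continuous_map (prod_topology X X) X (\<lambda>(x, y). x + y) \<and>
     continuous_map (prod_topology euclideanreal X) X (\<lambda>(c, x). c *\<^sub>R x)"

end

theory Submission
  imports Defs
begin

text \<open>
  At a price \<open>l\<close> per unit of transport cost, moving a unit of mass from \<open>\<zeta>\<close> to \<open>\<xi>\<close> earns
  \<open>gain l \<xi> \<zeta> = \<Psi> \<xi> - \<Psi> \<zeta> - l * dist \<xi> \<zeta> powr p\<close>. The supremum of the gain over \<open>\<xi>\<close> is nonnegative
  and equals \<open>- \<Psi> \<zeta> - Phi p \<Psi> l \<zeta>\<close>, so the dual objective at radius \<open>t\<close> is \<open>\<integral>\<Psi> d\<nu>\<close> plus
  \<open>dual_excess t l = l * t powr p + total_gain l\<close>, a quantity in \<open>[0, \<infinity>]\<close>. In this form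
  monotone convergence in the price applies: \<open>total_gain\<close> is
  antitone and right continuous, finite above the growth rate and infinite below it, and hence a dual
  minimizer exists for every positive radius (\<open>dual_minimizer_exists\<close>).

  Weak duality integrates the pointwise bound on the gain against a coupling. Equality means that
  almost all mass moves to points of the argmin sets at the minimizing price and that the budget is
  used up if that price is positive. A pair of argmin selections whose mixed cost equals the budget
  (\<open>complementary_pair\<close>) therefore gives a worst case.

  Let \<open>m\<close> be a dual minimizer above the growth rate. Comparing \<open>dual_excess\<close> at \<open>m\<close> with its values at
  larger and smaller prices shows that argmin points cost on average at most the budget at larger
  prices and at least the budget at smaller ones. Argmin points are stable under limits of the price,
  so the budget lies between the integrals of the least and the largest cost over the argmin sets at
  \<open>m\<close>, and mixing a near and a far selection spends it exactly. If the growth rate itself is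
  the only minimizer, argmin selections at slightly larger prices stay within the budget and fall short of the dual value by
  little more than the price of the unspent budget; this rest is spent by sending a tiny fraction of the mass very far,
  which is profitable at every price below the growth rate (\<open>far_profitable_map\<close>). This yields
  strong duality in all cases, with near-optimal measures that are mixtures of two images of \<open>\<nu>\<close>.

  Conversely, let \<open>\<mu>\<close> be a worst case and \<open>m\<close> a dual minimizer. Couplings whose costs approach the
  Wasserstein distance have vanishing total slack. For compact \<open>K\<close>, and then for Borel sets, this forces
  \<open>\<mu> K \<le> \<nu> {\<zeta>. the argmin set of \<zeta> meets K}\<close> (\<open>worst_case_mass\<close>). Taking the whole space for \<open>K\<close>
  shows that almost all argmin sets are nonempty. At a positive price \<open>\<Psi>\<close> is an increasing function of the
  cost on every argmin set, so taking the superlevel and sublevel sets of \<open>\<Psi>\<close> gives stochastic domination between \<open>\<Psi>\<close>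
  under \<open>\<mu>\<close> and its extreme values over the argmin sets under \<open>\<nu>\<close>. Integrating the tails turns this into
  the two cost conditions. In this way the necessity of the conditions follows without an optimal
  coupling.

  The selections are measurable because bounded closed sets are compact: a closed-valued
  correspondence whose hitting sets of compact sets are measurable has a measurable selection, found by
  repeatedly keeping the points closest to the next element of a dense sequence. In the convex case,
  pointwise convex combinations of two maps do at least as well as the mixture of their images.
\<close>

section \<open>Upper semicontinuous functions\<close>

lemma usc_closed_superlevel:
  assumes "usc f" shows "closed {x. c \<le> f x}"
proof -
  have "open {x. f x < c}"
    unfolding open_subopen[of "{x. f x < c}"]
  proof safe
    fix x assume "f x < c"
    then have "eventually (\<lambda>y. f y < c) (at x)" using assms unfolding usc_def by blast
    then obtain U where "open U" "x \<in> U" "\<forall>y\<in>U. y \<noteq> x \<longrightarrow> f y < c"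
      unfolding eventually_at_topological by blast
    with \<open>f x < c\<close> show "\<exists>T. open T \<and> x \<in> T \<and> T \<subseteq> {x. f x < c}"
      by (intro exI[of _ U]) auto
  qed
  then have "closed (- {x. f x < c})" by (rule closed_Compl)
  moreover have "- {x. f x < c} = {x. c \<le> f x}" by auto
  ultimately show ?thesis by simp
qed

lemma usc_open_sublevel:
  assumes "usc f" shows "open {x. f x < c}"
proof -
  have "{x. f x < c} = - {x. c \<le> f x}" by auto
  then show ?thesis using usc_closed_superlevel[OF assms] by auto
qed

lemma usc_borel_measurable:
  "usc f \<Longrightarrow> (f :: 'a::topological_space \<Rightarrow> real) \<in> borel_measurable borel"
  by (intro borel_measurableI_less) (simp add: usc_open_sublevel)

lemma usc_eventually_less:
  assumes "usc f" "X \<longlonglongrightarrow> x" "f x < c"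
  shows "eventually (\<lambda>n. f (X n) < c) sequentially"
  using topological_tendstoD[OF assms(2) usc_open_sublevel[OF assms(1)], of c] assms(3) by simp

lemma usc_le_limit:
  fixes f :: "'a::topological_space \<Rightarrow> real"
  assumes "usc f" "X \<longlonglongrightarrow> x" "Y \<longlonglongrightarrow> y" "\<And>n. Y n \<le> f (X n)"
  shows "y \<le> f x"
proof (rule ccontr)
  assume "\<not> y \<le> f x"
  then obtain c where c: "f x < c" "c < y" using dense[of "f x" y] by auto
  have "eventually (\<lambda>n. f (X n) < c) sequentially" using usc_eventually_less[OF assms(1,2) c(1)] .
  moreover have "eventually (\<lambda>n. c < Y n) sequentially" using order_tendstoD(1)[OF assms(3) c(2)] .
  ultimately have "eventually (\<lambda>n. False) sequentially"
    by eventually_elim (use assms(4) in \<open>smt (verit)\<close>)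
  then show False by simp
qed

text \<open>The sets \<open>{x \<in> K. f x < f y}\<close> cover a compact set on which no maximum exists; the largest of
  the finitely many values \<open>f y\<close> needed for a subcover is then not covered.\<close>

lemma usc_attains_sup:
  fixes f :: "'a::topological_space \<Rightarrow> real"
  assumes f: "usc f" and K: "compact K" "K \<noteq> {}"
  shows "\<exists>x\<in>K. \<forall>y\<in>K. f y \<le> f x"
proof (rule ccontr)
  assume "\<not> ?thesis"
  then have "K \<subseteq> (\<Union>y\<in>K. {x. f x < f y})" by (force simp: not_le)
  then obtain C where C: "C \<subseteq> K" "finite C" "K \<subseteq> (\<Union>y\<in>C. {x. f x < f y})"
    using compactE_image[OF K(1), of K "\<lambda>y. {x. f x < f y}"] usc_open_sublevel[OF f] by metis
  then have "C \<noteq> {}" using K(2) by auto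
  then have "Max (f ` C) \<in> f ` C" using C(2) by (intro Max_in) auto
  then obtain z where z: "z \<in> C" "f z = Max (f ` C)" by auto
  then obtain y where "y \<in> C" "f z < f y" using C by blast
  moreover have "f y \<le> Max (f ` C)" using C(2) \<open>y \<in> C\<close> by auto
  ultimately show False using z by simp
qed

lemma usc_iff_open_sublevel: "usc f \<longleftrightarrow> (\<forall>c. open {x. f x < c})"
proof
  assume *: "\<forall>c. open {x. f x < c}"
  show "usc f" unfolding usc_def
  proof safe
    fix x c assume "f x < c"
    then show "eventually (\<lambda>y. f y < c) (at x)"
      unfolding eventually_at_topological using * by (intro exI[of _ "{x. f x < c}"]) auto
  qed
qed (use usc_open_sublevel in blast)

lemma usc_compose_continuous:
  assumes "usc f" "continuous_on UNIV g"
  shows "usc (\<lambda>x. f (g x))"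
proof -
  have "open (g -` {y. f y < c})" for c
    using assms usc_open_sublevel by (intro open_vimage)
  then show ?thesis by (simp add: usc_iff_open_sublevel vimage_def)
qed

lemma usc_add_continuous:
  fixes g :: "'a::topological_space \<Rightarrow> real"
  assumes "usc f" "continuous_on UNIV g"
  shows "usc (\<lambda>x. f x + g x)"
proof -
  have "open {x. f x + g x < c}" for c
  proof -
    have "{x. f x + g x < c} = (\<Union>r. {x. f x < r} \<inter> {x. g x < c - r})"
    proof safe
      fix x assume "f x + g x < c"
      then obtain r where "f x < r" "r < c - g x" using dense[of "f x" "c - g x"] by auto
      then show "x \<in> (\<Union>r. {x. f x < r} \<inter> {x. g x < c - r})" by auto
    qed auto
    moreover have "open {x. g x < c'}" for c'
      using assms(2) by (intro open_Collect_less) (auto intro: continuous_intros)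
    moreover have "open {x. f x < c'}" for c' using assms(1) by (rule usc_open_sublevel)
    ultimately show ?thesis by (simp add: open_UN open_Int)
  qed
  then show ?thesis by (simp add: usc_iff_open_sublevel)
qed

section \<open>Measurable selections in proper metric spaces\<close>

text \<open>Weak measurability of a closed-valued correspondence. Testing with compact instead of open sets
  suits closed graphs, and carries over to open sets when closed balls are compact.\<close>

definition hit_measurable :: "'b measure \<Rightarrow> ('b \<Rightarrow> 'a::topological_space set) \<Rightarrow> bool" where
  "hit_measurable M F \<longleftrightarrow>
     (\<forall>\<zeta>. closed (F \<zeta>)) \<and> (\<forall>K. compact K \<longrightarrow> {\<zeta>\<in>space M. F \<zeta> \<inter> K \<noteq> {}} \<in> sets M)"

lemma hit_measurableD:
  assumes "hit_measurable M F"
  shows "closed (F \<zeta>)" "compact K \<Longrightarrow> {\<zeta>\<in>space M. F \<zeta> \<inter> K \<noteq> {}} \<in> sets M"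
  using assms unfolding hit_measurable_def by auto

lemma closed_projection:
  fixes G :: "('a::metric_space \<times> 'b::metric_space) set"
  assumes "closed G" "compact K"
  shows "closed {\<zeta>. \<exists>\<xi>\<in>K. (\<xi>, \<zeta>) \<in> G}"
  unfolding closed_sequential_limits
proof safe
  fix x l assume x: "\<forall>n. x n \<in> {\<zeta>. \<exists>\<xi>\<in>K. (\<xi>, \<zeta>) \<in> G}" and l: "x \<longlonglongrightarrow> l"
  then obtain y where y: "\<And>n. y n \<in> K" "\<And>n. (y n, x n) \<in> G" by (auto, metis)
  then obtain \<xi> r where r: "\<xi> \<in> K" "strict_mono r" "(y \<circ> r) \<longlonglongrightarrow> \<xi>"
    using assms(2) unfolding compact_def by metis
  have "(\<lambda>n. ((y \<circ> r) n, (x \<circ> r) n)) \<longlonglongrightarrow> (\<xi>, l)"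
    using r(3) LIMSEQ_subseq_LIMSEQ[OF l r(2)] by (rule tendsto_Pair)
  then have "(\<xi>, l) \<in> G" using closed_sequentially[OF assms(1)] y by force
  then show "\<exists>\<xi>\<in>K. (\<xi>, l) \<in> G" using r by auto
qed

text \<open>A hitting set of a compact set is the projection of a part of the graph along that compact set,
  hence closed.\<close>

lemma hit_measurable_closed_graph:
  fixes G :: "('a::metric_space \<times> 'b::metric_space) set"
  assumes "closed G"
  shows "hit_measurable borel (\<lambda>\<zeta>. {\<xi>. (\<xi>, \<zeta>) \<in> G})"
  unfolding hit_measurable_def
proof safe
  fix \<zeta> show "closed {\<xi>. (\<xi>, \<zeta>) \<in> G}"
    unfolding closed_sequential_limits
  proof safe
    fix x l assume x: "\<forall>n. x n \<in> {\<xi>. (\<xi>, \<zeta>) \<in> G}" and l: "x \<longlonglongrightarrow> l"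
    have "(\<lambda>n. (x n, \<zeta>)) \<longlonglongrightarrow> (l, \<zeta>)" using l by (intro tendsto_Pair) auto
    then show "(l, \<zeta>) \<in> G" using closed_sequentially[OF assms] x by force
  qed
next
  fix K :: "'a set" assume "compact K"
  have "{\<zeta> \<in> space borel. {\<xi>. (\<xi>, \<zeta>) \<in> G} \<inter> K \<noteq> {}} = {\<zeta>. \<exists>\<xi>\<in>K. (\<xi>, \<zeta>) \<in> G}" by auto
  also have "\<dots> \<in> sets borel" using closed_projection[OF assms \<open>compact K\<close>] by auto
  finally show "{\<zeta> \<in> space borel. {\<xi>. (\<xi>, \<zeta>) \<in> G} \<inter> K \<noteq> {}} \<in> sets borel" .
qed

text \<open>The candidates that remain in \<open>F \<zeta>\<close> once only the points closest to \<open>d 0\<close>, then to \<open>d 1\<close>, and so on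
  have been kept.\<close>

primrec refine_towards :: "(nat \<Rightarrow> 'a::metric_space) \<Rightarrow> ('b \<Rightarrow> 'a set) \<Rightarrow> nat \<Rightarrow> 'b \<Rightarrow> 'a set" where
  "refine_towards d F 0 = F"
| "refine_towards d F (Suc k) =
     (\<lambda>\<zeta>. {x \<in> refine_towards d F k \<zeta>. dist x (d k) \<le> infdist (d k) (refine_towards d F k \<zeta>)})"

lemma refine_towards_decreasing:
  "m \<le> n \<Longrightarrow> refine_towards d F n \<zeta> \<subseteq> refine_towards d F m \<zeta>"
  by (induction n arbitrary: m) (auto simp: le_Suc_eq)

locale proper_polish =
  fixes space_type :: "'a::polish_space itself"
  assumes closed_bounded_compact: "\<And>S :: 'a set. closed S \<Longrightarrow> bounded S \<Longrightarrow> compact S"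
begin

lemma compact_cball_proper: "compact (cball (x::'a) r)"
  by (intro closed_bounded_compact) auto

lemma nearest_point:
  fixes S :: "'a set"
  assumes "closed S" "S \<noteq> {}"
  shows "\<exists>x\<in>S. \<forall>y\<in>S. dist x a \<le> dist y a"
proof -
  obtain b where b: "b \<in> S" using assms by auto
  have "compact (S \<inter> cball a (dist b a))"
    using assms by (intro closed_bounded_compact) (auto intro: bounded_Int)
  moreover have "b \<in> S \<inter> cball a (dist b a)" using b by (auto simp: dist_commute)
  moreover have "continuous_on (S \<inter> cball a (dist b a)) (\<lambda>x. dist x a)"
    by (intro continuous_intros)
  ultimately obtain x where x: "x \<in> S \<inter> cball a (dist b a)"
      "\<forall>y\<in>S \<inter> cball a (dist b a). dist x a \<le> dist y a"
    using continuous_attains_inf[of "S \<inter> cball a (dist b a)" "\<lambda>x. dist x a"] by blast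
  have "dist x a \<le> dist y a" if "y \<in> S" for y
  proof (cases "dist y a \<le> dist b a")
    case True with that x show ?thesis by (auto simp: dist_commute)
  next
    case False with x show ?thesis by (auto simp: dist_commute)
  qed
  with x show ?thesis by auto
qed

lemma infdist_eq_nearest:
  fixes S :: "'a set"
  assumes "x \<in> S" "\<forall>y\<in>S. dist x a \<le> dist y a"
  shows "infdist a S = dist x a"
proof (rule antisym)
  show "infdist a S \<le> dist x a" using infdist_le[OF assms(1), of a] by (simp add: dist_commute)
  show "dist x a \<le> infdist a S"
    unfolding infdist_def using assms by (auto intro!: cINF_greatest simp: dist_commute)
qed

lemma infdist_le_iff:
  fixes S :: "'a set"
  assumes "closed S" "S \<noteq> {}"
  shows "infdist a S \<le> c \<longleftrightarrow> (\<exists>x\<in>S. dist x a \<le> c)"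
proof -
  obtain x where x: "x \<in> S" "\<forall>y\<in>S. dist x a \<le> dist y a" using nearest_point[OF assms] by blast
  then show ?thesis unfolding infdist_eq_nearest[OF x] by force
qed

lemma hit_measurable_nonempty:
  assumes F: "hit_measurable M (F :: 'b \<Rightarrow> 'a set)"
  shows "{\<zeta>\<in>space M. F \<zeta> \<noteq> {}} \<in> sets M"
proof -
  have "\<exists>n::nat. F \<zeta> \<inter> cball undefined n \<noteq> {}" if ne: "F \<zeta> \<noteq> {}" for \<zeta>
  proof -
    obtain y where y: "y \<in> F \<zeta>" using ne by auto
    obtain n where "dist undefined y \<le> real n" using real_arch_simple by blast
    then have "y \<in> F \<zeta> \<inter> cball undefined (real n)" using y by auto
    then show ?thesis by blast
  qed
  then have "{\<zeta>\<in>space M. F \<zeta> \<noteq> {}} = (\<Union>n::nat. {\<zeta>\<in>space M. F \<zeta> \<inter> cball undefined n \<noteq> {}})"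
    by blast
  then show ?thesis using hit_measurableD(2)[OF F compact_cball_proper] by auto
qed

text \<open>Approximating a point of \<open>F \<zeta>\<close> by a countable dense set costs only \<open>1/n\<close> in the value of a
  1-Lipschitz function; compactness closes the gap again.\<close>

lemma hit_measurable_restrict:
  fixes f :: "'a \<Rightarrow> 'b \<Rightarrow> real"
  assumes F: "hit_measurable M F"
    and f: "\<And>x. f x \<in> borel_measurable M"
    and lip: "\<And>\<zeta> x y. f x \<zeta> \<le> f y \<zeta> + dist x y"
  shows "hit_measurable M (\<lambda>\<zeta>. {x \<in> F \<zeta>. f x \<zeta> \<le> 0})"
proof -
  have cont: "continuous_on S (\<lambda>x. f x \<zeta>)" for S \<zeta>
    unfolding continuous_on_iff
  proof safe
    fix x and e :: real assume "0 < e"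
    have "dist (f x' \<zeta>) (f x \<zeta>) \<le> dist x' x" for x'
      using lip[of x' \<zeta> x] lip[of x \<zeta> x'] by (auto simp: dist_real_def dist_commute)
    then show "\<exists>d>0. \<forall>x'\<in>S. dist x' x < d \<longrightarrow> dist (f x' \<zeta>) (f x \<zeta>) < e"
      using \<open>0 < e\<close> by (intro exI[of _ e]) (auto intro: le_less_trans)
  qed
  have "closed {x \<in> F \<zeta>. f x \<zeta> \<le> 0}" for \<zeta>
  proof -
    have "closed {x. f x \<zeta> \<le> 0}" using cont[of UNIV \<zeta>] by (intro closed_Collect_le) auto
    then have "closed (F \<zeta> \<inter> {x. f x \<zeta> \<le> 0})" using hit_measurableD(1)[OF F] by auto
    then show ?thesis by (simp add: Int_def)
  qed
  moreover have "{\<zeta>\<in>space M. {x \<in> F \<zeta>. f x \<zeta> \<le> 0} \<inter> K \<noteq> {}} \<in> sets M" if K: "compact K" for K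
  proof -
    obtain D :: "'a set" where D: "countable D" "\<And>X. open X \<Longrightarrow> X \<noteq> {} \<Longrightarrow> \<exists>d\<in>D. d \<in> X"
      by (erule countable_dense_setE)
    have eq: "{x \<in> F \<zeta>. f x \<zeta> \<le> 0} \<inter> K \<noteq> {} \<longleftrightarrow>
        (\<forall>n::nat. \<exists>d\<in>D. F \<zeta> \<inter> (K \<inter> cball d (1 / Suc n)) \<noteq> {} \<and> f d \<zeta> \<le> 1 / Suc n)" (is "?L \<longleftrightarrow> ?R") for \<zeta>
    proof
      assume ?L
      then obtain x where x: "x \<in> F \<zeta>" "x \<in> K" "f x \<zeta> \<le> 0" by auto
      show ?R
      proof
        fix n :: nat
        obtain d where "d \<in> D" "d \<in> ball x (1 / Suc n)" using D(2)[of "ball x (1 / Suc n)"] by auto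
        then show "\<exists>d\<in>D. F \<zeta> \<inter> (K \<inter> cball d (1 / Suc n)) \<noteq> {} \<and> f d \<zeta> \<le> 1 / Suc n"
          using x lip[of d \<zeta> x] by (intro bexI[of _ d]) (auto simp: dist_commute intro!: exI[of _ x])
      qed
    next
      assume R: ?R
      have "compact (F \<zeta> \<inter> K)" using K hit_measurableD(1)[OF F] by (metis closed_Int_compact)
      moreover have "F \<zeta> \<inter> K \<noteq> {}" using R by blast
      ultimately obtain x where x: "x \<in> F \<zeta> \<inter> K" "\<forall>y\<in>F \<zeta> \<inter> K. f x \<zeta> \<le> f y \<zeta>"
        using continuous_attains_inf[OF _ _ cont] by blast
      have "f x \<zeta> \<le> 2 / Suc n" for n :: nat
      proof -
        obtain d y where "y \<in> F \<zeta>" "y \<in> K" "y \<in> cball d (1 / Suc n)" "f d \<zeta> \<le> 1 / Suc n" using R by blast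
        then have "f x \<zeta> \<le> f y \<zeta>" "f y \<zeta> \<le> 1 / Suc n + 1 / Suc n"
          using x lip[of y \<zeta> d] by (auto simp: dist_commute)
        then show ?thesis by simp
      qed
      moreover have "(\<lambda>n. 2 / real (Suc n)) \<longlonglongrightarrow> 0"
        by (intro LIMSEQ_Suc lim_const_over_n)
      ultimately have "f x \<zeta> \<le> 0" by (intro tendsto_lowerbound[of "\<lambda>n. 2 / real (Suc n)"]) auto
      then show ?L using x by auto
    qed
    have "{\<zeta>\<in>space M. {x \<in> F \<zeta>. f x \<zeta> \<le> 0} \<inter> K \<noteq> {}} =
      (\<Inter>n::nat. \<Union>d\<in>D. {\<zeta>\<in>space M. F \<zeta> \<inter> (K \<inter> cball d (1 / Suc n)) \<noteq> {}} \<inter> {\<zeta>\<in>space M. f d \<zeta> \<le> 1 / Suc n})"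
      unfolding eq by auto
    also have "\<dots> \<in> sets M"
    proof -
      have "{\<zeta>\<in>space M. F \<zeta> \<inter> (K \<inter> cball d (1 / Suc n)) \<noteq> {}} \<in> sets M" for n d
        using K by (intro hit_measurableD(2)[OF F] compact_Int_closed) auto
      moreover have "{\<zeta>\<in>space M. f d \<zeta> \<le> 1 / Suc n} \<in> sets M" for n d using f[of d] by measurable
      ultimately have "(\<Union>d\<in>D. {\<zeta>\<in>space M. F \<zeta> \<inter> (K \<inter> cball d (1 / Suc n)) \<noteq> {}} \<inter> {\<zeta>\<in>space M. f d \<zeta> \<le> 1 / Suc n}) \<in> sets M" for n
        by (intro sets.countable_UN'' D(1) sets.Int)
      then show ?thesis by (intro sets.countable_INT image_subsetI) auto
    qed
    finally show ?thesis .
  qed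
  ultimately show ?thesis unfolding hit_measurable_def by blast
qed

text \<open>Repeatedly keeping only the points of \<open>F \<zeta>\<close> closest to the next element of a dense sequence
  leaves a decreasing sequence of nonempty compact sets; its intersection is a single point,
  since two points with equal distances to a dense set coincide.\<close>

lemma measurable_selection_total:
  assumes F: "hit_measurable M (F :: 'b \<Rightarrow> 'a set)" and ne: "\<And>\<zeta>. F \<zeta> \<noteq> {}"
  shows "\<exists>T\<in>measurable M borel. \<forall>\<zeta>. T \<zeta> \<in> F \<zeta>"
proof -
  obtain D :: "'a set" where D: "countable D" "\<And>X. open X \<Longrightarrow> X \<noteq> {} \<Longrightarrow> \<exists>d\<in>D. d \<in> X"
    by (erule countable_dense_setE)
  then have "D \<noteq> {}" by (metis UNIV_I empty_iff open_UNIV)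
  define d where "d = from_nat_into D"
  have d: "\<exists>k. d k \<in> X" if "open X" "X \<noteq> {}" for X
    using D(2)[OF that] from_nat_into_surj[OF D(1)] unfolding d_def by metis
  let ?R = "refine_towards d F"
  have R: "hit_measurable M (?R k) \<and> (\<forall>\<zeta>. ?R k \<zeta> \<noteq> {}) \<and> (\<lambda>\<zeta>. infdist (d k) (?R k \<zeta>)) \<in> borel_measurable M" for k
  proof (induction k)
    have meas: "(\<lambda>\<zeta>. infdist a (G \<zeta>)) \<in> borel_measurable M"
      if G: "hit_measurable M G" "\<And>\<zeta>. G \<zeta> \<noteq> {}" for G and a :: 'a
    proof (rule borel_measurableI_le)
      fix c
      have "infdist a (G \<zeta>) \<le> c \<longleftrightarrow> G \<zeta> \<inter> cball a c \<noteq> {}" for \<zeta>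
        using infdist_le_iff[OF hit_measurableD(1)[OF G(1)] G(2)] by (auto simp: dist_commute)
      then show "{\<zeta>\<in>space M. infdist a (G \<zeta>) \<le> c} \<in> sets M"
        using hit_measurableD(2)[OF G(1) compact_cball_proper] by simp
    qed
    {
      case 0 then show ?case using F ne meas by simp
    next
      case (Suc k)
      have 1: "hit_measurable M (?R (Suc k))"
      proof -
        have "hit_measurable M (\<lambda>\<zeta>. {x \<in> ?R k \<zeta>. dist x (d k) - infdist (d k) (?R k \<zeta>) \<le> 0})"
        proof (rule hit_measurable_restrict)
          fix x y :: 'a and \<zeta>
          show "dist x (d k) - infdist (d k) (?R k \<zeta>) \<le> dist y (d k) - infdist (d k) (?R k \<zeta>) + dist x y"
            using dist_triangle[of x "d k" y] by simp
        qed (use Suc in auto)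
        then show ?thesis by simp
      qed
      have 2: "?R (Suc k) \<zeta> \<noteq> {}" for \<zeta>
      proof -
        obtain x where x: "x \<in> ?R k \<zeta>" "\<forall>y\<in>?R k \<zeta>. dist x (d k) \<le> dist y (d k)"
          using Suc nearest_point hit_measurableD(1) by metis
        then show ?thesis using infdist_eq_nearest[OF x] by auto
      qed
      show ?case using 1 2 meas[OF 1] by blast
    }
  qed
  have ex: "\<exists>x. \<forall>k. x \<in> ?R k \<zeta>" for \<zeta>
  proof -
    have 1: "compact (?R (Suc k) \<zeta>)" for k
    proof (rule closed_bounded_compact)
      show "closed (?R (Suc k) \<zeta>)" by (rule hit_measurableD(1)[OF conjunct1[OF R]])
      have "?R (Suc k) \<zeta> \<subseteq> cball (d k) (infdist (d k) (?R k \<zeta>))" by (auto simp: dist_commute)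
      then show "bounded (?R (Suc k) \<zeta>)" using bounded_cball bounded_subset by blast
    qed
    have "(\<Inter>k. ?R (Suc k) \<zeta>) \<noteq> {}"
    proof -
      have "?R (Suc 0) \<zeta> \<inter> (\<Inter>k. ?R (Suc k) \<zeta>) \<noteq> {}"
      proof (rule compact_imp_fip_image)
        show "compact (?R (Suc 0) \<zeta>)" using 1 .
        show "closed (?R (Suc k) \<zeta>)" for k using compact_imp_closed[OF 1] .
        fix I :: "nat set" assume "finite I"
        then obtain m where "\<forall>k\<in>I. k \<le> m" using finite_nat_set_iff_bounded_le by blast
        then have "?R (Suc m) \<zeta> \<subseteq> ?R (Suc 0) \<zeta> \<inter> (\<Inter>k\<in>I. ?R (Suc k) \<zeta>)"
          using refine_towards_decreasing[of _ "Suc m" d F \<zeta>] by (auto simp del: refine_towards.simps)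
        moreover have "?R (Suc m) \<zeta> \<noteq> {}" using R by blast
        ultimately show "?R (Suc 0) \<zeta> \<inter> (\<Inter>k\<in>I. ?R (Suc k) \<zeta>) \<noteq> {}" by blast
      qed
      then show ?thesis by blast
    qed
    then obtain x where "\<forall>k. x \<in> ?R (Suc k) \<zeta>" by blast
    then have "x \<in> ?R k \<zeta>" for k using refine_towards_decreasing[of k "Suc k" d F \<zeta>] by auto
    then show ?thesis by blast
  qed
  define T where "T \<zeta> = (SOME x. \<forall>k. x \<in> ?R k \<zeta>)" for \<zeta>
  have T: "T \<zeta> \<in> ?R k \<zeta>" for \<zeta> k unfolding T_def using someI_ex[OF ex] by blast
  have dist_T: "dist (T \<zeta>) (d k) = infdist (d k) (?R k \<zeta>)" for \<zeta> k
    using T[of \<zeta> "Suc k"] infdist_le[of "T \<zeta>" "?R k \<zeta>" "d k"] by (auto simp: dist_commute intro!: antisym)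
  have "T \<in> measurable M borel"
  proof (rule borel_measurableI)
    fix U :: "'a set" assume "open U"
    have "T -` U \<inter> space M = (\<Union>(k, m::nat) \<in> {(k, m). cball (d k) (1 / Suc m) \<subseteq> U}.
        {\<zeta>\<in>space M. infdist (d k) (?R k \<zeta>) \<le> 1 / Suc m})" (is "?A = ?B")
    proof safe
      fix \<zeta> assume "\<zeta> \<in> space M" "T \<zeta> \<in> U"
      obtain e where e: "e > 0" "ball (T \<zeta>) e \<subseteq> U" using \<open>open U\<close> \<open>T \<zeta> \<in> U\<close> open_contains_ball by blast
      obtain m where m: "1 / real (Suc m) < e / 2" using nat_approx_posE[of "e/2"] e by (metis half_gt_zero)
      obtain k where k: "d k \<in> ball (T \<zeta>) (1 / Suc m)" using d[of "ball (T \<zeta>) (1 / Suc m)"] by auto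
      have "cball (d k) (1 / Suc m) \<subseteq> ball (T \<zeta>) e"
      proof
        fix y assume "y \<in> cball (d k) (1 / Suc m)"
        then show "y \<in> ball (T \<zeta>) e"
          using k m dist_triangle[of "T \<zeta>" y "d k"] by auto
      qed
      then show "\<zeta> \<in> ?B"
        using e k \<open>\<zeta> \<in> space M\<close> dist_T[of \<zeta> k] by (intro UN_I[of "(k, m)"]) (auto simp: dist_commute)
    next
      fix \<zeta> k and m :: nat assume *: "cball (d k) (1 / real (Suc m)) \<subseteq> U" "infdist (d k) (?R k \<zeta>) \<le> 1 / real (Suc m)"
      then have "T \<zeta> \<in> cball (d k) (1 / real (Suc m))" using dist_T[of \<zeta> k] by (auto simp: dist_commute)
      then show "\<zeta> \<in> T -` U" using * by auto
    qed
    also have "\<dots> \<in> sets M"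
    proof (intro sets.countable_UN'')
      fix x :: "nat \<times> nat"
      obtain k m where [simp]: "x = (k, m)" by (cases x)
      have "(\<lambda>\<zeta>. infdist (d k) (?R k \<zeta>)) \<in> borel_measurable M" using R by blast
      then have "{\<zeta>\<in>space M. infdist (d k) (?R k \<zeta>) \<le> 1 / Suc m} \<in> sets M" by measurable
      then show "(case x of (k, m) \<Rightarrow> {\<zeta>\<in>space M. infdist (d k) (?R k \<zeta>) \<le> 1 / Suc m}) \<in> sets M" by simp
    qed auto
    finally show "T -` U \<inter> space M \<in> sets M" .
  qed
  moreover have "\<forall>\<zeta>. T \<zeta> \<in> F \<zeta>" using T[of _ 0] by simp
  ultimately show ?thesis by blast
qed

lemma measurable_selection:
  assumes F: "hit_measurable M (F :: 'b \<Rightarrow> 'a set)"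
  shows "\<exists>T\<in>measurable M borel. \<forall>\<zeta>. F \<zeta> \<noteq> {} \<longrightarrow> T \<zeta> \<in> F \<zeta>"
proof -
  define G where "G \<zeta> = (if F \<zeta> = {} then UNIV else F \<zeta>)" for \<zeta>
  have "hit_measurable M G"
    unfolding hit_measurable_def
  proof safe
    show "closed (G \<zeta>)" for \<zeta> unfolding G_def using hit_measurableD(1)[OF F] by simp
    fix K :: "'a set" assume K: "compact K"
    have "{\<zeta> \<in> space M. G \<zeta> \<inter> K \<noteq> {}} = {\<zeta>\<in>space M. F \<zeta> \<inter> K \<noteq> {}} \<union>
      (if K = {} then {} else space M - {\<zeta>\<in>space M. F \<zeta> \<noteq> {}})" unfolding G_def by auto
    also have "\<dots> \<in> sets M" using hit_measurableD(2)[OF F K] hit_measurable_nonempty[OF F] by auto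
    finally show "{\<zeta> \<in> space M. G \<zeta> \<inter> K \<noteq> {}} \<in> sets M" .
  qed
  moreover have "G \<zeta> \<noteq> {}" for \<zeta> unfolding G_def by simp
  ultimately obtain T where "T \<in> measurable M borel" "\<forall>\<zeta>. T \<zeta> \<in> G \<zeta>"
    using measurable_selection_total by blast
  moreover from this(2) have "F \<zeta> \<noteq> {} \<longrightarrow> T \<zeta> \<in> F \<zeta>" for \<zeta> by (metis G_def)
  ultimately show ?thesis by blast
qed

text \<open>The minimum value is measurable, because its sublevel sets are where a restricted correspondence
  is nonempty; the minimizers then form a restriction of \<open>F\<close> as well. Attainment is assumed instead of
  compactness, since nearest points exist in unbounded closed sets too.\<close>

lemma measurable_argmin_selection:
  fixes f :: "'a \<Rightarrow> 'b \<Rightarrow> real"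
  assumes F: "hit_measurable M F"
    and f: "\<And>x. f x \<in> borel_measurable M"
    and lip: "\<And>\<zeta> x y. f x \<zeta> \<le> f y \<zeta> + dist x y"
    and att: "\<And>\<zeta>. F \<zeta> \<noteq> {} \<Longrightarrow> \<exists>x\<in>F \<zeta>. \<forall>y\<in>F \<zeta>. f x \<zeta> \<le> f y \<zeta>"
  shows "\<exists>T\<in>M \<rightarrow>\<^sub>M borel. \<forall>\<zeta>. F \<zeta> \<noteq> {} \<longrightarrow> T \<zeta> \<in> F \<zeta> \<and> (\<forall>\<xi>\<in>F \<zeta>. f (T \<zeta>) \<zeta> \<le> f \<xi> \<zeta>)"
proof -
  define m where "m \<zeta> = (if F \<zeta> = {} then 0 else (INF x\<in>F \<zeta>. f x \<zeta>))" for \<zeta>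
  have m_eq: "m \<zeta> = f x \<zeta>" if "x \<in> F \<zeta>" "\<forall>y\<in>F \<zeta>. f x \<zeta> \<le> f y \<zeta>" for x \<zeta>
    unfolding m_def using that by (auto intro!: cInf_eq_minimum)
  have m: "m \<in> borel_measurable M"
  proof (rule borel_measurableI_le)
    fix c
    have "hit_measurable M (\<lambda>\<zeta>. {x \<in> F \<zeta>. f x \<zeta> - c \<le> 0})"
    proof (rule hit_measurable_restrict[OF F])
      show "f x \<zeta> - c \<le> f y \<zeta> - c + dist x y" for x y \<zeta> using lip[of x \<zeta> y] by simp
      show "(\<lambda>\<zeta>. f x \<zeta> - c) \<in> borel_measurable M" for x using f by simp
    qed
    note H = hit_measurable_nonempty[OF this]
    have "{\<zeta> \<in> space M. m \<zeta> \<le> c} = {\<zeta> \<in> space M. {x \<in> F \<zeta>. f x \<zeta> - c \<le> 0} \<noteq> {}} \<union>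
       (if 0 \<le> c then space M - {\<zeta>\<in>space M. F \<zeta> \<noteq> {}} else {})" (is "?A = ?B")
    proof (rule set_eqI)
      fix \<zeta>
      show "\<zeta> \<in> ?A \<longleftrightarrow> \<zeta> \<in> ?B"
      proof (cases "F \<zeta> = {}")
        case True then show ?thesis by (auto simp: m_def)
      next
        case False
        then obtain x where x: "x \<in> F \<zeta>" "\<forall>y\<in>F \<zeta>. f x \<zeta> \<le> f y \<zeta>" using att by blast
        have "m \<zeta> \<le> c \<longleftrightarrow> (\<exists>y\<in>F \<zeta>. f y \<zeta> \<le> c)"
          unfolding m_eq[OF x] using x by (meson order_trans)
        then show ?thesis using False by auto
      qed
    qed
    also have "\<dots> \<in> sets M" using H hit_measurable_nonempty[OF F] by auto
    finally show "{\<zeta> \<in> space M. m \<zeta> \<le> c} \<in> sets M" .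
  qed
  have "hit_measurable M (\<lambda>\<zeta>. {x \<in> F \<zeta>. f x \<zeta> - m \<zeta> \<le> 0})"
  proof (rule hit_measurable_restrict[OF F])
    show "f x \<zeta> - m \<zeta> \<le> f y \<zeta> - m \<zeta> + dist x y" for x y \<zeta> using lip[of x \<zeta> y] by simp
    show "(\<lambda>\<zeta>. f x \<zeta> - m \<zeta>) \<in> borel_measurable M" for x using f m by simp
  qed
  from measurable_selection[OF this] obtain T where T: "T \<in> M \<rightarrow>\<^sub>M borel"
    "\<forall>\<zeta>. {x \<in> F \<zeta>. f x \<zeta> - m \<zeta> \<le> 0} \<noteq> {} \<longrightarrow> T \<zeta> \<in> {x \<in> F \<zeta>. f x \<zeta> - m \<zeta> \<le> 0}" by blast
  have "T \<zeta> \<in> F \<zeta> \<and> (\<forall>\<xi>\<in>F \<zeta>. f (T \<zeta>) \<zeta> \<le> f \<xi> \<zeta>)" if ne: "F \<zeta> \<noteq> {}" for \<zeta>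
  proof -
    obtain x where x: "x \<in> F \<zeta>" "\<forall>y\<in>F \<zeta>. f x \<zeta> \<le> f y \<zeta>" using att[OF ne] by blast
    then have "x \<in> {x \<in> F \<zeta>. f x \<zeta> - m \<zeta> \<le> 0}" using m_eq[OF x] by simp
    then have "T \<zeta> \<in> {x \<in> F \<zeta>. f x \<zeta> - m \<zeta> \<le> 0}" using T(2) by blast
    then have "T \<zeta> \<in> F \<zeta>" "f (T \<zeta>) \<zeta> \<le> f x \<zeta>" using m_eq[OF x] by simp_all
    then show ?thesis using x(2) order_trans by blast
  qed
  then show ?thesis using T(1) by blast
qed

lemma measurable_nearest_selection:
  assumes F: "hit_measurable borel (F :: 'a \<Rightarrow> 'a set)"
  shows "\<exists>T\<in>borel \<rightarrow>\<^sub>M borel. \<forall>\<zeta>. F \<zeta> \<noteq> {} \<longrightarrow> T \<zeta> \<in> F \<zeta> \<and> (\<forall>\<xi>\<in>F \<zeta>. dist (T \<zeta>) \<zeta> \<le> dist \<xi> \<zeta>)"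
proof (rule measurable_argmin_selection[OF F])
  fix x y \<zeta> :: 'a
  show "dist x \<zeta> \<le> dist y \<zeta> + dist x y" using dist_triangle[of x \<zeta> y] by simp
qed (simp_all add: nearest_point hit_measurableD(1)[OF F])

lemma measurable_farthest_selection:
  assumes F: "hit_measurable borel (F :: 'a \<Rightarrow> 'a set)" and bdd: "\<And>\<zeta>. bounded (F \<zeta>)"
  shows "\<exists>T\<in>borel \<rightarrow>\<^sub>M borel. \<forall>\<zeta>. F \<zeta> \<noteq> {} \<longrightarrow> T \<zeta> \<in> F \<zeta> \<and> (\<forall>\<xi>\<in>F \<zeta>. dist \<xi> \<zeta> \<le> dist (T \<zeta>) \<zeta>)"
proof -
  have att: "\<exists>x\<in>F \<zeta>. \<forall>y\<in>F \<zeta>. - dist x \<zeta> \<le> - dist y \<zeta>" if ne: "F \<zeta> \<noteq> {}" for \<zeta>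
  proof -
    have "compact (F \<zeta>)" using F bdd by (intro closed_bounded_compact hit_measurableD(1))
    moreover have "continuous_on (F \<zeta>) (\<lambda>x. dist x \<zeta>)" by (intro continuous_intros)
    ultimately show ?thesis using continuous_attains_sup[of "F \<zeta>" "\<lambda>x. dist x \<zeta>"] ne by simp
  qed
  have lip: "- dist x \<zeta> \<le> - dist y \<zeta> + dist x y" for x y \<zeta> :: 'a
    using dist_triangle[of y \<zeta> x] by (simp add: dist_commute)
  have "(\<lambda>\<zeta>. - dist x \<zeta>) \<in> borel_measurable borel" for x :: 'a by simp
  from measurable_argmin_selection[OF F this lip att] show ?thesis by simp
qed

end

section \<open>Layer cake formula and stochastic dominance\<close>

lemma ennreal_eq_emeasure_Ioc: "ennreal a = emeasure lborel {0<..a}"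
  by (cases "0 \<le> a") (auto simp: ennreal_neg)

lemma ennreal_eq_emeasure_Ico: "ennreal a = emeasure lborel {0..<a}"
  by (cases "0 \<le> a") (auto simp: ennreal_neg)

lemma (in sigma_finite_measure) layer_cake_le:
  assumes [measurable]: "f \<in> borel_measurable M"
  shows "(\<integral>\<^sup>+x. ennreal (f x) \<partial>M) =
    (\<integral>\<^sup>+t. indicator {0<..} t * emeasure M {x\<in>space M. t \<le> f x} \<partial>lborel)"
proof -
  interpret pair_sigma_finite M lborel ..
  have "(\<integral>\<^sup>+x. ennreal (f x) \<partial>M) = (\<integral>\<^sup>+x. \<integral>\<^sup>+t. indicator {0<..} t * indicator {x\<in>space M. t \<le> f x} x \<partial>lborel \<partial>M)"
  proof (intro nn_integral_cong)
    fix x assume "x \<in> space M"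
    then have "(\<integral>\<^sup>+t. indicator {0<..} t * indicator {x\<in>space M. t \<le> f x} x \<partial>lborel)
      = (\<integral>\<^sup>+t. indicator {0<..f x} t \<partial>lborel)"
      by (intro nn_integral_cong) (auto split: split_indicator)
    then show "ennreal (f x) = (\<integral>\<^sup>+t. indicator {0<..} t * indicator {x\<in>space M. t \<le> f x} x \<partial>lborel)"
      by (simp add: ennreal_eq_emeasure_Ioc)
  qed
  also have "\<dots> = (\<integral>\<^sup>+t. \<integral>\<^sup>+x. indicator {0<..} t * indicator {x\<in>space M. t \<le> f x} x \<partial>M \<partial>lborel)"
    by (intro Fubini'[symmetric]) measurable
  also have "\<dots> = (\<integral>\<^sup>+t. indicator {0<..} t * emeasure M {x\<in>space M. t \<le> f x} \<partial>lborel)"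
    by (intro nn_integral_cong) (simp add: nn_integral_cmult)
  finally show ?thesis .
qed

lemma (in sigma_finite_measure) layer_cake_less:
  assumes [measurable]: "f \<in> borel_measurable M"
  shows "(\<integral>\<^sup>+x. ennreal (f x) \<partial>M) =
    (\<integral>\<^sup>+t. indicator {0..} t * emeasure M {x\<in>space M. t < f x} \<partial>lborel)"
proof -
  interpret pair_sigma_finite M lborel ..
  have "(\<integral>\<^sup>+x. ennreal (f x) \<partial>M) = (\<integral>\<^sup>+x. \<integral>\<^sup>+t. indicator {0..} t * indicator {x\<in>space M. t < f x} x \<partial>lborel \<partial>M)"
  proof (intro nn_integral_cong)
    fix x assume "x \<in> space M"
    then have "(\<integral>\<^sup>+t. indicator {0..} t * indicator {x\<in>space M. t < f x} x \<partial>lborel)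
      = (\<integral>\<^sup>+t. indicator {0..<f x} t \<partial>lborel)"
      by (intro nn_integral_cong) (auto split: split_indicator)
    then show "ennreal (f x) = (\<integral>\<^sup>+t. indicator {0..} t * indicator {x\<in>space M. t < f x} x \<partial>lborel)"
      by (simp add: ennreal_eq_emeasure_Ico)
  qed
  also have "\<dots> = (\<integral>\<^sup>+t. \<integral>\<^sup>+x. indicator {0..} t * indicator {x\<in>space M. t < f x} x \<partial>M \<partial>lborel)"
    by (intro Fubini'[symmetric]) measurable
  also have "\<dots> = (\<integral>\<^sup>+t. indicator {0..} t * emeasure M {x\<in>space M. t < f x} \<partial>lborel)"
    by (intro nn_integral_cong) (simp add: nn_integral_cmult)
  finally show ?thesis .
qed

text \<open>The two forms of the layer cake formula are complementary: closed tails of \<open>f\<close> compute the integral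
  of its positive part, and their complements are the open tails of \<open>- f\<close>.\<close>

lemma stochastic_dominance_nn_integral:
  fixes f :: "'b \<Rightarrow> real" and g :: "'c \<Rightarrow> real"
  assumes M: "prob_space M" and N: "prob_space N"
    and [measurable]: "f \<in> borel_measurable M" "g \<in> borel_measurable N"
    and tail: "\<And>t. emeasure M {x\<in>space M. t \<le> f x} \<le> emeasure N {x\<in>space N. t \<le> g x}"
  shows "(\<integral>\<^sup>+x. ennreal (f x) \<partial>M) \<le> (\<integral>\<^sup>+x. ennreal (g x) \<partial>N)"
    and "(\<integral>\<^sup>+x. ennreal (- g x) \<partial>N) \<le> (\<integral>\<^sup>+x. ennreal (- f x) \<partial>M)"
proof -
  interpret M: prob_space M by fact
  interpret N: prob_space N by fact
  show "(\<integral>\<^sup>+x. ennreal (f x) \<partial>M) \<le> (\<integral>\<^sup>+x. ennreal (g x) \<partial>N)"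
    by (subst M.layer_cake_le N.layer_cake_le; simp?)+ (intro nn_integral_mono mult_left_mono tail, auto)
  have "emeasure N {x\<in>space N. t < - g x} \<le> emeasure M {x\<in>space M. t < - f x}" for t
  proof -
    have 1: "{x\<in>space N. t < - g x} = space N - {x\<in>space N. - t \<le> g x}"
         "{x\<in>space M. t < - f x} = space M - {x\<in>space M. - t \<le> f x}" by auto
    have "measure M {x\<in>space M. - t \<le> f x} \<le> measure N {x\<in>space N. - t \<le> g x}"
      using tail[of "- t"] by (simp add: M.emeasure_eq_measure N.emeasure_eq_measure)
    then show ?thesis unfolding 1
      by (simp add: M.emeasure_eq_measure N.emeasure_eq_measure M.prob_compl N.prob_compl)
  qed
  then show "(\<integral>\<^sup>+x. ennreal (- g x) \<partial>N) \<le> (\<integral>\<^sup>+x. ennreal (- f x) \<partial>M)"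
    by (subst M.layer_cake_less N.layer_cake_less; simp?)+ (intro nn_integral_mono mult_left_mono, auto)
qed

section \<open>Integrals with extended real values\<close>

lemma integrable_parts:
  assumes "integrable M f"
  obtains a b where "0 \<le> a" "0 \<le> b" "(\<integral>\<^sup>+x. ennreal (f x) \<partial>M) = ennreal a"
    "(\<integral>\<^sup>+x. ennreal (- f x) \<partial>M) = ennreal b" "integral\<^sup>L M f = a - b"
proof -
  have "(\<integral>\<^sup>+x. ennreal (f x) \<partial>M) < \<infinity>" "(\<integral>\<^sup>+x. ennreal (- f x) \<partial>M) < \<infinity>"
    using assms by (auto simp: real_integrable_def less_top)
  then obtain a b where "(\<integral>\<^sup>+x. ennreal (f x) \<partial>M) = ennreal a" "a \<ge> 0" "(\<integral>\<^sup>+x. ennreal (- f x) \<partial>M) = ennreal b" "b \<ge> 0"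
    by (auto simp: less_top_ennreal)
  then show ?thesis using real_lebesgue_integral_def[OF assms] that by auto
qed

lemma ereal_integral_real:
  assumes "integrable M f"
  shows "ereal_integral M (\<lambda>x. ereal (f x)) = ereal (integral\<^sup>L M f)"
proof -
  obtain a b where "0 \<le> a" "0 \<le> b" "(\<integral>\<^sup>+x. ennreal (f x) \<partial>M) = ennreal a"
    "(\<integral>\<^sup>+x. ennreal (- f x) \<partial>M) = ennreal b" "integral\<^sup>L M f = a - b" by (rule integrable_parts[OF assms])
  then show ?thesis unfolding ereal_integral_def by (simp add: enn2ereal_ennreal)
qed

text \<open>The integral of \<open>a\<close> may be infinite. The positive part of the difference is dominated by that of \<open>f\<close>,
  so that \<open>\<infinity> - \<infinity>\<close> does not occur. \<open>Phi\<close> is integrated in this form.\<close>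

lemma ereal_integral_diff_enn:
  assumes f: "integrable M f" and [measurable]: "a \<in> borel_measurable M"
  shows "ereal_integral M (\<lambda>x. ereal (f x) - enn2ereal (a x)) =
    ereal (integral\<^sup>L M f) - enn2ereal (\<integral>\<^sup>+x. a x \<partial>M)"
proof -
  have [measurable]: "f \<in> borel_measurable M" using f by auto
  define P N where "P x = e2ennreal (ereal (f x) - enn2ereal (a x))"
    and "N x = e2ennreal (- (ereal (f x) - enn2ereal (a x)))" for x
  have [measurable]: "P \<in> borel_measurable M" "N \<in> borel_measurable M" unfolding P_def N_def by measurable
  have pw: "P x + (ennreal (- f x) + a x) = N x + ennreal (f x)" for x
  proof (cases "a x")
    case (real r)
    then have "P x = ennreal (f x - r)" "N x = ennreal (r - f x)"
      unfolding P_def N_def by (auto simp: enn2ereal_ennreal e2ennreal_ereal)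
    then show ?thesis using real
      by (cases "f x \<ge> 0"; cases "f x \<ge> r") (auto simp: ennreal_neg ennreal_plus[symmetric] simp del: ennreal_plus)
  next
    case top
    then have "N x = top" unfolding N_def by simp
    then show ?thesis using top by simp
  qed
  have le: "P x \<le> ennreal (f x)" for x
  proof -
    have "ereal (f x) - enn2ereal (a x) \<le> ereal (f x)"
      using enn2ereal_nonneg[of "a x"] by (cases "enn2ereal (a x)") auto
    then have "P x \<le> e2ennreal (ereal (f x))" unfolding P_def by (rule e2ennreal_mono)
    then show ?thesis by (simp add: e2ennreal_ereal)
  qed
  obtain u v where uv: "0 \<le> u" "0 \<le> v" "(\<integral>\<^sup>+x. ennreal (f x) \<partial>M) = ennreal u"
    "(\<integral>\<^sup>+x. ennreal (- f x) \<partial>M) = ennreal v" "integral\<^sup>L M f = u - v" by (rule integrable_parts[OF f])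
  have "integral\<^sup>N M P \<le> (\<integral>\<^sup>+x. ennreal (f x) \<partial>M)" using le by (intro nn_integral_mono)
  then have "integral\<^sup>N M P < \<infinity>" using uv(3) by (auto intro: le_less_trans)
  moreover have "integral\<^sup>N M P + ((\<integral>\<^sup>+x. ennreal (- f x) \<partial>M) + (\<integral>\<^sup>+x. a x \<partial>M)) = integral\<^sup>N M N + (\<integral>\<^sup>+x. ennreal (f x) \<partial>M)"
    by (simp add: nn_integral_add[symmetric] pw)
  moreover note uv
  moreover have "ereal_integral M (\<lambda>x. ereal (f x) - enn2ereal (a x)) = enn2ereal (integral\<^sup>N M P) - enn2ereal (integral\<^sup>N M N)"
    unfolding ereal_integral_def P_def N_def ..
  ultimately show ?thesis
    by (cases "integral\<^sup>N M P"; cases "integral\<^sup>N M N"; cases "\<integral>\<^sup>+x. a x \<partial>M")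
      (auto simp: enn2ereal_ennreal ennreal_plus[symmetric] simp del: ennreal_plus)
qed

section \<open>Mixtures, images and couplings\<close>

lemma sets_mixture [simp, measurable_cong]: "sets (mixture q M N) = sets M"
  and space_mixture [simp]: "space (mixture q M N) = space M"
  unfolding mixture_def by simp_all

lemma emeasure_mixture:
  assumes N: "sets N = sets M" and A: "A \<in> sets M"
  shows "emeasure (mixture q M N) A = ennreal q * emeasure M A + ennreal (1 - q) * emeasure N A"
  unfolding mixture_def
proof (rule emeasure_measure_of_sigma)
  show "sigma_algebra (space M) (sets M)" ..
  show "positive (sets M) (\<lambda>A. ennreal q * emeasure M A + ennreal (1 - q) * emeasure N A)"
    by (simp add: positive_def)
  show "countably_additive (sets M) (\<lambda>A. ennreal q * emeasure M A + ennreal (1 - q) * emeasure N A)"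
    unfolding countably_additive_def
    using N by (auto simp: suminf_add[symmetric] suminf_emeasure)
qed (rule A)

lemma nn_integral_mixture:
  assumes N: "sets N = sets M" and f: "f \<in> borel_measurable M"
  shows "(\<integral>\<^sup>+x. f x \<partial>mixture q M N) = ennreal q * (\<integral>\<^sup>+x. f x \<partial>M) + ennreal (1 - q) * (\<integral>\<^sup>+x. f x \<partial>N)"
  using f
proof (induction rule: borel_measurable_induct)
  case (cong f g)
  have "space N = space M" using N by (rule sets_eq_imp_space_eq)
  then have "(\<integral>\<^sup>+x. f x \<partial>L) = (\<integral>\<^sup>+x. g x \<partial>L)" if "L \<in> {M, N, mixture q M N}" for L
    using that cong by (intro nn_integral_cong) auto
  then show ?case using cong by simp
next
  case (set A)
  then show ?case using N by (simp add: emeasure_mixture)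
next
  case (mult u c)
  moreover have "u \<in> borel_measurable N" "u \<in> borel_measurable (mixture q M N)"
    using mult(2) measurable_cong_sets[OF N refl] measurable_cong_sets[OF sets_mixture refl] by auto
  ultimately show ?case by (simp add: nn_integral_cmult distrib_left mult.left_commute)
next
  case (add u v)
  moreover have "u \<in> borel_measurable N" "u \<in> borel_measurable (mixture q M N)"
    "v \<in> borel_measurable N" "v \<in> borel_measurable (mixture q M N)"
    using add(1,3) measurable_cong_sets[OF N refl] measurable_cong_sets[OF sets_mixture refl] by auto
  ultimately show ?case by (simp add: nn_integral_add distrib_left algebra_simps)
next
  case (seq U)
  have m: "U i \<in> borel_measurable N" "U i \<in> borel_measurable (mixture q M N)" for i
    using seq(1)[of i] measurable_cong_sets[OF N refl] measurable_cong_sets[OF sets_mixture refl] by auto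
  have L: "(\<integral>\<^sup>+x. (SUP i. U i) x \<partial>L) = (SUP i. integral\<^sup>N L (U i))" if "L \<in> {M, N, mixture q M N}" for L
  proof -
    have "U i \<in> borel_measurable L" for i using that seq(1) m by blast
    then show ?thesis unfolding SUP_apply using \<open>incseq U\<close> by (intro nn_integral_monotone_convergence_SUP)
  qed
  have "incseq (\<lambda>i. c * integral\<^sup>N L (U i))" for L and c :: ennreal
    using \<open>incseq U\<close> by (auto simp: incseq_def le_fun_def intro!: mult_left_mono nn_integral_mono)
  then show ?case using seq L by (simp add: SUP_mult_left_ennreal ennreal_SUP_add)
qed

lemma borel_probsD:
  "\<mu> \<in> borel_probs \<Longrightarrow> sets \<mu> = sets borel" "\<mu> \<in> borel_probs \<Longrightarrow> prob_space \<mu>"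
  "\<mu> \<in> borel_probs \<Longrightarrow> space \<mu> = UNIV"
  unfolding borel_probs_def by (auto dest: sets_eq_imp_space_eq)

lemma push_borel:
  assumes \<nu>: "\<nu> \<in> borel_probs" and T: "T \<in> borel \<rightarrow>\<^sub>M borel"
  shows "push \<nu> T = distr \<nu> borel T"
proof -
  have "T \<in> \<nu> \<rightarrow>\<^sub>M borel" using T borel_probsD(1)[OF \<nu>] measurable_cong_sets by blast
  then show ?thesis unfolding push_def by (rule distr_completion)
qed

lemma nu_measurable_borel:
  assumes \<nu>: "\<nu> \<in> borel_probs" and T: "T \<in> borel \<rightarrow>\<^sub>M borel"
  shows "nu_measurable \<nu> T"
proof -
  have "T \<in> \<nu> \<rightarrow>\<^sub>M borel" using T borel_probsD(1)[OF \<nu>] measurable_cong_sets by blast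
  then show ?thesis unfolding nu_measurable_def by (rule measurable_completion)
qed

lemma push_in_borel_probs:
  assumes \<nu>: "\<nu> \<in> borel_probs" and T: "nu_measurable \<nu> T"
  shows "push \<nu> T \<in> borel_probs"
  using prob_space.prob_space_distr[OF prob_space.prob_space_completion[OF borel_probsD(2)[OF \<nu>]]] T
  unfolding borel_probs_def push_def nu_measurable_def by auto

lemma mixture_in_borel_probs:
  assumes "M \<in> borel_probs" "N \<in> borel_probs" "q \<in> {0..1}"
  shows "mixture q M N \<in> borel_probs"
proof -
  interpret M: prob_space M using assms borel_probsD by auto
  interpret N: prob_space N using assms borel_probsD by auto
  have s: "sets N = sets M" "space M = space N" using assms(1,2) by (simp_all add: borel_probsD)
  have "emeasure (mixture q M N) (space M) = ennreal q * 1 + ennreal (1 - q) * 1"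
    using s N.emeasure_space_1 M.emeasure_space_1 by (subst emeasure_mixture) auto
  also have "\<dots> = 1" using assms(3) by (simp add: ennreal_plus[symmetric] del: ennreal_plus)
  finally show ?thesis using assms unfolding borel_probs_def by (auto intro!: prob_spaceI)
qed

lemma wasserstein_le_iff:
  assumes "1 \<le> p" "0 < \<theta>"
  shows "wasserstein p \<mu> \<nu> \<le> ennreal \<theta> \<longleftrightarrow> Wpp p \<mu> \<nu> \<le> ennreal (\<theta> powr p)"
proof (cases "Wpp p \<mu> \<nu>")
  case (real r)
  have "r powr (1 / p) \<le> \<theta> \<longleftrightarrow> r \<le> \<theta> powr p"
  proof
    assume "r powr (1 / p) \<le> \<theta>"
    then have "(r powr (1 / p)) powr p \<le> \<theta> powr p" using assms by (intro powr_mono2) auto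
    then show "r \<le> \<theta> powr p" using real assms by (simp add: powr_powr)
  next
    assume "r \<le> \<theta> powr p"
    then have "r powr (1 / p) \<le> (\<theta> powr p) powr (1 / p)" using assms real by (intro powr_mono2) auto
    then show "r powr (1 / p) \<le> \<theta>" using assms by (simp add: powr_powr)
  qed
  then show ?thesis using real assms unfolding wasserstein_def by simp
next
  case top
  then show ?thesis unfolding wasserstein_def by (simp add: top_unique)
qed

lemma borel_measurable_fst_snd:
  "fst \<in> borel_measurable (borel :: ('a::second_countable_topology \<times> 'b::second_countable_topology) measure)"
  "snd \<in> borel_measurable (borel :: ('a \<times> 'b) measure)"
  by (auto intro!: borel_measurable_continuous_onI continuous_intros)

lemma borel_measurable_cost:
  "(\<lambda>(\<xi>::'a::{metric_space, second_countable_topology}, \<zeta>). ennreal (dist \<xi> \<zeta> powr p)) \<in> borel_measurable borel"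
proof -
  note [measurable] = borel_measurable_fst_snd
  show ?thesis unfolding split_beta by measurable
qed

text \<open>Maps \<open>T\<close> produce couplings through \<open>\<zeta> \<mapsto> (\<zeta>, T \<zeta>)\<close>, with \<open>\<nu>\<close> as first marginal, whereas
  \<open>Wpp p \<mu> \<nu>\<close> ranges over couplings with \<open>\<nu>\<close> as second marginal.\<close>

lemma couplings_swap:
  fixes \<nu> :: "'a::polish_space measure"
  assumes "\<gamma> \<in> couplings \<nu> \<mu>"
  shows "distr \<gamma> borel prod.swap \<in> couplings \<mu> \<nu>"
    and "transport_cost p (distr \<gamma> borel prod.swap) = transport_cost p \<gamma>"
proof -
  have \<gamma>: "sets \<gamma> = sets borel" "prob_space \<gamma>" "distr \<gamma> borel fst = \<nu>" "distr \<gamma> borel snd = \<mu>"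
    using assms unfolding couplings_def borel_probs_def by auto
  have sw: "prod.swap \<in> \<gamma> \<rightarrow>\<^sub>M borel"
    unfolding measurable_cong_sets[OF \<gamma>(1) refl]
    by (intro borel_measurable_continuous_onI) (auto simp: prod.swap_def intro!: continuous_intros)
  have "distr (distr \<gamma> borel prod.swap) borel fst = \<mu>" "distr (distr \<gamma> borel prod.swap) borel snd = \<nu>"
    using \<gamma>(3,4) sw borel_measurable_fst_snd[where 'a = 'a and 'b = 'a] by (auto simp: distr_distr comp_def)
  then show "distr \<gamma> borel prod.swap \<in> couplings \<mu> \<nu>"
    unfolding couplings_def borel_probs_def using prob_space.prob_space_distr[OF \<gamma>(2) sw] by auto
  show "transport_cost p (distr \<gamma> borel prod.swap) = transport_cost p \<gamma>"
    unfolding transport_cost_def using sw borel_measurable_cost[where 'a = 'a]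
    by (subst nn_integral_distr) (auto simp: case_prod_beta' dist_commute)
qed

lemma couplingsD:
  fixes \<mu> \<nu> :: "'a::polish_space measure"
  assumes "\<gamma> \<in> couplings \<mu> \<nu>"
  shows "sets \<gamma> = sets borel" "space \<gamma> = UNIV" "prob_space \<gamma>"
    "fst \<in> \<gamma> \<rightarrow>\<^sub>M borel" "snd \<in> \<gamma> \<rightarrow>\<^sub>M borel" "distr \<gamma> borel fst = \<mu>" "distr \<gamma> borel snd = \<nu>"
    and "f \<in> borel_measurable borel \<Longrightarrow> (\<integral>\<^sup>+\<xi>. f \<xi> \<partial>\<mu>) = (\<integral>\<^sup>+x. f (fst x) \<partial>\<gamma>)"
    and "f \<in> borel_measurable borel \<Longrightarrow> (\<integral>\<^sup>+\<zeta>. f \<zeta> \<partial>\<nu>) = (\<integral>\<^sup>+x. f (snd x) \<partial>\<gamma>)"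
proof -
  show \<gamma>: "sets \<gamma> = sets borel" "prob_space \<gamma>" and d: "distr \<gamma> borel fst = \<mu>" "distr \<gamma> borel snd = \<nu>"
    using assms unfolding couplings_def borel_probs_def by auto
  show "space \<gamma> = UNIV" using sets_eq_imp_space_eq[OF \<gamma>(1)] by simp
  show fs: "fst \<in> \<gamma> \<rightarrow>\<^sub>M borel" "snd \<in> \<gamma> \<rightarrow>\<^sub>M borel"
    using borel_measurable_fst_snd[where 'a = 'a and 'b = 'a] unfolding measurable_cong_sets[OF \<gamma>(1) refl] .
  show "(\<integral>\<^sup>+\<xi>. f \<xi> \<partial>\<mu>) = (\<integral>\<^sup>+x. f (fst x) \<partial>\<gamma>)" if "f \<in> borel_measurable borel"
    unfolding d(1)[symmetric] by (rule nn_integral_distr) (use that fs in auto)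
  show "(\<integral>\<^sup>+\<zeta>. f \<zeta> \<partial>\<nu>) = (\<integral>\<^sup>+x. f (snd x) \<partial>\<gamma>)" if "f \<in> borel_measurable borel"
    unfolding d(2)[symmetric] by (rule nn_integral_distr) (use that fs in auto)
qed

text \<open>Every pair of maps yields a coupling of \<open>\<nu>\<close> with the mixture of its two images.\<close>

lemma mixture_push_coupling:
  fixes \<nu> :: "'a::polish_space measure"
  assumes \<nu>: "\<nu> \<in> borel_probs" and T [measurable]: "T\<^sub>1 \<in> borel \<rightarrow>\<^sub>M borel" "T\<^sub>2 \<in> borel \<rightarrow>\<^sub>M borel"
    and q: "q \<in> {0..1}"
  defines "\<mu> \<equiv> mixture q (push \<nu> T\<^sub>1) (push \<nu> T\<^sub>2)"
    and "\<gamma> \<equiv> mixture q (push \<nu> (\<lambda>\<zeta>. (\<zeta>, T\<^sub>1 \<zeta>))) (push \<nu> (\<lambda>\<zeta>. (\<zeta>, T\<^sub>2 \<zeta>)))"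
  shows "\<mu> \<in> borel_probs" "\<gamma> \<in> couplings \<nu> \<mu>"
    and "transport_cost p \<gamma> = ennreal q * (\<integral>\<^sup>+\<zeta>. ennreal (dist (T\<^sub>1 \<zeta>) \<zeta> powr p) \<partial>\<nu>)
        + ennreal (1 - q) * (\<integral>\<^sup>+\<zeta>. ennreal (dist (T\<^sub>2 \<zeta>) \<zeta> powr p) \<partial>\<nu>)"
    and "Wpp p \<mu> \<nu> \<le> transport_cost p \<gamma>"
proof -
  note [measurable_cong] = borel_probsD(1)[OF \<nu>]

  have P [measurable]: "(\<lambda>\<zeta>. (\<zeta>, T \<zeta>)) \<in> borel \<rightarrow>\<^sub>M borel" if [measurable]: "T \<in> borel \<rightarrow>\<^sub>M (borel :: 'a measure)" for T :: "'a \<Rightarrow> 'a"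
    using borel_measurable_Pair[OF measurable_ident_sets[OF refl] that] by (simp add: id_def)
  note pT = push_borel[OF \<nu> T(1)] push_borel[OF \<nu> T(2)] push_borel[OF \<nu> P[OF T(1)]] push_borel[OF \<nu> P[OF T(2)]]
  show \<mu>: "\<mu> \<in> borel_probs" unfolding \<mu>_def
    by (intro mixture_in_borel_probs push_in_borel_probs nu_measurable_borel \<nu> T q)
  have \<gamma>: "\<gamma> \<in> borel_probs" unfolding \<gamma>_def
    by (intro mixture_in_borel_probs push_in_borel_probs nu_measurable_borel \<nu> P T q)
  note fs [measurable] = borel_measurable_fst_snd[where 'a = 'a and 'b = 'a]
  note [measurable_cong] = borel_probsD(1)[OF \<gamma>]
  have "distr \<gamma> borel fst = \<nu>"
  proof (rule measure_eqI)
    show "sets (distr \<gamma> borel fst) = sets \<nu>" by (simp add: borel_probsD[OF \<nu>])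
    fix A assume "A \<in> sets (distr \<gamma> borel fst)"
    then have A [measurable]: "A \<in> sets borel" by simp
    have A': "fst -` A \<in> sets (borel :: ('a \<times> 'a) measure)"
      using measurable_sets[OF fs(1) A] by simp
    have "emeasure (distr \<gamma> borel fst) A = emeasure \<gamma> (fst -` A)"
      by (subst emeasure_distr) (auto simp: borel_probsD[OF \<gamma>])
    also have "\<dots> = ennreal q * emeasure \<nu> A + ennreal (1 - q) * emeasure \<nu> A"
      unfolding \<gamma>_def pT using A'
      by (subst emeasure_mixture) (auto simp: emeasure_distr vimage_def borel_probsD[OF \<nu>])
    also have "\<dots> = emeasure \<nu> A"
      using q by (simp add: distrib_right[symmetric] ennreal_plus[symmetric] del: ennreal_plus)
    finally show "emeasure (distr \<gamma> borel fst) A = emeasure \<nu> A" .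
  qed
  moreover have "distr \<gamma> borel snd = \<mu>"
  proof (rule measure_eqI)
    show "sets (distr \<gamma> borel snd) = sets \<mu>" by (simp add: borel_probsD[OF \<mu>])
    fix A assume "A \<in> sets (distr \<gamma> borel snd)"
    then have A [measurable]: "A \<in> sets borel" by simp
    have A': "snd -` A \<in> sets (borel :: ('a \<times> 'a) measure)"
      using measurable_sets[OF fs(2) A] by simp
    have "emeasure (distr \<gamma> borel snd) A = emeasure \<gamma> (snd -` A)"
      by (subst emeasure_distr) (auto simp: borel_probsD[OF \<gamma>])
    also have "\<dots> = emeasure \<mu> A"
      unfolding \<gamma>_def \<mu>_def pT using A'
      by (subst (1 2) emeasure_mixture) (auto simp: emeasure_distr vimage_def borel_probsD[OF \<nu>])
    finally show "emeasure (distr \<gamma> borel snd) A = emeasure \<mu> A" .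
  qed
  ultimately show c: "\<gamma> \<in> couplings \<nu> \<mu>" unfolding couplings_def using \<gamma> by auto
  note [measurable] = borel_measurable_cost[where 'a = 'a]
  show "transport_cost p \<gamma> = ennreal q * (\<integral>\<^sup>+\<zeta>. ennreal (dist (T\<^sub>1 \<zeta>) \<zeta> powr p) \<partial>\<nu>)
        + ennreal (1 - q) * (\<integral>\<^sup>+\<zeta>. ennreal (dist (T\<^sub>2 \<zeta>) \<zeta> powr p) \<partial>\<nu>)"
    unfolding transport_cost_def \<gamma>_def pT
    by (subst nn_integral_mixture) (auto simp: nn_integral_distr dist_commute)
  show "Wpp p \<mu> \<nu> \<le> transport_cost p \<gamma>"
    unfolding Wpp_def using couplings_swap[OF c] by (metis INF_lower)
qed

lemma ereal_integral_mixture_push: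
  assumes \<nu>: "\<nu> \<in> borel_probs" and T [measurable]: "T\<^sub>1 \<in> borel \<rightarrow>\<^sub>M borel" "T\<^sub>2 \<in> borel \<rightarrow>\<^sub>M borel"
    and q: "q \<in> {0..1}" and f [measurable]: "f \<in> borel_measurable borel"
    and int: "integrable \<nu> (\<lambda>\<zeta>. f (T\<^sub>1 \<zeta>))" "integrable \<nu> (\<lambda>\<zeta>. f (T\<^sub>2 \<zeta>))"
  shows "ereal_integral (mixture q (push \<nu> T\<^sub>1) (push \<nu> T\<^sub>2)) (\<lambda>\<xi>. ereal (f \<xi>)) =
    ereal (q * (\<integral>\<zeta>. f (T\<^sub>1 \<zeta>) \<partial>\<nu>) + (1 - q) * (\<integral>\<zeta>. f (T\<^sub>2 \<zeta>) \<partial>\<nu>))"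
proof -
  note [measurable_cong] = borel_probsD(1)[OF \<nu>]
  obtain a1 b1 where 1: "a1 \<ge> 0" "b1 \<ge> 0" "(\<integral>\<^sup>+x. ennreal (f (T\<^sub>1 x)) \<partial>\<nu>) = ennreal a1" "(\<integral>\<^sup>+x. ennreal (- f (T\<^sub>1 x)) \<partial>\<nu>) = ennreal b1"
    "(\<integral>\<zeta>. f (T\<^sub>1 \<zeta>) \<partial>\<nu>) = a1 - b1" by (rule integrable_parts[OF int(1)])
  obtain a2 b2 where 2: "a2 \<ge> 0" "b2 \<ge> 0" "(\<integral>\<^sup>+x. ennreal (f (T\<^sub>2 x)) \<partial>\<nu>) = ennreal a2" "(\<integral>\<^sup>+x. ennreal (- f (T\<^sub>2 x)) \<partial>\<nu>) = ennreal b2"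
    "(\<integral>\<zeta>. f (T\<^sub>2 \<zeta>) \<partial>\<nu>) = a2 - b2" by (rule integrable_parts[OF int(2)])
  have "(\<integral>\<^sup>+x. ennreal (g x) \<partial>mixture q (push \<nu> T\<^sub>1) (push \<nu> T\<^sub>2)) =
    ennreal q * (\<integral>\<^sup>+x. ennreal (g (T\<^sub>1 x)) \<partial>\<nu>) + ennreal (1 - q) * (\<integral>\<^sup>+x. ennreal (g (T\<^sub>2 x)) \<partial>\<nu>)"
    if [measurable]: "g \<in> borel_measurable borel" for g
    unfolding push_borel[OF \<nu> T(1)] push_borel[OF \<nu> T(2)]
    by (subst nn_integral_mixture) (auto simp: nn_integral_distr)
  note this[of f] this[of "\<lambda>x. - f x"]
  then have "(\<integral>\<^sup>+x. ennreal (f x) \<partial>mixture q (push \<nu> T\<^sub>1) (push \<nu> T\<^sub>2)) = ennreal (q * a1 + (1 - q) * a2)"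
    "(\<integral>\<^sup>+x. ennreal (- f x) \<partial>mixture q (push \<nu> T\<^sub>1) (push \<nu> T\<^sub>2)) = ennreal (q * b1 + (1 - q) * b2)"
    using 1 2 q by (auto simp: ennreal_plus ennreal_mult)
  moreover have "0 \<le> q * a1 + (1 - q) * a2" "0 \<le> q * b1 + (1 - q) * b2" using 1 2 q by auto
  ultimately show ?thesis using 1 2
    unfolding ereal_integral_def by (simp add: e2ennreal_ereal enn2ereal_ennreal) (simp add: algebra_simps)
qed

section \<open>Gains and the dual objective\<close>

text \<open>The radius is not a parameter, since the dual minimizers are compared over different radii.\<close>

locale transport_problem = proper_polish space_type for space_type :: "'a::polish_space itself" +
  fixes \<nu> :: "'a measure" and \<Psi> :: "'a \<Rightarrow> real" and p \<kappa> :: real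
  assumes p: "1 \<le> p" and \<nu>: "\<nu> \<in> borel_probs" and usc: "usc \<Psi>"
    and int: "integrable \<nu> \<Psi>" and growth: "growth_rate p \<Psi> \<nu> = ereal \<kappa>"
begin

sublocale prob_space \<nu> using \<nu> by (rule borel_probsD)

lemma sets_\<nu> [simp, measurable_cong]: "sets \<nu> = sets borel"
  and space_\<nu> [simp]: "space \<nu> = UNIV"
  using \<nu> by (simp_all add: borel_probsD)

lemma \<Psi>_borel [measurable]: "\<Psi> \<in> borel_measurable borel"
  using usc by (rule usc_borel_measurable)

abbreviation "Argmin \<equiv> argmin_set p \<Psi>"
abbreviation "Minimizers \<equiv> dual_minimizers p \<Psi> \<nu>"
abbreviation "D_lower \<equiv> D0_lower p \<Psi>"
abbreviation "D_upper \<equiv> D0_upper p \<Psi>"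
abbreviation "Primal \<equiv> primal_value p \<Psi> \<nu>"
abbreviation "Dual \<equiv> dual_value p \<Psi> \<nu>"
abbreviation "Worst \<equiv> worst_case p \<Psi> \<nu>"

definition gain :: "real \<Rightarrow> 'a \<Rightarrow> 'a \<Rightarrow> real" where
  "gain l \<xi> \<zeta> = \<Psi> \<xi> - \<Psi> \<zeta> - l * dist \<xi> \<zeta> powr p"

text \<open>Staying put gains \<open>0\<close>, so the supremum is nonnegative and nothing is lost by taking it in
  \<open>[0, \<infinity>]\<close>.\<close>

definition max_gain :: "real \<Rightarrow> 'a \<Rightarrow> ennreal" where
  "max_gain l \<zeta> = (SUP \<xi>. ennreal (gain l \<xi> \<zeta>))"

definition total_gain :: "real \<Rightarrow> ennreal" where
  "total_gain l = (\<integral>\<^sup>+\<zeta>. max_gain l \<zeta> \<partial>\<nu>)"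

text \<open>The dual objective less the constant \<open>\<integral>\<Psi> d\<nu>\<close>.\<close>

definition dual_excess :: "real \<Rightarrow> real \<Rightarrow> ennreal" where
  "dual_excess t l = ennreal (l * t powr p) + total_gain l"

lemma gain_self [simp]: "gain l \<zeta> \<zeta> = 0"
  using p by (simp add: gain_def)

lemma gain_shift: "gain l' \<xi> \<zeta> = gain l \<xi> \<zeta> + (l - l') * dist \<xi> \<zeta> powr p"
  by (simp add: gain_def algebra_simps)

lemma gain_le_max_gain: "ennreal (gain l \<xi> \<zeta>) \<le> max_gain l \<zeta>"
  unfolding max_gain_def by (rule SUP_upper) simp

lemma continuous_cost: "continuous_on UNIV (\<lambda>x :: 'b::topological_space. dist (f x) (g x :: 'a) powr p)"
  if "continuous_on UNIV f" "continuous_on UNIV g" for f g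
proof -
  have "continuous_on {0..} (\<lambda>x::real. x powr p)"
    using p by (intro continuous_on_powr') (auto intro: continuous_intros)
  moreover have "continuous_on UNIV (\<lambda>x. dist (f x) (g x))" using that by (rule continuous_on_dist)
  ultimately show ?thesis by (rule continuous_on_compose2) auto
qed

lemma usc_gain_target: "usc (\<lambda>\<xi>. gain l \<xi> \<zeta>)"
proof -
  have "usc (\<lambda>\<xi>. \<Psi> \<xi> + (- \<Psi> \<zeta> - l * dist \<xi> \<zeta> powr p))"
    by (intro usc_add_continuous usc continuous_intros continuous_cost)
  then show ?thesis by (simp add: gain_def algebra_simps)
qed

lemma usc_neg_gain_source: "usc (\<lambda>\<zeta>. - gain l \<xi> \<zeta>)"
proof -
  have "usc (\<lambda>\<zeta>. \<Psi> \<zeta> + (- \<Psi> \<xi> + l * dist \<xi> \<zeta> powr p))"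
    by (intro usc_add_continuous usc continuous_intros continuous_cost)
  then show ?thesis by (simp add: gain_def algebra_simps)
qed

text \<open>A supremum over uncountably many targets stays measurable because each gain is lower semicontinuous
  in the source: the superlevel sets are unions of open sets.\<close>

lemma max_gain_measurable [measurable]: "max_gain l \<in> borel_measurable borel"
proof (rule borel_measurableI_greater)
  fix y :: ennreal
  have "open {\<zeta>. y < ennreal (gain l \<xi> \<zeta>)}" for \<xi>
  proof (cases y)
    case (real r)
    then have "{\<zeta>. y < ennreal (gain l \<xi> \<zeta>)} = {\<zeta>. - gain l \<xi> \<zeta> < - r}"
      by (auto simp: ennreal_less_iff)
    moreover have "open {\<zeta>. - gain l \<xi> \<zeta> < - r}" by (rule usc_open_sublevel[OF usc_neg_gain_source])
    ultimately show ?thesis by simp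
  qed auto
  then have "open (\<Union>\<xi>. {\<zeta>. y < ennreal (gain l \<xi> \<zeta>)})" by auto
  moreover have "{\<zeta> \<in> space borel. y < max_gain l \<zeta>} = (\<Union>\<xi>. {\<zeta>. y < ennreal (gain l \<xi> \<zeta>)})"
    unfolding max_gain_def by (auto simp: less_SUP_iff)
  ultimately show "{\<zeta> \<in> space borel. y < max_gain l \<zeta>} \<in> sets borel" by simp
qed

lemma Phi_eq: "Phi p \<Psi> l \<zeta> = ereal (- \<Psi> \<zeta>) - enn2ereal (max_gain l \<zeta>)"
proof (rule antisym)
  have le: "Phi p \<Psi> l \<zeta> \<le> ereal (l * dist \<xi> \<zeta> powr p - \<Psi> \<xi>)" for \<xi>
    unfolding Phi_def by (rule INF_lower) simp
  from le[of \<zeta>] have 0: "Phi p \<Psi> l \<zeta> \<le> ereal (- \<Psi> \<zeta>)" using p by simp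
  have "max_gain l \<zeta> \<le> e2ennreal (ereal (- \<Psi> \<zeta>) - Phi p \<Psi> l \<zeta>)"
    unfolding max_gain_def
  proof (rule SUP_least)
    fix \<xi>
    have "ereal (gain l \<xi> \<zeta>) \<le> ereal (- \<Psi> \<zeta>) - Phi p \<Psi> l \<zeta>"
      using le[of \<xi>] by (cases "Phi p \<Psi> l \<zeta>") (auto simp: gain_def)
    then have "e2ennreal (ereal (gain l \<xi> \<zeta>)) \<le> e2ennreal (ereal (- \<Psi> \<zeta>) - Phi p \<Psi> l \<zeta>)"
      by (rule e2ennreal_mono)
    then show "ennreal (gain l \<xi> \<zeta>) \<le> e2ennreal (ereal (- \<Psi> \<zeta>) - Phi p \<Psi> l \<zeta>)" by simp
  qed
  then have "enn2ereal (max_gain l \<zeta>) \<le> ereal (- \<Psi> \<zeta>) - Phi p \<Psi> l \<zeta>"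
    using 0 by (subst (asm) less_eq_ennreal.rep_eq, subst (asm) enn2ereal_e2ennreal)
       (cases "Phi p \<Psi> l \<zeta>", auto)
  then show "Phi p \<Psi> l \<zeta> \<le> ereal (- \<Psi> \<zeta>) - enn2ereal (max_gain l \<zeta>)"
    using 0 enn2ereal_nonneg[of "max_gain l \<zeta>"]
    by (cases "Phi p \<Psi> l \<zeta>"; cases "enn2ereal (max_gain l \<zeta>)") auto
  show "ereal (- \<Psi> \<zeta>) - enn2ereal (max_gain l \<zeta>) \<le> Phi p \<Psi> l \<zeta>"
    unfolding Phi_def
  proof (rule INF_greatest)
    fix \<xi>
    have "ereal (gain l \<xi> \<zeta>) \<le> enn2ereal (ennreal (gain l \<xi> \<zeta>))"
      by (cases "gain l \<xi> \<zeta> \<ge> 0") (auto simp: enn2ereal_ennreal ennreal_neg zero_ennreal.rep_eq)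
    also have "\<dots> \<le> enn2ereal (max_gain l \<zeta>)"
      using gain_le_max_gain by (simp add: less_eq_ennreal.rep_eq)
    finally show "ereal (- \<Psi> \<zeta>) - enn2ereal (max_gain l \<zeta>) \<le> ereal (l * dist \<xi> \<zeta> powr p - \<Psi> \<xi>)"
      by (cases "enn2ereal (max_gain l \<zeta>)") (auto simp: gain_def)
  qed
qed

lemma argmin_iff: "\<xi> \<in> Argmin l \<zeta> \<longleftrightarrow> (\<forall>\<eta>. gain l \<eta> \<zeta> \<le> gain l \<xi> \<zeta>)"
proof -
  have "\<xi> \<in> Argmin l \<zeta> \<longleftrightarrow> ereal (l * dist \<xi> \<zeta> powr p - \<Psi> \<xi>) \<le> Phi p \<Psi> l \<zeta>"
    unfolding argmin_set_def Phi_def by (auto intro: antisym INF_lower)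
  also have "\<dots> \<longleftrightarrow> (\<forall>\<eta>. gain l \<eta> \<zeta> \<le> gain l \<xi> \<zeta>)"
    unfolding Phi_def le_INF_iff gain_def by (auto simp: algebra_simps)
  finally show ?thesis .
qed

lemma argmin_max_gain:
  assumes "\<xi> \<in> Argmin l \<zeta>"
  shows "0 \<le> gain l \<xi> \<zeta>" "max_gain l \<zeta> = ennreal (gain l \<xi> \<zeta>)"
proof -
  have *: "gain l \<eta> \<zeta> \<le> gain l \<xi> \<zeta>" for \<eta> using assms argmin_iff by blast
  from *[of \<zeta>] show "0 \<le> gain l \<xi> \<zeta>" by simp
  show "max_gain l \<zeta> = ennreal (gain l \<xi> \<zeta>)"
    by (rule antisym) (auto simp: max_gain_def intro!: SUP_least SUP_upper ennreal_leI *)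
qed

lemma max_gain_antimono: "l \<le> l' \<Longrightarrow> max_gain l' \<zeta> \<le> max_gain l \<zeta>"
  unfolding max_gain_def
proof (rule SUP_mono')
  fix \<xi> assume "l \<le> l'"
  then show "ennreal (gain l' \<xi> \<zeta>) \<le> ennreal (gain l \<xi> \<zeta>)"
    by (intro ennreal_leI) (auto simp: gain_def intro!: mult_right_mono)
qed

text \<open>A point of the argmin set at price \<open>l\<close> competes at price \<open>l'\<close>, where its gain differs by \<open>(l - l')\<close>
  times its cost. Thus costs of argmin points are, up to sign, subgradients of the convex function
  \<open>max_gain\<close> of the price; both one-sided forms are needed.\<close>

lemma argmin_gain_lower:
  assumes "\<xi> \<in> Argmin l \<zeta>" "l' \<le> l"
  shows "max_gain l \<zeta> + ennreal ((l - l') * dist \<xi> \<zeta> powr p) \<le> max_gain l' \<zeta>"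
proof -
  have "max_gain l \<zeta> + ennreal ((l - l') * dist \<xi> \<zeta> powr p) = ennreal (gain l' \<xi> \<zeta>)"
    using argmin_max_gain[OF assms(1)] assms(2)
    by (simp add: gain_shift[of l' _ _ l] ennreal_plus[symmetric] del: ennreal_plus)
  then show ?thesis using gain_le_max_gain by simp
qed

lemma argmin_gain_upper:
  assumes "\<xi> \<in> Argmin l \<zeta>" "l \<le> l'"
  shows "max_gain l \<zeta> \<le> max_gain l' \<zeta> + ennreal ((l' - l) * dist \<xi> \<zeta> powr p)"
proof -
  have "max_gain l \<zeta> = ennreal (gain l' \<xi> \<zeta> + (l' - l) * dist \<xi> \<zeta> powr p)"
    using argmin_max_gain[OF assms(1)] by (simp add: gain_shift[of l _ _ l'])
  also have "\<dots> \<le> ennreal (gain l' \<xi> \<zeta>) + ennreal ((l' - l) * dist \<xi> \<zeta> powr p)"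
  proof (cases "gain l' \<xi> \<zeta> \<ge> 0")
    case True then show ?thesis using assms(2) by (simp add: ennreal_plus)
  next
    case False then show ?thesis using assms(2) by (auto simp: ennreal_neg intro!: ennreal_leI)
  qed
  also have "\<dots> \<le> max_gain l' \<zeta> + ennreal ((l' - l) * dist \<xi> \<zeta> powr p)"
    by (intro add_right_mono gain_le_max_gain)
  finally show ?thesis .
qed

lemma max_gain_right_continuous: "max_gain l \<zeta> = (SUP n. max_gain (l + 1 / Suc n) \<zeta>)"
proof -
  have *: "ennreal (gain l \<xi> \<zeta>) = (SUP n. ennreal (gain (l + 1 / Suc n) \<xi> \<zeta>))" for \<xi>
  proof (rule LIMSEQ_unique)
    have "(\<lambda>n. l + 1 / real (Suc n)) \<longlonglongrightarrow> l + 0"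
      by (intro tendsto_add tendsto_const LIMSEQ_Suc[OF lim_const_over_n])
    then have "(\<lambda>n. gain (l + 1 / Suc n) \<xi> \<zeta>) \<longlonglongrightarrow> gain (l + 0) \<xi> \<zeta>"
      unfolding gain_def by (rule tendsto_diff[OF tendsto_const tendsto_mult[OF _ tendsto_const]])
    then show "(\<lambda>n. ennreal (gain (l + 1 / Suc n) \<xi> \<zeta>)) \<longlonglongrightarrow> ennreal (gain l \<xi> \<zeta>)"
      by (intro tendsto_ennrealI) simp
    have "incseq (\<lambda>n. ennreal (gain (l + 1 / Suc n) \<xi> \<zeta>))"
      unfolding incseq_def gain_def
      by (auto intro!: ennreal_leI mult_right_mono divide_left_mono)
    then show "(\<lambda>n. ennreal (gain (l + 1 / Suc n) \<xi> \<zeta>)) \<longlonglongrightarrow> (SUP n. ennreal (gain (l + 1 / Suc n) \<xi> \<zeta>))"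
      by (rule LIMSEQ_SUP)
  qed
  show ?thesis unfolding max_gain_def by (subst *) (rule SUP_commute)
qed

lemma total_gain_antimono: "l \<le> l' \<Longrightarrow> total_gain l' \<le> total_gain l"
  unfolding total_gain_def by (intro nn_integral_mono max_gain_antimono)

lemma total_gain_right_continuous: "total_gain l = (SUP n. total_gain (l + 1 / Suc n))"
proof -
  have "total_gain l = (\<integral>\<^sup>+\<zeta>. (SUP n. max_gain (l + 1 / Suc n) \<zeta>) \<partial>\<nu>)"
    unfolding total_gain_def by (intro nn_integral_cong max_gain_right_continuous)
  also have "\<dots> = (SUP n. total_gain (l + 1 / Suc n))"
    unfolding total_gain_def
    by (intro nn_integral_monotone_convergence_SUP)
      (auto simp: incseq_def le_fun_def intro!: max_gain_antimono divide_left_mono)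
  finally show ?thesis .
qed

lemma ereal_integral_Phi:
  "ereal_integral \<nu> (Phi p \<Psi> l) = ereal (- (\<integral>\<zeta>. \<Psi> \<zeta> \<partial>\<nu>)) - enn2ereal (total_gain l)"
proof -
  have "Phi p \<Psi> l = (\<lambda>\<zeta>. ereal (- \<Psi> \<zeta>) - enn2ereal (max_gain l \<zeta>))" by (auto simp: Phi_eq)
  then show ?thesis
    using ereal_integral_diff_enn[of \<nu> "\<lambda>\<zeta>. - \<Psi> \<zeta>" "max_gain l"] int
    unfolding total_gain_def by simp
qed

lemma dual_objective_eq:
  assumes "0 \<le> l"
  shows "dual_objective p \<Psi> \<nu> t l = ereal (\<integral>\<zeta>. \<Psi> \<zeta> \<partial>\<nu>) + enn2ereal (dual_excess t l)"
  unfolding dual_objective_def ereal_integral_Phi dual_excess_def plus_ennreal.rep_eq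
  using assms by (cases "total_gain l") (auto simp: enn2ereal_ennreal)

lemma ereal_add_enn2ereal_le_iff:
  "ereal c + enn2ereal a \<le> ereal c + enn2ereal b \<longleftrightarrow> a \<le> b"
  by (cases a; cases b) (auto simp: enn2ereal_ennreal top_unique)

lemma dual_minimizers_eq:
  "Minimizers t = {l\<in>{0..}. \<forall>l'\<in>{0..}. dual_excess t l \<le> dual_excess t l'}"
  unfolding dual_minimizers_def by (auto simp: dual_objective_eq ereal_add_enn2ereal_le_iff)

lemma dual_value_minimizer:
  assumes "l \<in> Minimizers t"
  shows "Dual t = ereal (\<integral>\<zeta>. \<Psi> \<zeta> \<partial>\<nu>) + enn2ereal (dual_excess t l)"
proof -
  have "Dual t = dual_objective p \<Psi> \<nu> t l"
    using assms unfolding dual_value_def dual_minimizers_def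
    by (auto intro!: antisym INF_lower INF_greatest)
  then show ?thesis using assms unfolding dual_minimizers_def by (simp add: dual_objective_eq)
qed

lemma \<kappa>_eq: "ereal \<kappa> = Inf (ereal ` {l\<in>{0..}. total_gain l < \<infinity>})"
proof -
  have "ereal_integral \<nu> (Phi p \<Psi> l) > -\<infinity> \<longleftrightarrow> total_gain l < \<infinity>" for l
    unfolding ereal_integral_Phi by (cases "total_gain l") (auto simp: enn2ereal_ennreal)
  then show ?thesis using growth unfolding growth_rate_def by simp
qed

lemma \<kappa>_nonneg: "0 \<le> \<kappa>"
proof -
  have "ereal 0 \<le> ereal \<kappa>" unfolding \<kappa>_eq by (rule Inf_greatest) auto
  then show ?thesis by simp
qed

lemma total_gain_finite:
  assumes "\<kappa> < l" shows "total_gain l < \<infinity>"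
proof -
  have "Inf (ereal ` {l\<in>{0..}. total_gain l < \<infinity>}) < ereal l" using assms unfolding \<kappa>_eq[symmetric] by simp
  then obtain l' where "l' < l" "total_gain l' < \<infinity>" by (auto simp: Inf_less_iff)
  then show ?thesis using total_gain_antimono[of l' l] by (auto intro: le_less_trans)
qed

lemma total_gain_infinite:
  assumes "0 \<le> l" "l < \<kappa>" shows "total_gain l = \<infinity>"
proof (rule ccontr)
  assume "total_gain l \<noteq> \<infinity>"
  then have "Inf (ereal ` {l\<in>{0..}. total_gain l < \<infinity>}) \<le> ereal l"
    using assms by (intro Inf_lower) (auto simp: less_top)
  then show False using assms unfolding \<kappa>_eq[symmetric] by simp
qed

text \<open>Monotonicity bounds \<open>total_gain\<close> along the sequence from below by its values to the right of the limit, and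
  right continuity takes these values to the limit.\<close>

lemma dual_excess_lower_semicontinuous:
  assumes "\<And>n. 0 \<le> X n" "X \<longlonglongrightarrow> l" "\<And>n. dual_excess t (X n) \<le> Y n" "Y \<longlonglongrightarrow> y" "0 \<le> t"
  shows "dual_excess t l \<le> y"
proof -
  have *: "ennreal (l * t powr p) + total_gain (l + 1 / Suc m) \<le> y" for m
  proof (rule LIMSEQ_le)
    have "(\<lambda>n. X n * t powr p) \<longlonglongrightarrow> l * t powr p" using assms(2) by (intro tendsto_intros)
    then show "(\<lambda>n. ennreal (X n * t powr p) + total_gain (l + 1 / Suc m)) \<longlonglongrightarrow> ennreal (l * t powr p) + total_gain (l + 1 / Suc m)"
      by (intro tendsto_add tendsto_ennrealI tendsto_const)
    show "Y \<longlonglongrightarrow> y" by fact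
    have "eventually (\<lambda>n. X n < l + 1 / Suc m) sequentially"
      using order_tendstoD(2)[OF assms(2), of "l + 1 / Suc m"] by simp
    then obtain N where N: "\<And>n. n \<ge> N \<Longrightarrow> X n < l + 1 / Suc m" by (auto simp: eventually_sequentially)
    show "\<exists>N. \<forall>n\<ge>N. ennreal (X n * t powr p) + total_gain (l + 1 / Suc m) \<le> Y n"
    proof (intro exI allI impI)
      fix n assume "N \<le> n"
      then have "ennreal (X n * t powr p) + total_gain (l + 1 / Suc m) \<le> dual_excess t (X n)"
        unfolding dual_excess_def using N[of n] by (intro add_left_mono total_gain_antimono) auto
      also have "\<dots> \<le> Y n" by fact
      finally show "ennreal (X n * t powr p) + total_gain (l + 1 / Suc m) \<le> Y n" .
    qed
  qed
  have "dual_excess t l = (SUP m. ennreal (l * t powr p) + total_gain (l + 1 / Suc m))"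
    unfolding dual_excess_def by (subst total_gain_right_continuous) (simp add: ennreal_SUP_add_right)
  then show ?thesis using * by (auto intro: SUP_least)
qed

text \<open>Minimizing sequences are bounded, as \<open>dual_excess t l\<close> is at least \<open>l * t powr p\<close>.\<close>

lemma dual_minimizer_exists:
  assumes "0 < t"
  shows "Minimizers t \<noteq> {}"
proof -
  define m where "m = (INF l\<in>{0..}. dual_excess t l)"
  have "m \<le> dual_excess t (\<kappa> + 1)" unfolding m_def using \<kappa>_nonneg by (intro INF_lower) auto
  also have "\<dots> < \<infinity>" unfolding dual_excess_def using total_gain_finite[of "\<kappa> + 1"] by simp
  finally have m_fin: "m < \<infinity>" .
  have "\<exists>l\<ge>0. dual_excess t l < m + ennreal (1 / Suc n)" for n
  proof -
    have "m < m + ennreal (1 / Suc n)" using m_fin by (cases m) (auto simp: ennreal_plus[symmetric] ennreal_less_iff simp del: ennreal_plus)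
    then show ?thesis by (subst (asm) (1) m_def) (auto simp: INF_less_iff)
  qed
  then obtain X where X: "\<And>n. 0 \<le> X n" "\<And>n. dual_excess t (X n) < m + ennreal (1 / Suc n)" by metis
  obtain mr where mr: "m = ennreal mr" "0 \<le> mr" using m_fin by (cases m) auto
  have tp: "0 < t powr p" using assms by simp
  have "X n \<in> {0..(mr + 1) / t powr p}" for n
  proof -
    have "ennreal (X n * t powr p) \<le> dual_excess t (X n)" unfolding dual_excess_def by simp
    also have "\<dots> \<le> m + ennreal (1 / Suc n)" using X(2)[of n] by simp
    also have "\<dots> \<le> m + ennreal 1" by (intro add_left_mono ennreal_leI) simp
    also have "\<dots> = ennreal (mr + 1)" using mr by (simp add: ennreal_plus)
    finally have "X n * t powr p \<le> mr + 1" using mr by (subst (asm) ennreal_le_iff) auto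
    then show ?thesis using X(1) tp by (simp add: pos_le_divide_eq)
  qed
  then obtain l r where l: "strict_mono r" "(X \<circ> r) \<longlonglongrightarrow> l" "l \<in> {0..(mr + 1) / t powr p}"
    using compact_Icc[of 0 "(mr + 1) / t powr p"] unfolding compact_def by metis
  have "dual_excess t l \<le> m"
  proof (rule dual_excess_lower_semicontinuous[OF _ l(2)])
    have "(\<lambda>n. 1 / real (Suc n)) \<longlonglongrightarrow> 0" by (intro LIMSEQ_Suc lim_const_over_n)
    from tendsto_add[OF tendsto_const tendsto_ennrealI[OF this], of m]
    have 1: "(\<lambda>n. m + ennreal (1 / Suc n)) \<longlonglongrightarrow> m" by simp
    show "(\<lambda>n. m + ennreal (1 / Suc (r n))) \<longlonglongrightarrow> m"
      using LIMSEQ_subseq_LIMSEQ[OF 1 l(1)] by (simp add: comp_def)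
  qed (use X assms in \<open>auto intro: less_imp_le\<close>)
  then have "l \<in> Minimizers t"
    unfolding dual_minimizers_eq m_def using l(3) by (auto intro: order_trans INF_lower)
  then show ?thesis by auto
qed

lemma dual_minimizer_finite:
  assumes "l \<in> Minimizers t"
  shows "\<kappa> \<le> l" "0 \<le> l" "total_gain l < \<infinity>" "dual_excess t l < \<infinity>"
proof -
  show "0 \<le> l" using assms unfolding dual_minimizers_eq by auto
  have "dual_excess t l \<le> dual_excess t (\<kappa> + 1)" using assms \<kappa>_nonneg unfolding dual_minimizers_eq by auto
  also have "\<dots> < \<infinity>" unfolding dual_excess_def using total_gain_finite[of "\<kappa> + 1"] by simp
  finally show "dual_excess t l < \<infinity>" .
  then show f: "total_gain l < \<infinity>" unfolding dual_excess_def by simp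
  show "\<kappa> \<le> l" using total_gain_infinite[of l] f \<open>0 \<le> l\<close> by (metis less_irrefl not_le)
qed

lemma AE_max_gain_finite:
  assumes "total_gain l < \<infinity>" shows "AE \<zeta> in \<nu>. max_gain l \<zeta> < \<infinity>"
  using nn_integral_PInf_AE[of "max_gain l" \<nu>] assms unfolding total_gain_def by (auto simp: less_top)

text \<open>One null set serves all prices: by monotonicity a sequence of prices decreasing to the growth rate
  suffices.\<close>

lemma AE_max_gain_finite_above: "AE \<zeta> in \<nu>. \<forall>l>\<kappa>. max_gain l \<zeta> < \<infinity>"
proof -
  have "AE \<zeta> in \<nu>. \<forall>n::nat. max_gain (\<kappa> + 1 / Suc n) \<zeta> < \<infinity>"
    unfolding AE_all_countable by (intro allI AE_max_gain_finite total_gain_finite) simp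
  then show ?thesis
  proof eventually_elim
    case (elim \<zeta>)
    show ?case
    proof safe
      fix l assume "\<kappa> < l"
      then obtain n where "1 / real (Suc n) < l - \<kappa>" using nat_approx_posE[of "l - \<kappa>"] by auto
      then have "max_gain l \<zeta> \<le> max_gain (\<kappa> + 1 / Suc n) \<zeta>" by (intro max_gain_antimono) simp
      with elim show "max_gain l \<zeta> < \<infinity>" by (meson le_less_trans)
    qed
  qed
qed

lemma cost_le_iff: "0 \<le> c \<Longrightarrow> dist \<xi> \<zeta> powr p \<le> c \<longleftrightarrow> dist \<xi> \<zeta> \<le> c powr (1 / p)"
proof
  assume "dist \<xi> \<zeta> powr p \<le> c"
  then have "(dist \<xi> \<zeta> powr p) powr (1 / p) \<le> c powr (1 / p)" using p by (intro powr_mono2) auto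
  then show "dist \<xi> \<zeta> \<le> c powr (1 / p)" using p by (simp add: powr_powr)
next
  assume "0 \<le> c" "dist \<xi> \<zeta> \<le> c powr (1 / p)"
  then have "dist \<xi> \<zeta> powr p \<le> (c powr (1 / p)) powr p" using p by (intro powr_mono2) auto
  then show "dist \<xi> \<zeta> powr p \<le> c" using p \<open>0 \<le> c\<close> by (simp add: powr_powr)
qed

text \<open>A target with positive gain at price \<open>l\<close> satisfies \<open>(l - l') * dist \<xi> \<zeta> powr p \<le> max_gain l' \<zeta>\<close>. All
  competitors of \<open>\<zeta>\<close> itself therefore lie in a ball, which is compact.\<close>

lemma argmin_exists:
  assumes fin: "max_gain l' \<zeta> < \<infinity>" and l: "l' < l"
  shows "Argmin l \<zeta> \<noteq> {}"
proof -
  obtain a where a: "max_gain l' \<zeta> = ennreal a" "0 \<le> a" using fin by (cases "max_gain l' \<zeta>") auto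
  define K where "K = cball \<zeta> ((a / (l - l')) powr (1 / p))"
  have K: "compact K" "\<zeta> \<in> K" unfolding K_def using compact_cball_proper by auto
  obtain \<xi> where \<xi>: "\<xi> \<in> K" "\<forall>\<eta>\<in>K. gain l \<eta> \<zeta> \<le> gain l \<xi> \<zeta>"
    using usc_attains_sup[OF usc_gain_target K(1)] K(2) by blast
  have "gain l \<eta> \<zeta> \<le> gain l \<xi> \<zeta>" for \<eta>
  proof (cases "0 < gain l \<eta> \<zeta>")
    case True
    have "ennreal (gain l' \<eta> \<zeta>) \<le> ennreal a" using gain_le_max_gain a by metis
    then have "gain l' \<eta> \<zeta> \<le> a" using a by (simp add: ennreal_le_iff)
    then have "(l - l') * dist \<eta> \<zeta> powr p \<le> a" using True gain_shift[of l' \<eta> \<zeta> l] by simp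
    then have "dist \<eta> \<zeta> powr p \<le> a / (l - l')" using l by (simp add: pos_le_divide_eq mult.commute)
    then have "\<eta> \<in> K" unfolding K_def using a l by (subst (asm) cost_le_iff) (auto simp: dist_commute)
    then show ?thesis using \<xi> by blast
  next
    case False
    then show ?thesis using \<xi>(2) K(2) by force
  qed
  then show ?thesis using argmin_iff by blast
qed

lemma AE_argmin_exists:
  assumes "\<kappa> < l"
  shows "AE \<zeta> in \<nu>. Argmin l \<zeta> \<noteq> {}"
  using AE_max_gain_finite_above
proof eventually_elim
  case (elim \<zeta>)
  then show ?case using assms dense[of \<kappa> l] argmin_exists by blast
qed

text \<open>Upper semicontinuity limits the gain from short moves, and for long moves the growing price
  outweighs the finite gain available at price \<open>l\<^sub>0\<close>.\<close>

lemma max_gain_tendsto_0: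
  assumes fin: "max_gain l\<^sub>0 \<zeta> < \<infinity>" and l0: "0 \<le> l\<^sub>0"
  shows "(INF n::nat. max_gain (l\<^sub>0 + n) \<zeta>) = 0"
proof (rule ccontr)
  assume "\<not> ?thesis"
  then have "0 < (INF n::nat. max_gain (l\<^sub>0 + n) \<zeta>)" by (simp add: zero_less_iff_neq_zero)
  then obtain e' where e': "0 < e'" "e' < (INF n::nat. max_gain (l\<^sub>0 + n) \<zeta>)" using dense by blast
  then obtain e where e: "e' = ennreal e" "0 < e" by (cases e') (auto simp: top_unique)
  have "eventually (\<lambda>y. \<Psi> y < \<Psi> \<zeta> + e) (at \<zeta>)" using usc e(2) unfolding usc_def by simp
  then obtain d where d: "d > 0" "\<And>y. y \<noteq> \<zeta> \<Longrightarrow> dist y \<zeta> < d \<Longrightarrow> \<Psi> y < \<Psi> \<zeta> + e"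
    by (auto simp: eventually_at)
  obtain a where a: "max_gain l\<^sub>0 \<zeta> = ennreal a" "0 \<le> a" using fin by (cases "max_gain l\<^sub>0 \<zeta>") auto
  obtain n :: nat where n: "a / d powr p \<le> n" using real_arch_simple by blast
  have "gain (l\<^sub>0 + n) \<xi> \<zeta> \<le> e" for \<xi>
  proof (cases "dist \<xi> \<zeta> < d")
    case True
    have "0 \<le> (l\<^sub>0 + n) * dist \<xi> \<zeta> powr p" using l0 by auto
    then show ?thesis using d(2)[of \<xi>] True e(2) unfolding gain_def by (cases "\<xi> = \<zeta>") auto
  next
    case False
    have "ennreal (gain l\<^sub>0 \<xi> \<zeta>) \<le> ennreal a" using gain_le_max_gain a by metis
    then have 1: "gain l\<^sub>0 \<xi> \<zeta> \<le> a" using a by (simp add: ennreal_le_iff)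
    have "a \<le> n * d powr p" using n d(1) by (simp add: pos_divide_le_eq)
    also have "\<dots> \<le> n * dist \<xi> \<zeta> powr p" using False d(1) p by (intro mult_left_mono powr_mono2) auto
    finally show ?thesis using 1 e(2) gain_shift[of "l\<^sub>0 + n" \<xi> \<zeta> l\<^sub>0] by simp
  qed
  then have "max_gain (l\<^sub>0 + n) \<zeta> \<le> ennreal e"
    unfolding max_gain_def by (intro SUP_least ennreal_leI)
  moreover have "(INF n::nat. max_gain (l\<^sub>0 + n) \<zeta>) \<le> max_gain (l\<^sub>0 + n) \<zeta>"
    by (rule INF_lower) simp
  ultimately show False using e' e by simp
qed

section \<open>Weak duality\<close>

definition map_cost :: "('a \<Rightarrow> 'a) \<Rightarrow> ennreal" where
  "map_cost T = (\<integral>\<^sup>+\<zeta>. ennreal (dist (T \<zeta>) \<zeta> powr p) \<partial>\<nu>)"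

text \<open>A real inequality, rearranged so that both sides are sums of nonnegative terms and can be
  integrated termwise.\<close>

lemma ennreal_pos_neg_parts_le:
  fixes a b c d :: real
  assumes "a + d \<le> b + c" "0 \<le> c" "0 \<le> d"
  shows "ennreal a + ennreal (- b) + ennreal d \<le> ennreal (- a) + ennreal b + ennreal c"
proof -
  have "ennreal x = ennreal (max 0 x)" for x by (cases "0 \<le> x") (auto simp: ennreal_neg)
  then have *: "ennreal a = ennreal (max 0 a)" "ennreal (- b) = ennreal (max 0 (- b))"
    "ennreal (- a) = ennreal (max 0 (- a))" "ennreal b = ennreal (max 0 b)" by blast+
  show ?thesis unfolding * using assms
    by (subst ennreal_plus[symmetric] ennreal_plus[symmetric], simp, simp)+ (intro ennreal_leI, auto)
qed

text \<open>This integrates the bound \<open>\<Psi> \<xi> - \<Psi> \<zeta> \<le> l * dist \<xi> \<zeta> powr p + max_gain l \<zeta>\<close> against a coupling. On \<open>B\<close>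
  the bound has slack at least \<open>\<delta>\<close>; keeping this term measures how far the coupling is from
  complementary slackness.\<close>

lemma weak_duality_slack:
  assumes \<mu>: "\<mu> \<in> borel_probs" and \<gamma>: "\<gamma> \<in> couplings \<mu> \<nu>" and l: "0 \<le> l" and \<delta>: "0 \<le> \<delta>"
    and B: "B \<in> sets borel" "\<And>\<xi> \<zeta>. (\<xi>, \<zeta>) \<in> B \<Longrightarrow> \<exists>\<eta>. gain l \<xi> \<zeta> + \<delta> \<le> gain l \<eta> \<zeta>"
  shows "(\<integral>\<^sup>+\<xi>. ennreal (\<Psi> \<xi>) \<partial>\<mu>) + (\<integral>\<^sup>+\<zeta>. ennreal (- \<Psi> \<zeta>) \<partial>\<nu>) + ennreal \<delta> * emeasure \<gamma> B
    \<le> (\<integral>\<^sup>+\<xi>. ennreal (- \<Psi> \<xi>) \<partial>\<mu>) + (\<integral>\<^sup>+\<zeta>. ennreal (\<Psi> \<zeta>) \<partial>\<nu>) + (ennreal l * transport_cost p \<gamma> + total_gain l)"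
proof -
  note \<mu>I = couplingsD(8)[OF \<gamma>] and \<nu>I = couplingsD(9)[OF \<gamma>]
  have B\<gamma>: "B \<in> sets \<gamma>" using B couplingsD(1)[OF \<gamma>] by simp
  note [measurable] = couplingsD(4,5)[OF \<gamma>]
  have pw: "ennreal (\<Psi> (fst x)) + ennreal (- \<Psi> (snd x)) + ennreal \<delta> * indicator B x
    \<le> ennreal (- \<Psi> (fst x)) + ennreal (\<Psi> (snd x)) + (ennreal l * ennreal (dist (fst x) (snd x) powr p) + max_gain l (snd x))" for x
  proof -
    obtain \<xi> \<zeta> where x: "x = (\<xi>, \<zeta>)" by (cases x)
    obtain \<eta> where \<eta>: "gain l \<xi> \<zeta> + \<delta> * indicator B x \<le> gain l \<eta> \<zeta>" "0 \<le> gain l \<eta> \<zeta>"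
    proof (cases "x \<in> B")
      case True
      then obtain \<eta> where "gain l \<xi> \<zeta> + \<delta> \<le> gain l \<eta> \<zeta>" using B(2) x by blast
      then show ?thesis using that[of \<eta>] that[of \<zeta>] True by (cases "0 \<le> gain l \<eta> \<zeta>") auto
    next
      case False
      then show ?thesis using that[of \<xi>] that[of \<zeta>] by (cases "0 \<le> gain l \<xi> \<zeta>") auto
    qed
    have "ennreal (\<Psi> \<xi>) + ennreal (- \<Psi> \<zeta>) + ennreal (\<delta> * indicator B x)
      \<le> ennreal (- \<Psi> \<xi>) + ennreal (\<Psi> \<zeta>) + ennreal (l * dist \<xi> \<zeta> powr p + gain l \<eta> \<zeta>)"
      using \<eta> \<delta> l unfolding gain_def[of l \<xi>] by (intro ennreal_pos_neg_parts_le) auto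
    also have "ennreal (l * dist \<xi> \<zeta> powr p + gain l \<eta> \<zeta>) = ennreal l * ennreal (dist \<xi> \<zeta> powr p) + ennreal (gain l \<eta> \<zeta>)"
      using l \<eta>(2) by (simp add: ennreal_plus ennreal_mult)
    also have "\<dots> \<le> ennreal l * ennreal (dist \<xi> \<zeta> powr p) + max_gain l \<zeta>"
      by (intro add_left_mono gain_le_max_gain)
    finally show ?thesis using x \<delta> by (simp add: ennreal_mult' ennreal_indicator add_left_mono)
  qed
  have "(\<integral>\<^sup>+\<xi>. ennreal (\<Psi> \<xi>) \<partial>\<mu>) + (\<integral>\<^sup>+\<zeta>. ennreal (- \<Psi> \<zeta>) \<partial>\<nu>) + ennreal \<delta> * emeasure \<gamma> B
    = (\<integral>\<^sup>+x. ennreal (\<Psi> (fst x)) + ennreal (- \<Psi> (snd x)) + ennreal \<delta> * indicator B x \<partial>\<gamma>)"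
    using B\<gamma> by (subst \<mu>I, simp, subst \<nu>I, simp) (simp add: nn_integral_add nn_integral_cmult_indicator)
  also have "\<dots> \<le> (\<integral>\<^sup>+x. ennreal (- \<Psi> (fst x)) + ennreal (\<Psi> (snd x)) + (ennreal l * ennreal (dist (fst x) (snd x) powr p) + max_gain l (snd x)) \<partial>\<gamma>)"
    by (intro nn_integral_mono pw)
  also have "\<dots> = (\<integral>\<^sup>+\<xi>. ennreal (- \<Psi> \<xi>) \<partial>\<mu>) + (\<integral>\<^sup>+\<zeta>. ennreal (\<Psi> \<zeta>) \<partial>\<nu>) + (ennreal l * transport_cost p \<gamma> + total_gain l)"
    unfolding total_gain_def transport_cost_def case_prod_beta'
    by (subst \<mu>I, simp, subst (1 2) \<nu>I, simp, simp) (simp add: nn_integral_add nn_integral_cmult)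
  finally show ?thesis .
qed

text \<open>Any price above the growth rate bounds \<open>\<Psi> \<xi>\<close> by an integrable function of \<open>\<zeta>\<close> plus a multiple of the cost.\<close>

lemma positive_part_integrable:
  assumes \<mu>: "\<mu> \<in> borel_probs" and \<gamma>: "\<gamma> \<in> couplings \<mu> \<nu>" and fin: "transport_cost p \<gamma> < \<infinity>"
  shows "(\<integral>\<^sup>+\<xi>. ennreal (\<Psi> \<xi>) \<partial>\<mu>) < \<infinity>"
proof -
  define l where "l = \<kappa> + 1"
  have l: "0 \<le> l" "total_gain l < \<infinity>" unfolding l_def using \<kappa>_nonneg total_gain_finite by auto
  note \<mu>I = couplingsD(8)[OF \<gamma>] and \<nu>I = couplingsD(9)[OF \<gamma>]
  note [measurable] = couplingsD(4,5)[OF \<gamma>]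
  have "(\<integral>\<^sup>+\<xi>. ennreal (\<Psi> \<xi>) \<partial>\<mu>) = (\<integral>\<^sup>+x. ennreal (\<Psi> (fst x)) \<partial>\<gamma>)"
    by (rule \<mu>I) simp
  also have "\<dots> \<le> (\<integral>\<^sup>+x. ennreal (\<Psi> (snd x)) + (ennreal l * ennreal (dist (fst x) (snd x) powr p) + max_gain l (snd x)) \<partial>\<gamma>)"
  proof (intro nn_integral_mono)
    fix x :: "'a \<times> 'a"
    obtain \<xi> \<zeta> where x: "x = (\<xi>, \<zeta>)" by (cases x)
    have "ennreal (\<Psi> \<xi>) \<le> ennreal (max 0 (\<Psi> \<zeta>) + (l * dist \<xi> \<zeta> powr p + max 0 (gain l \<xi> \<zeta>)))"
      by (intro ennreal_leI) (auto simp: gain_def)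
    also have "\<dots> = ennreal (max 0 (\<Psi> \<zeta>)) + (ennreal (l * dist \<xi> \<zeta> powr p) + ennreal (max 0 (gain l \<xi> \<zeta>)))"
      using l by (simp add: ennreal_plus)
    also have "\<dots> = ennreal (\<Psi> \<zeta>) + (ennreal l * ennreal (dist \<xi> \<zeta> powr p) + ennreal (gain l \<xi> \<zeta>))"
      using l by (simp add: ennreal_mult max_def ennreal_neg)
    also have "\<dots> \<le> ennreal (\<Psi> \<zeta>) + (ennreal l * ennreal (dist \<xi> \<zeta> powr p) + max_gain l \<zeta>)"
      by (intro add_left_mono gain_le_max_gain)
    finally show "ennreal (\<Psi> (fst x)) \<le> ennreal (\<Psi> (snd x)) + (ennreal l * ennreal (dist (fst x) (snd x) powr p) + max_gain l (snd x))"
      using x by simp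
  qed
  also have "\<dots> = (\<integral>\<^sup>+\<zeta>. ennreal (\<Psi> \<zeta>) \<partial>\<nu>) + (ennreal l * transport_cost p \<gamma> + total_gain l)"
    unfolding total_gain_def transport_cost_def case_prod_beta'
    by (subst (1 2) \<nu>I, simp, simp) (simp add: nn_integral_add nn_integral_cmult)
  also have "\<dots> < \<infinity>"
    using int l fin by (auto simp: real_integrable_def less_top ennreal_mult_less_top)
  finally show ?thesis .
qed

text \<open>The bound holds for couplings whose cost is arbitrarily close to the infimum, which suffices.\<close>

lemma weak_duality_Wpp:
  assumes \<mu>: "\<mu> \<in> borel_probs" and W: "Wpp p \<mu> \<nu> < \<infinity>" and l: "0 \<le> l"
  shows "ereal_integral \<mu> (\<lambda>\<xi>. ereal (\<Psi> \<xi>)) \<le> ereal (\<integral>\<zeta>. \<Psi> \<zeta> \<partial>\<nu>) + enn2ereal (ennreal l * Wpp p \<mu> \<nu> + total_gain l)"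
proof -
  obtain w where w: "Wpp p \<mu> \<nu> = ennreal w" "0 \<le> w" using W by (cases "Wpp p \<mu> \<nu>") auto
  obtain a b where ab: "0 \<le> a" "0 \<le> b" "(\<integral>\<^sup>+\<zeta>. ennreal (\<Psi> \<zeta>) \<partial>\<nu>) = ennreal a" "(\<integral>\<^sup>+\<zeta>. ennreal (- \<Psi> \<zeta>) \<partial>\<nu>) = ennreal b"
    "(\<integral>\<zeta>. \<Psi> \<zeta> \<partial>\<nu>) = a - b" by (rule integrable_parts[OF int])
  have \<gamma>: "\<exists>\<gamma>\<in>couplings \<mu> \<nu>. transport_cost p \<gamma> < ennreal (w + e)" if "0 < e" for e
  proof -
    have "Wpp p \<mu> \<nu> < ennreal (w + e)" using w that by (simp add: ennreal_less_iff)
    then show ?thesis unfolding Wpp_def by (auto simp: INF_less_iff)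
  qed
  from \<gamma>[of 1] obtain \<gamma>1 where "\<gamma>1 \<in> couplings \<mu> \<nu>" "transport_cost p \<gamma>1 < \<infinity>"
    by (metis ennreal_less_top infinity_ennreal_def less_trans zero_less_one)
  then have "(\<integral>\<^sup>+\<xi>. ennreal (\<Psi> \<xi>) \<partial>\<mu>) < \<infinity>" using positive_part_integrable \<mu> by blast
  then obtain u where u: "(\<integral>\<^sup>+\<xi>. ennreal (\<Psi> \<xi>) \<partial>\<mu>) = ennreal u" "0 \<le> u" by (cases "\<integral>\<^sup>+\<xi>. ennreal (\<Psi> \<xi>) \<partial>\<mu>") auto
  have I: "ereal_integral \<mu> (\<lambda>\<xi>. ereal (\<Psi> \<xi>)) = ereal u - enn2ereal (\<integral>\<^sup>+\<xi>. ennreal (- \<Psi> \<xi>) \<partial>\<mu>)"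
    unfolding ereal_integral_def using u by (simp add: enn2ereal_ennreal)
  show ?thesis
  proof (cases "total_gain l = \<infinity> \<or> (\<integral>\<^sup>+\<xi>. ennreal (- \<Psi> \<xi>) \<partial>\<mu>) = \<infinity>")
    case True
    then show ?thesis unfolding I by auto
  next
    case False
    then obtain g v where g: "total_gain l = ennreal g" "0 \<le> g" and v: "(\<integral>\<^sup>+\<xi>. ennreal (- \<Psi> \<xi>) \<partial>\<mu>) = ennreal v" "0 \<le> v"
      by (cases "total_gain l"; cases "\<integral>\<^sup>+\<xi>. ennreal (- \<Psi> \<xi>) \<partial>\<mu>") auto
    have "u + b \<le> v + a + (l * w + g) + l * e" if e: "0 < e" for e
    proof -
      obtain \<gamma> where \<gamma>: "\<gamma> \<in> couplings \<mu> \<nu>" "transport_cost p \<gamma> < ennreal (w + e)" using \<gamma>[OF e] by blast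
      have "ennreal u + ennreal b + ennreal 0 * emeasure \<gamma> {} \<le> ennreal v + ennreal a + (ennreal l * transport_cost p \<gamma> + ennreal g)"
        using weak_duality_slack[OF \<mu> \<gamma>(1) l, of 0 "{}"] u v ab g by simp
      also have "\<dots> \<le> ennreal v + ennreal a + (ennreal l * ennreal (w + e) + ennreal g)"
        using \<gamma>(2) by (intro add_mono mult_left_mono) auto
      also have "\<dots> = ennreal (v + a + (l * (w + e) + g))"
        using v ab l w e g by (simp add: ennreal_plus ennreal_mult)
      finally have "ennreal (u + b) \<le> ennreal (v + a + (l * (w + e) + g))" using u ab by (simp add: ennreal_plus)
      then have "u + b \<le> v + a + (l * (w + e) + g)" using v ab l w e g by (subst (asm) ennreal_le_iff) auto
      then show ?thesis by (simp add: algebra_simps)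
    qed
    note * = this
    have "u + b \<le> v + a + (l * w + g)"
    proof (rule field_le_epsilon)
      fix e :: real assume "0 < e"
      have "l * (e / (l + 1)) \<le> e" using l \<open>0 < e\<close> by (simp add: field_simps)
      then show "u + b \<le> v + a + (l * w + g) + e" using *[of "e / (l + 1)"] \<open>0 < e\<close> l by simp
    qed
    moreover have "ennreal l * Wpp p \<mu> \<nu> + total_gain l = ennreal (l * w + g)"
      using l w g by (simp add: ennreal_plus ennreal_mult)
    then have "enn2ereal (ennreal l * Wpp p \<mu> \<nu> + total_gain l) = ereal (l * w + g)"
      using l w g by (simp add: enn2ereal_ennreal del: ennreal_plus)
    ultimately show ?thesis unfolding I using v ab(5) by (simp add: enn2ereal_ennreal)
  qed
qed

lemma primal_feasible_iff:
  assumes "0 < t"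
  shows "\<mu> \<in> primal_feasible p \<nu> t \<longleftrightarrow> \<mu> \<in> borel_probs \<and> Wpp p \<mu> \<nu> \<le> ennreal (t powr p)"
  unfolding primal_feasible_def using wasserstein_le_iff[OF p assms] by auto

lemma weak_duality:
  assumes "0 < t" "\<mu> \<in> primal_feasible p \<nu> t" "0 \<le> l"
  shows "ereal_integral \<mu> (\<lambda>\<xi>. ereal (\<Psi> \<xi>)) \<le> ereal (\<integral>\<zeta>. \<Psi> \<zeta> \<partial>\<nu>) + enn2ereal (dual_excess t l)"
proof -
  have \<mu>: "\<mu> \<in> borel_probs" "Wpp p \<mu> \<nu> \<le> ennreal (t powr p)" using assms primal_feasible_iff by auto
  then have "Wpp p \<mu> \<nu> < \<infinity>" by (auto intro: le_less_trans)
  from weak_duality_Wpp[OF \<mu>(1) this assms(3)]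
  have "ereal_integral \<mu> (\<lambda>\<xi>. ereal (\<Psi> \<xi>)) \<le> ereal (\<integral>\<zeta>. \<Psi> \<zeta> \<partial>\<nu>) + enn2ereal (ennreal l * Wpp p \<mu> \<nu> + total_gain l)" .
  also have "\<dots> \<le> ereal (\<integral>\<zeta>. \<Psi> \<zeta> \<partial>\<nu>) + enn2ereal (dual_excess t l)"
    unfolding dual_excess_def ereal_add_enn2ereal_le_iff using \<mu>(2) assms(3)
    by (intro add_right_mono) (auto simp: ennreal_mult intro!: mult_left_mono)
  finally show ?thesis .
qed

lemma primal_le_dual:
  assumes "0 < t" shows "Primal t \<le> Dual t"
  unfolding primal_value_def dual_value_def
  using weak_duality[OF assms] by (auto intro!: SUP_least INF_greatest simp: dual_objective_eq)

section \<open>Complementary slackness\<close>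

lemma integral_along_argmin:
  assumes l: "0 \<le> l" "total_gain l < \<infinity>" and T [measurable]: "T \<in> borel \<rightarrow>\<^sub>M borel"
    and arg: "AE \<zeta> in \<nu>. T \<zeta> \<in> Argmin l \<zeta>" and C: "map_cost T < \<infinity>"
  shows "integrable \<nu> (\<lambda>\<zeta>. \<Psi> (T \<zeta>))"
    and "(\<integral>\<zeta>. \<Psi> (T \<zeta>) \<partial>\<nu>) = (\<integral>\<zeta>. \<Psi> \<zeta> \<partial>\<nu>) + l * enn2real (map_cost T) + enn2real (total_gain l)"
proof -
  have eq: "AE \<zeta> in \<nu>. \<Psi> (T \<zeta>) = \<Psi> \<zeta> + l * dist (T \<zeta>) \<zeta> powr p + enn2real (max_gain l \<zeta>)"
    using arg
  proof eventually_elim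
    case (elim \<zeta>)
    then show ?case using argmin_max_gain[OF elim] by (simp add: gain_def)
  qed
  have c: "integrable \<nu> (\<lambda>\<zeta>. dist (T \<zeta>) \<zeta> powr p)"
    using C unfolding map_cost_def by (intro integrableI_nonneg) auto
  have g: "(\<integral>\<^sup>+\<zeta>. ennreal (enn2real (max_gain l \<zeta>)) \<partial>\<nu>) = total_gain l"
    unfolding total_gain_def using AE_max_gain_finite[OF l(2)]
    by (intro nn_integral_cong_AE) (auto elim!: eventually_mono)
  then have gi: "integrable \<nu> (\<lambda>\<zeta>. enn2real (max_gain l \<zeta>))"
    using l(2) by (intro integrableI_nonneg) auto
  have "integrable \<nu> (\<lambda>\<zeta>. \<Psi> \<zeta> + l * dist (T \<zeta>) \<zeta> powr p + enn2real (max_gain l \<zeta>))"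
    using c gi int by auto
  then show "integrable \<nu> (\<lambda>\<zeta>. \<Psi> (T \<zeta>))"
    using eq by (subst integrable_cong_AE) auto
  have "(\<integral>\<zeta>. \<Psi> (T \<zeta>) \<partial>\<nu>) = (\<integral>\<zeta>. \<Psi> \<zeta> + l * dist (T \<zeta>) \<zeta> powr p + enn2real (max_gain l \<zeta>) \<partial>\<nu>)"
    using eq by (intro integral_cong_AE) auto
  also have "\<dots> = (\<integral>\<zeta>. \<Psi> \<zeta> \<partial>\<nu>) + l * (\<integral>\<zeta>. dist (T \<zeta>) \<zeta> powr p \<partial>\<nu>) + (\<integral>\<zeta>. enn2real (max_gain l \<zeta>) \<partial>\<nu>)"
    using c gi int by simp
  also have "(\<integral>\<zeta>. dist (T \<zeta>) \<zeta> powr p \<partial>\<nu>) = enn2real (map_cost T)"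
    unfolding map_cost_def by (rule integral_eq_nn_integral) auto
  also have "(\<integral>\<zeta>. enn2real (max_gain l \<zeta>) \<partial>\<nu>) = enn2real (total_gain l)"
    unfolding g[symmetric] by (rule integral_eq_nn_integral) auto
  finally show "(\<integral>\<zeta>. \<Psi> (T \<zeta>) \<partial>\<nu>) = (\<integral>\<zeta>. \<Psi> \<zeta> \<partial>\<nu>) + l * enn2real (map_cost T) + enn2real (total_gain l)" .
qed

text \<open>Complementary slackness is sufficient: maps into the argmin sets of a dual minimizer \<open>l\<close> whose
  mixed cost exhausts the budget (or, when \<open>l = 0\<close>, stays within it) attain the dual value.\<close>

definition complementary_pair :: "real \<Rightarrow> real \<Rightarrow> real \<Rightarrow> ('a \<Rightarrow> 'a) \<Rightarrow> ('a \<Rightarrow> 'a) \<Rightarrow> bool" where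
  "complementary_pair t l q T\<^sub>1 T\<^sub>2 \<longleftrightarrow> l \<in> Minimizers t \<and> q \<in> {0..1} \<and>
     T\<^sub>1 \<in> borel \<rightarrow>\<^sub>M borel \<and> T\<^sub>2 \<in> borel \<rightarrow>\<^sub>M borel \<and>
     (AE \<zeta> in \<nu>. T\<^sub>1 \<zeta> \<in> Argmin l \<zeta> \<and> T\<^sub>2 \<zeta> \<in> Argmin l \<zeta>) \<and>
     map_cost T\<^sub>1 < \<infinity> \<and> map_cost T\<^sub>2 < \<infinity> \<and>
     q * enn2real (map_cost T\<^sub>1) + (1 - q) * enn2real (map_cost T\<^sub>2) \<le> t powr p \<and>
     (0 < l \<longrightarrow> q * enn2real (map_cost T\<^sub>1) + (1 - q) * enn2real (map_cost T\<^sub>2) = t powr p)"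

lemma complementary_pair_value:
  assumes S: "complementary_pair t l q T\<^sub>1 T\<^sub>2" and t: "0 < t"
  shows "integrable \<nu> (\<lambda>\<zeta>. \<Psi> (T\<^sub>1 \<zeta>))" "integrable \<nu> (\<lambda>\<zeta>. \<Psi> (T\<^sub>2 \<zeta>))"
    and "ereal (q * (\<integral>\<zeta>. \<Psi> (T\<^sub>1 \<zeta>) \<partial>\<nu>) + (1 - q) * (\<integral>\<zeta>. \<Psi> (T\<^sub>2 \<zeta>) \<partial>\<nu>)) = Dual t"
proof -
  have l: "l \<in> Minimizers t" and q: "q \<in> {0..1}"
    and T: "T\<^sub>1 \<in> borel \<rightarrow>\<^sub>M borel" "T\<^sub>2 \<in> borel \<rightarrow>\<^sub>M borel"
    and arg: "AE \<zeta> in \<nu>. T\<^sub>1 \<zeta> \<in> Argmin l \<zeta>" "AE \<zeta> in \<nu>. T\<^sub>2 \<zeta> \<in> Argmin l \<zeta>"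
    and C: "map_cost T\<^sub>1 < \<infinity>" "map_cost T\<^sub>2 < \<infinity>"
    and eq: "l * (q * enn2real (map_cost T\<^sub>1) + (1 - q) * enn2real (map_cost T\<^sub>2)) = l * t powr p"
    using S dual_minimizer_finite(2) unfolding complementary_pair_def by (fastforce elim: eventually_mono)+
  note fin = dual_minimizer_finite[OF l]
  note 1 = integral_along_argmin[OF fin(2,3) T(1) arg(1) C(1)] and 2 = integral_along_argmin[OF fin(2,3) T(2) arg(2) C(2)]
  show "integrable \<nu> (\<lambda>\<zeta>. \<Psi> (T\<^sub>1 \<zeta>))" "integrable \<nu> (\<lambda>\<zeta>. \<Psi> (T\<^sub>2 \<zeta>))" using 1 2 by auto
  have "q * (\<integral>\<zeta>. \<Psi> (T\<^sub>1 \<zeta>) \<partial>\<nu>) + (1 - q) * (\<integral>\<zeta>. \<Psi> (T\<^sub>2 \<zeta>) \<partial>\<nu>) =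
    (\<integral>\<zeta>. \<Psi> \<zeta> \<partial>\<nu>) + l * (q * enn2real (map_cost T\<^sub>1) + (1 - q) * enn2real (map_cost T\<^sub>2)) + enn2real (total_gain l)"
    unfolding 1(2) 2(2) by (simp add: algebra_simps)
  also have "\<dots> = (\<integral>\<zeta>. \<Psi> \<zeta> \<partial>\<nu>) + l * t powr p + enn2real (total_gain l)" unfolding eq ..
  finally show "ereal (q * (\<integral>\<zeta>. \<Psi> (T\<^sub>1 \<zeta>) \<partial>\<nu>) + (1 - q) * (\<integral>\<zeta>. \<Psi> (T\<^sub>2 \<zeta>) \<partial>\<nu>)) = Dual t"
    unfolding dual_value_minimizer[OF l] dual_excess_def using fin
    by (cases "total_gain l") (auto simp: enn2ereal_ennreal ennreal_plus[symmetric] simp del: ennreal_plus)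
qed

lemma mixture_feasible:
  assumes t: "0 < t" and q: "q \<in> {0..1}" and T: "T\<^sub>1 \<in> borel \<rightarrow>\<^sub>M borel" "T\<^sub>2 \<in> borel \<rightarrow>\<^sub>M borel"
    and C: "map_cost T\<^sub>1 < \<infinity>" "map_cost T\<^sub>2 < \<infinity>"
    and le: "q * enn2real (map_cost T\<^sub>1) + (1 - q) * enn2real (map_cost T\<^sub>2) \<le> t powr p"
  shows "mixture q (push \<nu> T\<^sub>1) (push \<nu> T\<^sub>2) \<in> primal_feasible p \<nu> t"
    and "transport_cost p (mixture q (push \<nu> (\<lambda>\<zeta>. (\<zeta>, T\<^sub>1 \<zeta>))) (push \<nu> (\<lambda>\<zeta>. (\<zeta>, T\<^sub>2 \<zeta>)))) =
      ennreal (q * enn2real (map_cost T\<^sub>1) + (1 - q) * enn2real (map_cost T\<^sub>2))"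
proof -
  note mp = mixture_push_coupling[OF \<nu> T q]
  show cost: "transport_cost p (mixture q (push \<nu> (\<lambda>\<zeta>. (\<zeta>, T\<^sub>1 \<zeta>))) (push \<nu> (\<lambda>\<zeta>. (\<zeta>, T\<^sub>2 \<zeta>)))) =
      ennreal (q * enn2real (map_cost T\<^sub>1) + (1 - q) * enn2real (map_cost T\<^sub>2))"
    unfolding mp(3) map_cost_def[symmetric] using C q
    by (cases "map_cost T\<^sub>1"; cases "map_cost T\<^sub>2") (auto simp: ennreal_plus ennreal_mult)
  then have "Wpp p (mixture q (push \<nu> T\<^sub>1) (push \<nu> T\<^sub>2)) \<nu> \<le> ennreal (t powr p)"
    using mp(4)[of p] le by (metis ennreal_leI order_trans)
  then show "mixture q (push \<nu> T\<^sub>1) (push \<nu> T\<^sub>2) \<in> primal_feasible p \<nu> t"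
    using primal_feasible_iff[OF t] mp(1) by simp
qed

text \<open>At a positive price the coupling is optimal, since a cheaper one would make weak duality strict.\<close>

lemma complementary_pair_worst_case:
  assumes S: "complementary_pair t l q T\<^sub>1 T\<^sub>2" and t: "0 < t"
  defines "\<mu> \<equiv> mixture q (push \<nu> T\<^sub>1) (push \<nu> T\<^sub>2)"
    and "\<gamma> \<equiv> mixture q (push \<nu> (\<lambda>\<zeta>. (\<zeta>, T\<^sub>1 \<zeta>))) (push \<nu> (\<lambda>\<zeta>. (\<zeta>, T\<^sub>2 \<zeta>)))"
  shows "Worst t \<mu>" "Primal t = Dual t"
    and "0 < l \<Longrightarrow> \<gamma> \<in> couplings \<nu> \<mu> \<and> transport_cost p \<gamma> = Wpp p \<mu> \<nu>"
proof -
  have l: "l \<in> Minimizers t" and q: "q \<in> {0..1}"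
    and T: "T\<^sub>1 \<in> borel \<rightarrow>\<^sub>M borel" "T\<^sub>2 \<in> borel \<rightarrow>\<^sub>M borel"
    and C: "map_cost T\<^sub>1 < \<infinity>" "map_cost T\<^sub>2 < \<infinity>"
    and le: "q * enn2real (map_cost T\<^sub>1) + (1 - q) * enn2real (map_cost T\<^sub>2) \<le> t powr p"
    and eq: "0 < l \<Longrightarrow> q * enn2real (map_cost T\<^sub>1) + (1 - q) * enn2real (map_cost T\<^sub>2) = t powr p"
    using S unfolding complementary_pair_def by auto
  note fin = dual_minimizer_finite[OF l]
  note mp = mixture_push_coupling[OF \<nu> T q, folded \<mu>_def \<gamma>_def]
  note mf = mixture_feasible[OF t q T C le, folded \<mu>_def \<gamma>_def]
  then have feas: "\<mu> \<in> primal_feasible p \<nu> t" and W: "Wpp p \<mu> \<nu> \<le> ennreal (t powr p)"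
    using primal_feasible_iff[OF t] by auto
  note v = complementary_pair_value[OF S t]
  have I: "ereal_integral \<mu> (\<lambda>\<xi>. ereal (\<Psi> \<xi>)) = Dual t"
    unfolding \<mu>_def ereal_integral_mixture_push[OF \<nu> T q \<Psi>_borel v(1,2)] by (rule v(3))
  have "Dual t \<le> Primal t"
    unfolding primal_value_def I[symmetric] by (rule SUP_upper[OF feas])
  then show pd: "Primal t = Dual t" using primal_le_dual[OF t] by (rule antisym[rotated])
  show "Worst t \<mu>" unfolding worst_case_def using feas I pd by simp
  show "\<gamma> \<in> couplings \<nu> \<mu> \<and> transport_cost p \<gamma> = Wpp p \<mu> \<nu>" if l0: "0 < l"
  proof (intro conjI mp(2) antisym)
    show "Wpp p \<mu> \<nu> \<le> transport_cost p \<gamma>" by (rule mp(4))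
    have Wf: "Wpp p \<mu> \<nu> < \<infinity>" using W by (auto intro: le_less_trans)
    from weak_duality_Wpp[OF mp(1) this fin(2)]
    have "dual_excess t l \<le> ennreal l * Wpp p \<mu> \<nu> + total_gain l"
      unfolding I dual_value_minimizer[OF l] by (simp add: ereal_add_enn2ereal_le_iff)
    then have "ennreal l * ennreal (t powr p) \<le> ennreal l * Wpp p \<mu> \<nu>"
      unfolding dual_excess_def using fin by (auto simp: ennreal_mult)
    then have "ennreal (t powr p) \<le> Wpp p \<mu> \<nu>" using l0
      by (simp add: ennreal_mult_le_mult_iff)
    then show "transport_cost p \<gamma> \<le> Wpp p \<mu> \<nu>" unfolding mf(2) eq[OF l0] .
  qed
qed

section \<open>Selections from the argmin sets\<close>

text \<open>Each competitor \<open>\<eta>\<close> contributes a superlevel set of an upper semicontinuous function of the pair.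
  The tolerance \<open>\<delta>\<close> serves to approximate the argmin sets from outside.\<close>

lemma closed_near_argmin_graph: "closed {(\<xi>, \<zeta>). \<forall>\<eta>. gain l \<eta> \<zeta> \<le> gain l \<xi> \<zeta> + \<delta>}"
proof -
  have "closed {x. \<Psi> \<eta> - \<delta> \<le> \<Psi> (fst x) + (l * dist \<eta> (snd x) powr p - l * dist (fst x) (snd x) powr p)}" for \<eta>
    by (intro usc_closed_superlevel usc_add_continuous usc_compose_continuous[OF usc] continuous_intros continuous_cost)
  then have "closed (\<Inter>\<eta>. {x. \<Psi> \<eta> - \<delta> \<le> \<Psi> (fst x) + (l * dist \<eta> (snd x) powr p - l * dist (fst x) (snd x) powr p)})"
    by auto
  moreover have "(\<Inter>\<eta>. {x. \<Psi> \<eta> - \<delta> \<le> \<Psi> (fst x) + (l * dist \<eta> (snd x) powr p - l * dist (fst x) (snd x) powr p)})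
     = {(\<xi>, \<zeta>). \<forall>\<eta>. gain l \<eta> \<zeta> \<le> gain l \<xi> \<zeta> + \<delta>}"
    by (auto simp: gain_def algebra_simps)
  ultimately show ?thesis by simp
qed

lemma hit_measurable_argmin: "hit_measurable borel (Argmin l)"
proof -
  have "Argmin l = (\<lambda>\<zeta>. {\<xi>. (\<xi>, \<zeta>) \<in> {(\<xi>, \<zeta>). \<forall>\<eta>. gain l \<eta> \<zeta> \<le> gain l \<xi> \<zeta> + 0}})"
    by (auto simp: argmin_iff)
  then show ?thesis
    using hit_measurable_closed_graph[OF closed_near_argmin_graph[where \<delta> = 0 and l = l]] by simp
qed

lemma argmin_closed: "closed (Argmin l \<zeta>)"
  using hit_measurable_argmin by (rule hit_measurableD)

lemma argmin_nonempty_measurable [measurable]: "{\<zeta>. Argmin l \<zeta> \<noteq> {}} \<in> sets borel"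
  using hit_measurable_nonempty[OF hit_measurable_argmin] by simp

lemma nearest_argmin_selection:
  "\<exists>N\<in>borel \<rightarrow>\<^sub>M borel. \<forall>\<zeta>. Argmin l \<zeta> \<noteq> {} \<longrightarrow>
     N \<zeta> \<in> Argmin l \<zeta> \<and> D_lower l \<zeta> = ennreal (dist (N \<zeta>) \<zeta> powr p)"
proof -
  obtain N where N: "N \<in> borel \<rightarrow>\<^sub>M borel" "\<forall>\<zeta>. Argmin l \<zeta> \<noteq> {} \<longrightarrow>
     N \<zeta> \<in> Argmin l \<zeta> \<and> (\<forall>\<xi>\<in>Argmin l \<zeta>. dist (N \<zeta>) \<zeta> \<le> dist \<xi> \<zeta>)"
    using measurable_nearest_selection[OF hit_measurable_argmin] by blast
  have "D_lower l \<zeta> = ennreal (dist (N \<zeta>) \<zeta> powr p)" if "Argmin l \<zeta> \<noteq> {}" for \<zeta>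
    unfolding D0_lower_def using N(2) that p
    by (intro antisym INF_lower INF_greatest ennreal_leI powr_mono2) auto
  then show ?thesis using N by blast
qed

lemma D0_lower_measurable [measurable]: "D_lower l \<in> borel_measurable borel"
proof -
  obtain N where N [measurable]: "N \<in> borel \<rightarrow>\<^sub>M borel" and *: "\<forall>\<zeta>. Argmin l \<zeta> \<noteq> {} \<longrightarrow>
     N \<zeta> \<in> Argmin l \<zeta> \<and> D_lower l \<zeta> = ennreal (dist (N \<zeta>) \<zeta> powr p)"
    using nearest_argmin_selection by blast
  define A where "A = {\<zeta>. Argmin l \<zeta> \<noteq> {}}"
  have [measurable]: "A \<in> sets borel" unfolding A_def by (rule argmin_nonempty_measurable)
  have "D_lower l = (\<lambda>\<zeta>. if \<zeta> \<in> A then ennreal (dist (N \<zeta>) \<zeta> powr p) else \<infinity>)"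
  proof
    fix \<zeta>
    show "D_lower l \<zeta> = (if \<zeta> \<in> A then ennreal (dist (N \<zeta>) \<zeta> powr p) else \<infinity>)"
      using * by (cases "Argmin l \<zeta> = {}") (auto simp: A_def D0_lower_def)
  qed
  then show ?thesis by simp
qed

text \<open>The maximal distance to the argmin set need not be attained, nor be finite; bounding the distance
  makes the argmin set compact.\<close>

lemma truncated_farthest_selection:
  assumes b: "b \<in> borel_measurable borel"
  shows "\<exists>T\<in>borel \<rightarrow>\<^sub>M borel. \<forall>\<zeta>. {\<xi> \<in> Argmin l \<zeta>. dist \<xi> \<zeta> \<le> b \<zeta>} \<noteq> {} \<longrightarrow>
     T \<zeta> \<in> Argmin l \<zeta> \<and> dist (T \<zeta>) \<zeta> \<le> b \<zeta> \<and>
     (\<forall>\<xi>\<in>Argmin l \<zeta>. dist \<xi> \<zeta> \<le> b \<zeta> \<longrightarrow> dist \<xi> \<zeta> \<le> dist (T \<zeta>) \<zeta>)"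
    and "{\<zeta>. {\<xi> \<in> Argmin l \<zeta>. dist \<xi> \<zeta> \<le> b \<zeta>} \<noteq> {}} \<in> sets borel"
proof -
  have "hit_measurable borel (\<lambda>\<zeta>. {\<xi> \<in> Argmin l \<zeta>. dist \<xi> \<zeta> - b \<zeta> \<le> 0})"
  proof (rule hit_measurable_restrict[OF hit_measurable_argmin])
    fix x y \<zeta> :: 'a
    show "dist x \<zeta> - b \<zeta> \<le> dist y \<zeta> - b \<zeta> + dist x y" using dist_triangle[of x \<zeta> y] by simp
    show "(\<lambda>\<zeta>. dist x \<zeta> - b \<zeta>) \<in> borel_measurable borel" using b by measurable
  qed
  then have h: "hit_measurable borel (\<lambda>\<zeta>. {\<xi> \<in> Argmin l \<zeta>. dist \<xi> \<zeta> \<le> b \<zeta>})" by simp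
  moreover have "bounded {\<xi> \<in> Argmin l \<zeta>. dist \<xi> \<zeta> \<le> b \<zeta>}" for \<zeta>
    by (rule bounded_subset[OF bounded_cball[of \<zeta> "b \<zeta>"]]) (auto simp: dist_commute)
  ultimately obtain T where T: "T \<in> borel \<rightarrow>\<^sub>M borel" "\<forall>\<zeta>. {\<xi> \<in> Argmin l \<zeta>. dist \<xi> \<zeta> \<le> b \<zeta>} \<noteq> {} \<longrightarrow>
    T \<zeta> \<in> {\<xi> \<in> Argmin l \<zeta>. dist \<xi> \<zeta> \<le> b \<zeta>} \<and> (\<forall>\<xi>\<in>{\<xi> \<in> Argmin l \<zeta>. dist \<xi> \<zeta> \<le> b \<zeta>}. dist \<xi> \<zeta> \<le> dist (T \<zeta>) \<zeta>)"
    using measurable_farthest_selection by blast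
  then show "\<exists>T\<in>borel \<rightarrow>\<^sub>M borel. \<forall>\<zeta>. {\<xi> \<in> Argmin l \<zeta>. dist \<xi> \<zeta> \<le> b \<zeta>} \<noteq> {} \<longrightarrow>
     T \<zeta> \<in> Argmin l \<zeta> \<and> dist (T \<zeta>) \<zeta> \<le> b \<zeta> \<and>
     (\<forall>\<xi>\<in>Argmin l \<zeta>. dist \<xi> \<zeta> \<le> b \<zeta> \<longrightarrow> dist \<xi> \<zeta> \<le> dist (T \<zeta>) \<zeta>)"
    by (intro bexI[of _ T]) auto
  show "{\<zeta>. {\<xi> \<in> Argmin l \<zeta>. dist \<xi> \<zeta> \<le> b \<zeta>} \<noteq> {}} \<in> sets borel"
    using hit_measurable_nonempty[OF h] by simp
qed

definition D0_truncated :: "real \<Rightarrow> nat \<Rightarrow> 'a \<Rightarrow> ennreal" where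
  "D0_truncated l n \<zeta> = (SUP \<xi>\<in>{\<xi> \<in> Argmin l \<zeta>. dist \<xi> \<zeta> \<le> real n}. ennreal (dist \<xi> \<zeta> powr p))"

lemma D0_truncated_measurable [measurable]: "D0_truncated l n \<in> borel_measurable borel"
proof -
  let ?F = "\<lambda>\<zeta>. {\<xi> \<in> Argmin l \<zeta>. dist \<xi> \<zeta> \<le> real n}"
  obtain T where T [measurable]: "T \<in> borel \<rightarrow>\<^sub>M borel" and *: "\<forall>\<zeta>. ?F \<zeta> \<noteq> {} \<longrightarrow>
     T \<zeta> \<in> Argmin l \<zeta> \<and> dist (T \<zeta>) \<zeta> \<le> real n \<and>
     (\<forall>\<xi>\<in>Argmin l \<zeta>. dist \<xi> \<zeta> \<le> real n \<longrightarrow> dist \<xi> \<zeta> \<le> dist (T \<zeta>) \<zeta>)"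
    using truncated_farthest_selection(1)[of "\<lambda>_. real n" l, OF borel_measurable_const] by blast
  define A where "A = {\<zeta>. ?F \<zeta> \<noteq> {}}"
  have [measurable]: "A \<in> sets borel" unfolding A_def by (intro truncated_farthest_selection(2)) simp
  have "D0_truncated l n \<zeta> = ennreal (dist (T \<zeta>) \<zeta> powr p)" if "?F \<zeta> \<noteq> {}" for \<zeta>
  proof (rule antisym)
    show "D0_truncated l n \<zeta> \<le> ennreal (dist (T \<zeta>) \<zeta> powr p)"
      unfolding D0_truncated_def using * that p by (auto intro!: SUP_least ennreal_leI powr_mono2)
    show "ennreal (dist (T \<zeta>) \<zeta> powr p) \<le> D0_truncated l n \<zeta>"
      unfolding D0_truncated_def using * that by (intro SUP_upper) auto
  qed
  then have "D0_truncated l n \<zeta> = (if \<zeta> \<in> A then ennreal (dist (T \<zeta>) \<zeta> powr p) else 0)" for \<zeta>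
    by (cases "?F \<zeta> = {}") (auto simp: A_def D0_truncated_def bot_ennreal simp del: Collect_empty_eq)
  then have "D0_truncated l n = (\<lambda>\<zeta>. if \<zeta> \<in> A then ennreal (dist (T \<zeta>) \<zeta> powr p) else 0)" by blast
  then show ?thesis by simp
qed

lemma incseq_D0_truncated: "incseq (D0_truncated l)"
  unfolding incseq_def le_fun_def D0_truncated_def by (auto intro!: SUP_subset_mono)

lemma D0_upper_eq_SUP: "D_upper l \<zeta> = (SUP n. D0_truncated l n \<zeta>)"
proof (rule antisym)
  show "D_upper l \<zeta> \<le> (SUP n. D0_truncated l n \<zeta>)"
    unfolding D0_upper_def
  proof (rule SUP_least)
    fix \<xi> assume "\<xi> \<in> Argmin l \<zeta>"
    moreover obtain n where "dist \<xi> \<zeta> \<le> real n" using real_arch_simple by blast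
    ultimately have "ennreal (dist \<xi> \<zeta> powr p) \<le> D0_truncated l n \<zeta>"
      unfolding D0_truncated_def by (intro SUP_upper) auto
    then show "ennreal (dist \<xi> \<zeta> powr p) \<le> (SUP n. D0_truncated l n \<zeta>)" by (rule SUP_upper2[rotated]) simp
  qed
  show "(SUP n. D0_truncated l n \<zeta>) \<le> D_upper l \<zeta>"
    unfolding D0_upper_def D0_truncated_def by (intro SUP_least SUP_subset_mono) auto
qed

lemma D0_upper_measurable [measurable]: "D_upper l \<in> borel_measurable borel"
  unfolding D0_upper_eq_SUP[abs_def] by measurable

text \<open>Mixing the nearest selection with a far one meets any budget between the two cost integrals.
  The far selection is the farthest one if its cost is finite and a truncation of it otherwise.\<close>

lemma mixed_argmin_selection:
  assumes ne: "AE \<zeta> in \<nu>. Argmin l \<zeta> \<noteq> {}" and c: "0 \<le> c"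
    and lo: "(\<integral>\<^sup>+\<zeta>. D_lower l \<zeta> \<partial>\<nu>) \<le> ennreal c" and up: "ennreal c \<le> (\<integral>\<^sup>+\<zeta>. D_upper l \<zeta> \<partial>\<nu>)"
  shows "\<exists>T\<^sub>1\<in>borel \<rightarrow>\<^sub>M borel. \<exists>T\<^sub>2\<in>borel \<rightarrow>\<^sub>M borel. \<exists>q\<in>{0..1}.
    (AE \<zeta> in \<nu>. T\<^sub>1 \<zeta> \<in> Argmin l \<zeta> \<and> T\<^sub>2 \<zeta> \<in> Argmin l \<zeta>) \<and>
    map_cost T\<^sub>1 < \<infinity> \<and> map_cost T\<^sub>2 < \<infinity> \<and>
    q * enn2real (map_cost T\<^sub>1) + (1 - q) * enn2real (map_cost T\<^sub>2) = c"
proof -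
  obtain N where N [measurable]: "N \<in> borel \<rightarrow>\<^sub>M borel" and Na: "\<And>\<zeta>. Argmin l \<zeta> \<noteq> {} \<Longrightarrow>
     N \<zeta> \<in> Argmin l \<zeta> \<and> D_lower l \<zeta> = ennreal (dist (N \<zeta>) \<zeta> powr p)"
    using nearest_argmin_selection by blast
  have mN: "map_cost N = (\<integral>\<^sup>+\<zeta>. D_lower l \<zeta> \<partial>\<nu>)"
    unfolding map_cost_def by (rule nn_integral_cong_AE, use ne in eventually_elim) (use Na in simp)
  have "\<exists>T\<in>borel \<rightarrow>\<^sub>M borel. (AE \<zeta> in \<nu>. T \<zeta> \<in> Argmin l \<zeta>) \<and> map_cost T < \<infinity> \<and> ennreal c \<le> map_cost T"
  proof (cases "(\<integral>\<^sup>+\<zeta>. D_upper l \<zeta> \<partial>\<nu>) = \<infinity>")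
    case False
    \<comment> \<open>where \<open>D_upper\<close> is finite, the ball of radius \<open>b \<zeta>\<close> contains the whole argmin set\<close>
    define b where "b \<zeta> = enn2real (D_upper l \<zeta>) powr (1 / p)" for \<zeta>
    have [measurable]: "b \<in> borel_measurable borel" unfolding b_def by measurable
    obtain T where T: "T \<in> borel \<rightarrow>\<^sub>M borel" and *: "\<forall>\<zeta>. {\<xi> \<in> Argmin l \<zeta>. dist \<xi> \<zeta> \<le> b \<zeta>} \<noteq> {} \<longrightarrow>
       T \<zeta> \<in> Argmin l \<zeta> \<and> dist (T \<zeta>) \<zeta> \<le> b \<zeta> \<and>
       (\<forall>\<xi>\<in>Argmin l \<zeta>. dist \<xi> \<zeta> \<le> b \<zeta> \<longrightarrow> dist \<xi> \<zeta> \<le> dist (T \<zeta>) \<zeta>)"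
      using truncated_farthest_selection(1)[of b l] \<open>b \<in> borel_measurable borel\<close> by blast
    have fin: "AE \<zeta> in \<nu>. D_upper l \<zeta> \<noteq> \<infinity>"
      using False by (intro nn_integral_PInf_AE) auto
    have TA: "AE \<zeta> in \<nu>. T \<zeta> \<in> Argmin l \<zeta> \<and> D_upper l \<zeta> = ennreal (dist (T \<zeta>) \<zeta> powr p)"
      using fin ne
    proof eventually_elim
      case (elim \<zeta>)
      have b: "dist \<xi> \<zeta> \<le> b \<zeta>" if "\<xi> \<in> Argmin l \<zeta>" for \<xi>
      proof -
        have "ennreal (dist \<xi> \<zeta> powr p) \<le> D_upper l \<zeta>"
          unfolding D0_upper_def using that by (rule SUP_upper)
        also have "\<dots> = ennreal (enn2real (D_upper l \<zeta>))" using elim(1) by (simp add: less_top)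
        finally show ?thesis unfolding b_def by (subst cost_le_iff[symmetric]) auto
      qed
      then have T': "T \<zeta> \<in> Argmin l \<zeta>" "\<forall>\<xi>\<in>Argmin l \<zeta>. dist \<xi> \<zeta> \<le> dist (T \<zeta>) \<zeta>"
        using * elim(2) by blast+
      then have "D_upper l \<zeta> = ennreal (dist (T \<zeta>) \<zeta> powr p)"
        unfolding D0_upper_def using p by (intro antisym SUP_upper SUP_least ennreal_leI powr_mono2) auto
      then show ?case using T' by simp
    qed
    then have "map_cost T = (\<integral>\<^sup>+\<zeta>. D_upper l \<zeta> \<partial>\<nu>)"
      unfolding map_cost_def by (intro nn_integral_cong_AE, use TA in eventually_elim) simp
    then show ?thesis using T TA up False by (intro bexI[of _ T]) (auto simp: less_top elim!: eventually_mono)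
  next
    case True
    have "(\<integral>\<^sup>+\<zeta>. D_upper l \<zeta> \<partial>\<nu>) = (SUP n. \<integral>\<^sup>+\<zeta>. D0_truncated l n \<zeta> \<partial>\<nu>)"
      unfolding D0_upper_eq_SUP by (intro nn_integral_monotone_convergence_SUP incseq_D0_truncated) measurable
    then have "ennreal c < (SUP n. \<integral>\<^sup>+\<zeta>. D0_truncated l n \<zeta> \<partial>\<nu>)" using True by simp
    then obtain n where n: "ennreal c < (\<integral>\<^sup>+\<zeta>. D0_truncated l n \<zeta> \<partial>\<nu>)" by (auto simp: less_SUP_iff)
    let ?F = "\<lambda>\<zeta>. {\<xi> \<in> Argmin l \<zeta>. dist \<xi> \<zeta> \<le> real n}"
    obtain S where S [measurable]: "S \<in> borel \<rightarrow>\<^sub>M borel" and *: "\<And>\<zeta>. ?F \<zeta> \<noteq> {} \<Longrightarrow>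
       S \<zeta> \<in> Argmin l \<zeta> \<and> dist (S \<zeta>) \<zeta> \<le> real n \<and>
       (\<forall>\<xi>\<in>Argmin l \<zeta>. dist \<xi> \<zeta> \<le> real n \<longrightarrow> dist \<xi> \<zeta> \<le> dist (S \<zeta>) \<zeta>)"
      using truncated_farthest_selection(1)[of "\<lambda>_. real n" l, OF borel_measurable_const] by blast
    have F [measurable]: "{\<zeta>. ?F \<zeta> \<noteq> {}} \<in> sets borel" by (intro truncated_farthest_selection(2)) simp
    \<comment> \<open>sources without argmin points within distance \<open>n\<close> use the nearest one, whose cost is integrable\<close>
    define T where "T \<zeta> = (if \<zeta> \<in> {\<zeta>. ?F \<zeta> \<noteq> {}} then S \<zeta> else N \<zeta>)" for \<zeta>
    have T: "T \<in> borel \<rightarrow>\<^sub>M borel" unfolding T_def by measurable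
    have TA: "AE \<zeta> in \<nu>. T \<zeta> \<in> Argmin l \<zeta>"
      using ne by eventually_elim (use * Na in \<open>auto simp: T_def\<close>)
    have low: "(\<integral>\<^sup>+\<zeta>. D0_truncated l n \<zeta> \<partial>\<nu>) \<le> map_cost T"
      unfolding map_cost_def
    proof (rule nn_integral_mono)
      fix \<zeta>
      show "D0_truncated l n \<zeta> \<le> ennreal (dist (T \<zeta>) \<zeta> powr p)"
        unfolding D0_truncated_def
      proof (rule SUP_least)
        fix \<xi> assume \<xi>: "\<xi> \<in> ?F \<zeta>"
        then have ne: "?F \<zeta> \<noteq> {}" by blast
        then have "dist \<xi> \<zeta> \<le> dist (T \<zeta>) \<zeta>" using *[OF ne] \<xi> by (auto simp: T_def simp del: Collect_empty_eq)
        then show "ennreal (dist \<xi> \<zeta> powr p) \<le> ennreal (dist (T \<zeta>) \<zeta> powr p)"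
          using p by (intro ennreal_leI powr_mono2) auto
      qed
    qed
    have "map_cost T \<le> (\<integral>\<^sup>+\<zeta>. ennreal (real n powr p) + D_lower l \<zeta> \<partial>\<nu>)"
      unfolding map_cost_def
    proof (rule nn_integral_mono_AE, use ne in eventually_elim)
      fix \<zeta> assume ne: "Argmin l \<zeta> \<noteq> {}"
      show "ennreal (dist (T \<zeta>) \<zeta> powr p) \<le> ennreal (real n powr p) + D_lower l \<zeta>"
      proof (cases "?F \<zeta> = {}")
        case True then show ?thesis using Na[OF ne] by (simp add: T_def del: Collect_empty_eq)
      next
        case False
        then have "dist (T \<zeta>) \<zeta> \<le> real n" using *[OF False] by (simp add: T_def del: Collect_empty_eq)
        then have "ennreal (dist (T \<zeta>) \<zeta> powr p) \<le> ennreal (real n powr p)"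
          using p by (intro ennreal_leI powr_mono2) auto
        then show ?thesis by (rule order_trans) simp
      qed
    qed
    then have "map_cost T \<le> ennreal (real n powr p) + (\<integral>\<^sup>+\<zeta>. D_lower l \<zeta> \<partial>\<nu>)"
      by (subst (asm) nn_integral_add) (auto simp: emeasure_space_1[simplified])
    then have "map_cost T < \<infinity>" by (rule le_less_trans) (use lo in \<open>auto intro: le_less_trans\<close>)
    then show ?thesis using T TA n low by (intro bexI[of _ T]) auto
  qed
  then obtain T where T: "T \<in> borel \<rightarrow>\<^sub>M borel" "AE \<zeta> in \<nu>. T \<zeta> \<in> Argmin l \<zeta>" "map_cost T < \<infinity>" "ennreal c \<le> map_cost T"
    by blast
  define c1 c2 where "c1 = enn2real (map_cost N)" and "c2 = enn2real (map_cost T)"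
  have fN: "map_cost N < \<infinity>" using lo mN by (auto intro: le_less_trans)
  have "map_cost N = ennreal c1" "map_cost T = ennreal c2" "0 \<le> c1" "0 \<le> c2"
    unfolding c1_def c2_def using fN T(3) by auto
  then have c12: "c1 \<le> c" "c \<le> c2" using lo mN T(4) c by auto
  define q where "q = (if c1 = c2 then 1 else (c2 - c) / (c2 - c1))"
  have "q \<in> {0..1}" "q * c1 + (1 - q) * c2 = c"
  proof -
    show "q \<in> {0..1}" unfolding q_def using c12 by (auto simp: field_simps)
    show "q * c1 + (1 - q) * c2 = c"
    proof (cases "c1 = c2")
      case False
      then have "q * (c2 - c1) = c2 - c" unfolding q_def by simp
      then show ?thesis by (simp add: algebra_simps)
    qed (use c12 in \<open>simp add: q_def\<close>)
  qed
  moreover have "AE \<zeta> in \<nu>. N \<zeta> \<in> Argmin l \<zeta> \<and> T \<zeta> \<in> Argmin l \<zeta>"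
    using ne T(2) by eventually_elim (use Na in auto)
  ultimately show ?thesis using N T fN unfolding c1_def c2_def by blast
qed

section \<open>Transport costs around a dual minimizer\<close>

lemma D0_lower_le: "\<xi> \<in> Argmin l \<zeta> \<Longrightarrow> D_lower l \<zeta> \<le> ennreal (dist \<xi> \<zeta> powr p)"
  unfolding D0_lower_def by (rule INF_lower)

lemma D0_upper_ge: "\<xi> \<in> Argmin l \<zeta> \<Longrightarrow> ennreal (dist \<xi> \<zeta> powr p) \<le> D_upper l \<zeta>"
  unfolding D0_upper_def by (rule SUP_upper)

lemma D0_lower_attained:
  assumes "Argmin l \<zeta> \<noteq> {}"
  obtains \<xi> where "\<xi> \<in> Argmin l \<zeta>" "D_lower l \<zeta> = ennreal (dist \<xi> \<zeta> powr p)"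
  using nearest_argmin_selection assms by blast

lemma max_gain_ge_D0_lower:
  assumes "Argmin l \<zeta> \<noteq> {}" "l' \<le> l"
  shows "max_gain l \<zeta> + ennreal (l - l') * D_lower l \<zeta> \<le> max_gain l' \<zeta>"
  using D0_lower_attained[OF assms(1)] argmin_gain_lower[OF _ assms(2)] assms(2)
  by (metis diff_ge_0_iff_ge ennreal_mult powr_ge_zero)

lemma max_gain_le_D0_lower:
  assumes "Argmin l \<zeta> \<noteq> {}" "l \<le> l'"
  shows "max_gain l \<zeta> \<le> max_gain l' \<zeta> + ennreal (l' - l) * D_lower l \<zeta>"
  using D0_lower_attained[OF assms(1)] argmin_gain_upper[OF _ assms(2)] assms(2)
  by (metis diff_ge_0_iff_ge ennreal_mult powr_ge_zero)

lemma total_gain_ge_D0_lower: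
  assumes "\<kappa> < l" "l' \<le> l"
  shows "total_gain l + ennreal (l - l') * (\<integral>\<^sup>+\<zeta>. D_lower l \<zeta> \<partial>\<nu>) \<le> total_gain l'"
proof -
  have "total_gain l + ennreal (l - l') * (\<integral>\<^sup>+\<zeta>. D_lower l \<zeta> \<partial>\<nu>) =
    (\<integral>\<^sup>+\<zeta>. max_gain l \<zeta> + ennreal (l - l') * D_lower l \<zeta> \<partial>\<nu>)"
    unfolding total_gain_def by (simp add: nn_integral_add nn_integral_cmult)
  also have "\<dots> \<le> total_gain l'"
    unfolding total_gain_def using AE_argmin_exists[OF assms(1)] max_gain_ge_D0_lower[OF _ assms(2)]
    by (intro nn_integral_mono_AE) (auto elim!: eventually_mono)
  finally show ?thesis .
qed

lemma total_gain_le_D0_lower: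
  assumes "\<kappa> < l" "l \<le> l'"
  shows "total_gain l \<le> total_gain l' + ennreal (l' - l) * (\<integral>\<^sup>+\<zeta>. D_lower l \<zeta> \<partial>\<nu>)"
proof -
  have "total_gain l \<le> (\<integral>\<^sup>+\<zeta>. max_gain l' \<zeta> + ennreal (l' - l) * D_lower l \<zeta> \<partial>\<nu>)"
    unfolding total_gain_def using AE_argmin_exists[OF assms(1)] max_gain_le_D0_lower[OF _ assms(2)]
    by (intro nn_integral_mono_AE) (auto elim!: eventually_mono)
  also have "\<dots> = total_gain l' + ennreal (l' - l) * (\<integral>\<^sup>+\<zeta>. D_lower l \<zeta> \<partial>\<nu>)"
    unfolding total_gain_def by (simp add: nn_integral_add nn_integral_cmult)
  finally show ?thesis .
qed

lemma D0_lower_integral_finite: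
  assumes "\<kappa> < l" shows "(\<integral>\<^sup>+\<zeta>. D_lower l \<zeta> \<partial>\<nu>) < \<infinity>"
proof -
  obtain l' where l': "\<kappa> < l'" "l' < l" using dense[OF assms] by blast
  have "ennreal (l - l') * (\<integral>\<^sup>+\<zeta>. D_lower l \<zeta> \<partial>\<nu>) \<le> total_gain l'"
    using total_gain_ge_D0_lower[OF assms, of l'] l' by (auto intro: order_trans[rotated])
  also have "\<dots> < \<infinity>" using total_gain_finite l' by simp
  finally show ?thesis using l' by (auto simp: ennreal_mult_less_top)
qed

text \<open>Raising the price from \<open>m\<close> to \<open>l\<close> cannot lower \<open>dual_excess\<close>; it adds \<open>(l - m) * t powr p\<close> and saves at
  least \<open>l - m\<close> times the average cost of argmin points at price \<open>l\<close>.\<close>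

lemma cost_above_minimizer:
  assumes m: "m \<in> Minimizers t" and l: "m < l"
  shows "(\<integral>\<^sup>+\<zeta>. D_lower l \<zeta> \<partial>\<nu>) \<le> ennreal (t powr p)"
proof -
  note fin = dual_minimizer_finite[OF m]
  have l': "\<kappa> < l" "0 \<le> l" using fin l by auto
  obtain g where g: "total_gain l = ennreal g" "0 \<le> g" using total_gain_finite[OF l'(1)] by (cases "total_gain l") auto
  obtain d where d: "(\<integral>\<^sup>+\<zeta>. D_lower l \<zeta> \<partial>\<nu>) = ennreal d" "0 \<le> d"
    using D0_lower_integral_finite[OF l'(1)] by (cases "\<integral>\<^sup>+\<zeta>. D_lower l \<zeta> \<partial>\<nu>") auto
  have "ennreal (m * t powr p) + (ennreal g + ennreal (l - m) * ennreal d) \<le> dual_excess t m"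
    unfolding dual_excess_def using total_gain_ge_D0_lower[OF l'(1), of m] l g d by (intro add_left_mono) simp
  also have "\<dots> \<le> dual_excess t l" using m l' unfolding dual_minimizers_eq by auto
  also have "\<dots> = ennreal (l * t powr p + g)" unfolding dual_excess_def using g l' by (simp add: ennreal_plus)
  also have "ennreal (m * t powr p) + (ennreal g + ennreal (l - m) * ennreal d) = ennreal (m * t powr p + (g + (l - m) * d))"
    using fin l g d by (simp add: ennreal_plus ennreal_mult)
  finally have "m * t powr p + (g + (l - m) * d) \<le> l * t powr p + g"
    using g l' by (subst (asm) ennreal_le_iff) auto
  then have "(l - m) * d \<le> (l - m) * t powr p" by (simp add: algebra_simps)
  then show ?thesis using l d by (auto intro!: ennreal_leI)
qed

text \<open>Lowering the price saves \<open>(m - l) * t powr p\<close> and adds at most \<open>m - l\<close> times the average cost of argmin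
  points at price \<open>l\<close>.\<close>

lemma cost_below_minimizer:
  assumes m: "m \<in> Minimizers t" and l: "\<kappa> < l" "l < m"
  shows "ennreal (t powr p) \<le> (\<integral>\<^sup>+\<zeta>. D_lower l \<zeta> \<partial>\<nu>)"
proof -
  note fin = dual_minimizer_finite[OF m]
  have l0: "0 \<le> l" using l \<kappa>_nonneg by simp
  obtain g where g: "total_gain m = ennreal g" "0 \<le> g" using fin by (cases "total_gain m") auto
  obtain d where d: "(\<integral>\<^sup>+\<zeta>. D_lower l \<zeta> \<partial>\<nu>) = ennreal d" "0 \<le> d"
    using D0_lower_integral_finite[OF l(1)] by (cases "\<integral>\<^sup>+\<zeta>. D_lower l \<zeta> \<partial>\<nu>") auto
  have "ennreal (m * t powr p + g) = dual_excess t m" unfolding dual_excess_def using g fin by (simp add: ennreal_plus)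
  also have "\<dots> \<le> dual_excess t l" using m l0 unfolding dual_minimizers_eq by auto
  also have "\<dots> \<le> ennreal (l * t powr p) + (ennreal g + ennreal (m - l) * ennreal d)"
    unfolding dual_excess_def using total_gain_le_D0_lower[OF l(1), of m] l g d by (intro add_left_mono) simp
  also have "\<dots> = ennreal (l * t powr p + (g + (m - l) * d))"
    using l0 l g d by (simp add: ennreal_plus ennreal_mult)
  finally have "m * t powr p + g \<le> l * t powr p + (g + (m - l) * d)"
    using g l l0 d by (subst (asm) ennreal_le_iff) auto
  then have "(m - l) * t powr p \<le> (m - l) * d" by (simp add: algebra_simps)
  then show ?thesis using l d by (auto intro!: ennreal_leI)
qed

lemma argmin_limit:
  assumes "X \<longlonglongrightarrow> \<xi>" "L \<longlonglongrightarrow> l" "\<And>n. X n \<in> Argmin (L n) \<zeta>"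
  shows "\<xi> \<in> Argmin l \<zeta>"
  unfolding argmin_iff
proof
  fix \<eta>
  have c: "(\<lambda>n. dist (X n) \<zeta> powr p) \<longlonglongrightarrow> dist \<xi> \<zeta> powr p"
    using continuous_on_tendsto_compose[OF continuous_cost[OF continuous_on_id continuous_on_const] assms(1)]
    by (simp add: id_def)
  have "\<Psi> \<eta> - l * dist \<eta> \<zeta> powr p + l * dist \<xi> \<zeta> powr p \<le> \<Psi> \<xi>"
  proof (rule usc_le_limit[OF usc assms(1)])
    show "(\<lambda>n. \<Psi> \<eta> - L n * dist \<eta> \<zeta> powr p + L n * dist (X n) \<zeta> powr p)
       \<longlonglongrightarrow> \<Psi> \<eta> - l * dist \<eta> \<zeta> powr p + l * dist \<xi> \<zeta> powr p"
      by (intro tendsto_intros assms c)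
    fix n
    have "gain (L n) \<eta> \<zeta> \<le> gain (L n) (X n) \<zeta>" using assms(3) argmin_iff by blast
    then show "\<Psi> \<eta> - L n * dist \<eta> \<zeta> powr p + L n * dist (X n) \<zeta> powr p \<le> \<Psi> (X n)" by (simp add: gain_def)
  qed
  then show "gain l \<eta> \<zeta> \<le> gain l \<xi> \<zeta>" by (simp add: gain_def)
qed

lemma argmin_bounded_limit:
  assumes "\<And>n::nat. X n \<in> Argmin (L n) \<zeta>" "L \<longlonglongrightarrow> l" "\<And>n. dist (X n) \<zeta> powr p \<le> s"
  obtains \<xi> r where "\<xi> \<in> Argmin l \<zeta>" "strict_mono r" "(\<lambda>n. dist (X (r n)) \<zeta> powr p) \<longlonglongrightarrow> dist \<xi> \<zeta> powr p"
proof -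
  have s: "0 \<le> s" using assms(3)[of 0] powr_ge_zero order_trans by blast
  have "\<forall>n. X n \<in> cball \<zeta> (s powr (1 / p))" using assms(3) cost_le_iff[OF s] by (auto simp: dist_commute)
  then obtain \<xi> r where r: "strict_mono r" "(X \<circ> r) \<longlonglongrightarrow> \<xi>"
    using compact_cball_proper unfolding compact_def by blast
  have "\<xi> \<in> Argmin l \<zeta>"
    by (rule argmin_limit[OF r(2) LIMSEQ_subseq_LIMSEQ[OF assms(2) r(1)]]) (use assms(1) in auto)
  moreover have "(\<lambda>n. dist (X (r n)) \<zeta> powr p) \<longlonglongrightarrow> dist \<xi> \<zeta> powr p"
    using continuous_on_tendsto_compose[OF continuous_cost[OF continuous_on_id continuous_on_const] r(2)]
    by (simp add: id_def)
  ultimately show ?thesis using that r by blast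
qed

text \<open>Higher prices shorten the moves; this makes monotone convergence in the price possible.\<close>

lemma D0_lower_antimono:
  assumes ne: "Argmin l \<zeta> \<noteq> {}" "Argmin l' \<zeta> \<noteq> {}" and l: "l < l'"
  shows "D_lower l' \<zeta> \<le> D_lower l \<zeta>"
proof -
  obtain \<xi> where \<xi>: "\<xi> \<in> Argmin l \<zeta>" "D_lower l \<zeta> = ennreal (dist \<xi> \<zeta> powr p)"
    using D0_lower_attained[OF ne(1)] .
  obtain \<xi>' where \<xi>': "\<xi>' \<in> Argmin l' \<zeta>" "D_lower l' \<zeta> = ennreal (dist \<xi>' \<zeta> powr p)"
    using D0_lower_attained[OF ne(2)] .
  have "gain l \<xi>' \<zeta> \<le> gain l \<xi> \<zeta>" "gain l' \<xi> \<zeta> \<le> gain l' \<xi>' \<zeta>" using \<xi>(1) \<xi>'(1) argmin_iff by blast+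
  then have "(l' - l) * dist \<xi>' \<zeta> powr p \<le> (l' - l) * dist \<xi> \<zeta> powr p" by (simp add: gain_def algebra_simps)
  then have "dist \<xi>' \<zeta> powr p \<le> dist \<xi> \<zeta> powr p" using l by simp
  then show ?thesis using \<xi>(2) \<xi>'(2) by (simp add: ennreal_leI)
qed

text \<open>As the price decreases to \<open>m\<close>, nearest argmin points with bounded costs accumulate at an argmin point for \<open>m\<close>,
  so \<open>D_lower m\<close> is at most the supremum of their costs.\<close>

lemma minimizer_D0_lower_le:
  assumes m: "m \<in> Minimizers t"
  shows "(\<integral>\<^sup>+\<zeta>. D_lower m \<zeta> \<partial>\<nu>) \<le> ennreal (t powr p)"
proof -
  define L where "L n = m + 1 / Suc n" for n :: nat
  note fin = dual_minimizer_finite[OF m]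
  have L: "m < L n" "\<kappa> < L n" for n unfolding L_def using fin by (auto intro: le_less_trans)
  have "L \<longlonglongrightarrow> m + 0" unfolding L_def by (intro tendsto_add tendsto_const LIMSEQ_Suc[OF lim_const_over_n])
  then have L_lim: "L \<longlonglongrightarrow> m" by simp
  have ne: "AE \<zeta> in \<nu>. \<forall>n. Argmin (L n) \<zeta> \<noteq> {}"
    unfolding AE_all_countable using AE_argmin_exists L by blast
  have "AE \<zeta> in \<nu>. D_lower m \<zeta> \<le> (SUP n. D_lower (L n) \<zeta>)"
    using ne
  proof eventually_elim
    case (elim \<zeta>)
    show ?case
    proof (cases "SUP n. D_lower (L n) \<zeta>")
      case (real s)
      have "\<exists>\<xi>. \<xi> \<in> Argmin (L n) \<zeta> \<and> dist \<xi> \<zeta> powr p \<le> s" for n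
      proof -
        obtain \<xi> where \<xi>: "\<xi> \<in> Argmin (L n) \<zeta>" "D_lower (L n) \<zeta> = ennreal (dist \<xi> \<zeta> powr p)"
          using D0_lower_attained elim by blast
        have "D_lower (L n) \<zeta> \<le> ennreal s" unfolding real(2)[symmetric] by (rule SUP_upper) simp
        then have "dist \<xi> \<zeta> powr p \<le> s" unfolding \<xi>(2) using real(1) by simp
        then show ?thesis using \<xi> by blast
      qed
      then obtain X where X: "\<And>n. X n \<in> Argmin (L n) \<zeta>" "\<And>n. dist (X n) \<zeta> powr p \<le> s" by metis
      obtain \<xi> r where \<xi>: "\<xi> \<in> Argmin m \<zeta>" "(\<lambda>n. dist (X (r n)) \<zeta> powr p) \<longlonglongrightarrow> dist \<xi> \<zeta> powr p"
        using argmin_bounded_limit[OF X(1) L_lim X(2)] by metis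
      have "dist \<xi> \<zeta> powr p \<le> s" by (rule tendsto_upperbound[OF \<xi>(2)]) (use X in auto)
      then show ?thesis unfolding real(2) using D0_lower_le[OF \<xi>(1)] by (meson ennreal_leI order_trans)
    qed (simp only: top_greatest)
  qed
  then have "(\<integral>\<^sup>+\<zeta>. D_lower m \<zeta> \<partial>\<nu>) \<le> (\<integral>\<^sup>+\<zeta>. (SUP n. D_lower (L n) \<zeta>) \<partial>\<nu>)"
    by (rule nn_integral_mono_AE)
  also have "\<dots> = (SUP n. \<integral>\<^sup>+\<zeta>. D_lower (L n) \<zeta> \<partial>\<nu>)"
  proof (rule nn_integral_monotone_convergence_SUP_AE)
    fix n
    have "L (Suc n) < L n" unfolding L_def by (simp add: field_simps)
    then show "AE \<zeta> in \<nu>. D_lower (L n) \<zeta> \<le> D_lower (L (Suc n)) \<zeta>"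
      using ne by (auto elim!: eventually_mono intro: D0_lower_antimono)
  qed simp
  also have "\<dots> \<le> ennreal (t powr p)" by (intro SUP_least cost_above_minimizer[OF m] L)
  finally show ?thesis by simp
qed

text \<open>As the price increases to \<open>m\<close>, the costs of nearest argmin points decrease; an accumulation point lies in the
  argmin set for \<open>m\<close>, so their infimum is at most \<open>D_upper m\<close>.\<close>

lemma minimizer_D0_upper_ge:
  assumes m: "m \<in> Minimizers t" "\<kappa> < m"
  shows "ennreal (t powr p) \<le> (\<integral>\<^sup>+\<zeta>. D_upper m \<zeta> \<partial>\<nu>)"
proof -
  define L where "L n = m - (m - \<kappa>) / Suc (Suc n)" for n :: nat
  have L: "L n < m" "\<kappa> < L n" "L n < L (Suc n)" for n
  proof -
    have "(m - \<kappa>) / Suc (Suc n) < (m - \<kappa>) / 1" "(m - \<kappa>) / Suc (Suc (Suc n)) < (m - \<kappa>) / Suc (Suc n)"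
      using m(2) by (intro divide_strict_left_mono; simp)+
    then show "\<kappa> < L n" "L n < L (Suc n)" unfolding L_def by simp_all
    show "L n < m" unfolding L_def using m(2) by simp
  qed
  have "L \<longlonglongrightarrow> m - 0" unfolding L_def
    by (intro tendsto_diff tendsto_const LIMSEQ_Suc[OF LIMSEQ_Suc[OF lim_const_over_n]])
  then have L_lim: "L \<longlonglongrightarrow> m" by simp
  have ne: "AE \<zeta> in \<nu>. \<forall>n. Argmin (L n) \<zeta> \<noteq> {}"
    unfolding AE_all_countable using AE_argmin_exists L by blast
  have dec: "AE \<zeta> in \<nu>. D_lower (L (Suc n)) \<zeta> \<le> D_lower (L n) \<zeta>" for n
    using ne by eventually_elim (rule D0_lower_antimono, auto simp: L(3))
  have dec': "AE \<zeta> in \<nu>. \<forall>n. D_lower (L (Suc n)) \<zeta> \<le> D_lower (L n) \<zeta>"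
    unfolding AE_all_countable using dec by blast
  have "ennreal (t powr p) \<le> (INF n. \<integral>\<^sup>+\<zeta>. D_lower (L n) \<zeta> \<partial>\<nu>)"
    by (intro INF_greatest cost_below_minimizer[OF m(1)] L)
  also have "\<dots> = (\<integral>\<^sup>+\<zeta>. (INF n. D_lower (L n) \<zeta>) \<partial>\<nu>)"
    by (rule nn_integral_monotone_convergence_INF_AE[symmetric, where i = 0 and f = "\<lambda>n. D_lower (L n)", OF dec])
      (simp_all add: D0_lower_integral_finite[OF L(2), simplified])
  also have "\<dots> \<le> (\<integral>\<^sup>+\<zeta>. D_upper m \<zeta> \<partial>\<nu>)"
  proof (rule nn_integral_mono_AE, use ne dec' in eventually_elim)
    case (elim \<zeta>)
    have "\<exists>\<xi>. \<xi> \<in> Argmin (L n) \<zeta> \<and> D_lower (L n) \<zeta> = ennreal (dist \<xi> \<zeta> powr p)" for n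
      using D0_lower_attained[of "L n" \<zeta>] elim(1) by blast
    then obtain X where X: "\<And>n. X n \<in> Argmin (L n) \<zeta>" "\<And>n. D_lower (L n) \<zeta> = ennreal (dist (X n) \<zeta> powr p)"
      by metis
    have "decseq (\<lambda>n. D_lower (L n) \<zeta>)" using elim(2) by (simp add: decseq_Suc_iff)
    then have "D_lower (L n) \<zeta> \<le> D_lower (L 0) \<zeta>" for n by (simp add: decseq_def)
    then have "dist (X n) \<zeta> powr p \<le> dist (X 0) \<zeta> powr p" for n unfolding X(2) by simp
    then obtain \<xi> r where \<xi>: "\<xi> \<in> Argmin m \<zeta>" "(\<lambda>n. dist (X (r n)) \<zeta> powr p) \<longlonglongrightarrow> dist \<xi> \<zeta> powr p"
      using argmin_bounded_limit[OF X(1) L_lim] by metis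
    have "(INF n. D_lower (L n) \<zeta>) \<le> ennreal (dist \<xi> \<zeta> powr p)"
    proof (rule tendsto_lowerbound[OF tendsto_ennrealI[OF \<xi>(2)]])
      show "eventually (\<lambda>n. (INF n. D_lower (L n) \<zeta>) \<le> ennreal (dist (X (r n)) \<zeta> powr p)) sequentially"
        unfolding X(2)[symmetric] by (intro always_eventually allI INF_lower) simp
    qed simp
    then show ?case using D0_upper_ge[OF \<xi>(1)] by (rule order_trans)
  qed
  finally show ?thesis .
qed

section \<open>Strong duality\<close>

lemma complementary_pair_above_growth_rate:
  assumes m: "m \<in> Minimizers t" "\<kappa> < m"
  shows "\<exists>q T\<^sub>1 T\<^sub>2. complementary_pair t m q T\<^sub>1 T\<^sub>2"
  using mixed_argmin_selection[OF AE_argmin_exists[OF m(2)] _ minimizer_D0_lower_le[OF m(1)] minimizer_D0_upper_ge[OF m]] m(1)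
  unfolding complementary_pair_def by fastforce

text \<open>Below the growth rate the total gain is infinite, so restricting the targets to large balls
  yields maps that move mass far while earning at least \<open>l'\<close> per unit of cost.\<close>

lemma far_profitable_map:
  assumes l': "0 < l'" "l' < \<kappa>"
  shows "\<exists>S\<in>borel \<rightarrow>\<^sub>M borel. map_cost S < \<infinity> \<and> B \<le> enn2real (map_cost S) \<and>
    integrable \<nu> (\<lambda>\<zeta>. \<Psi> (S \<zeta>)) \<and> (\<integral>\<zeta>. \<Psi> \<zeta> \<partial>\<nu>) + l' * enn2real (map_cost S) \<le> (\<integral>\<zeta>. \<Psi> (S \<zeta>) \<partial>\<nu>)"
proof -
  define K where "K n = cball (undefined :: 'a) (real n)" for n :: nat
  have K: "compact (K n)" "K n \<noteq> {}" for n unfolding K_def using compact_cball_proper by auto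
  have "\<exists>T\<in>borel \<rightarrow>\<^sub>M borel. \<forall>\<zeta>. T \<zeta> \<in> K n \<and> (\<forall>\<eta>\<in>K n. gain l' \<eta> \<zeta> \<le> gain l' (T \<zeta>) \<zeta>)" for n
  proof -
    let ?G = "{(\<xi> :: 'a, \<zeta> :: 'a). \<xi> \<in> K n \<and> (\<forall>\<eta>\<in>K n. gain l' \<eta> \<zeta> \<le> gain l' \<xi> \<zeta>)}"
    have "closed {x. \<Psi> \<eta> \<le> \<Psi> (fst x) + (l' * dist \<eta> (snd x) powr p - l' * dist (fst x) (snd x) powr p)}" for \<eta>
      by (intro usc_closed_superlevel usc_add_continuous usc_compose_continuous[OF usc] continuous_intros continuous_cost)
    then have "closed (K n \<times> UNIV \<inter> (\<Inter>\<eta>\<in>K n. {x. \<Psi> \<eta> \<le> \<Psi> (fst x) + (l' * dist \<eta> (snd x) powr p - l' * dist (fst x) (snd x) powr p)}))"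
      using K by (intro closed_Int closed_Times closed_INT) (auto simp: compact_imp_closed)
    moreover have "K n \<times> UNIV \<inter> (\<Inter>\<eta>\<in>K n. {x. \<Psi> \<eta> \<le> \<Psi> (fst x) + (l' * dist \<eta> (snd x) powr p - l' * dist (fst x) (snd x) powr p)}) = ?G"
      by (auto simp: gain_def algebra_simps)
    ultimately have "closed ?G" by simp
    then have h: "hit_measurable borel (\<lambda>\<zeta>. {\<xi>. (\<xi>, \<zeta>) \<in> ?G})" by (rule hit_measurable_closed_graph)
    have ne: "{\<xi>. (\<xi>, \<zeta>) \<in> ?G} \<noteq> {}" for \<zeta>
    proof -
      obtain \<xi> where "\<xi> \<in> K n" "\<forall>\<eta>\<in>K n. gain l' \<eta> \<zeta> \<le> gain l' \<xi> \<zeta>"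
        using usc_attains_sup[OF usc_gain_target[of l' \<zeta>] K[of n]] by (rule bexE)
      then have "\<xi> \<in> {\<xi>. (\<xi>, \<zeta>) \<in> ?G}" by simp
      then show ?thesis by (rule ex_in_conv[THEN iffD1, OF exI])
    qed
    obtain T where "T \<in> borel \<rightarrow>\<^sub>M borel" "\<forall>\<zeta>. T \<zeta> \<in> {\<xi>. (\<xi>, \<zeta>) \<in> ?G}"
      using measurable_selection_total[OF h ne] by (rule bexE)
    then show ?thesis by (intro bexI[of _ T]) simp_all
  qed
  then have "\<forall>n. \<exists>T. T \<in> borel \<rightarrow>\<^sub>M borel \<and> (\<forall>\<zeta>. T \<zeta> \<in> K n \<and> (\<forall>\<eta>\<in>K n. gain l' \<eta> \<zeta> \<le> gain l' (T \<zeta>) \<zeta>))"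
    by (simp add: Bex_def)
  from choice[OF this]
  obtain T where T [measurable]: "\<And>n. T n \<in> borel \<rightarrow>\<^sub>M borel"
    and TK: "\<And>n \<zeta>. T n \<zeta> \<in> K n" and Tmax: "\<And>n \<zeta> \<eta>. \<eta> \<in> K n \<Longrightarrow> gain l' \<eta> \<zeta> \<le> gain l' (T n \<zeta>) \<zeta>" by auto
  have g_meas: "(\<lambda>\<zeta>. gain l' (S \<zeta>) \<zeta>) \<in> borel_measurable borel" if [measurable]: "S \<in> borel \<rightarrow>\<^sub>M borel" for S
    unfolding gain_def by measurable
  \<comment> \<open>moving only when it pays bounds the cost by the gain in \<open>\<Psi>\<close>, which is integrable\<close>
  define S where "S n \<zeta> = (if 0 < gain l' (T n \<zeta>) \<zeta> then T n \<zeta> else \<zeta>)" for n \<zeta>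
  have S [measurable]: "S n \<in> borel \<rightarrow>\<^sub>M borel" for n
    unfolding S_def using g_meas[OF T[of n]] by measurable
  have Sg: "gain l' (S n \<zeta>) \<zeta> = max 0 (gain l' (T n \<zeta>) \<zeta>)" for n \<zeta> unfolding S_def by auto
  define a where "a n \<zeta> = ennreal (gain l' (S n \<zeta>) \<zeta>)" for n \<zeta>
  have [measurable]: "a n \<in> borel_measurable borel" for n unfolding a_def using g_meas[OF S] by measurable
  have a: "ennreal (gain l' \<eta> \<zeta>) \<le> a n \<zeta>" if "\<eta> \<in> K n" for \<eta> n \<zeta>
    unfolding a_def Sg using Tmax[OF that, of \<zeta>] by (auto intro!: ennreal_leI)
  have inc: "incseq a"
    unfolding incseq_def le_fun_def
  proof safe
    fix m n :: nat and \<zeta> assume "m \<le> n"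
    then have "K m \<subseteq> K n" unfolding K_def by auto
    then have "gain l' (T m \<zeta>) \<zeta> \<le> gain l' (T n \<zeta>) \<zeta>" using Tmax TK by blast
    then show "a m \<zeta> \<le> a n \<zeta>" unfolding a_def Sg by (auto intro!: ennreal_leI)
  qed
  have "(SUP n. \<integral>\<^sup>+\<zeta>. a n \<zeta> \<partial>\<nu>) = (\<integral>\<^sup>+\<zeta>. (SUP n. a n \<zeta>) \<partial>\<nu>)"
    using inc by (intro nn_integral_monotone_convergence_SUP[symmetric]) auto
  also have "\<dots> \<ge> total_gain l'"
    unfolding total_gain_def
  proof (rule nn_integral_mono)
    fix \<zeta>
    show "max_gain l' \<zeta> \<le> (SUP n. a n \<zeta>)"
      unfolding max_gain_def
    proof (rule SUP_least)
      fix \<xi> :: 'a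
      obtain n where "dist undefined \<xi> \<le> real n" using real_arch_simple by blast
      then have "ennreal (gain l' \<xi> \<zeta>) \<le> a n \<zeta>" by (intro a) (simp add: K_def)
      then show "ennreal (gain l' \<xi> \<zeta>) \<le> (SUP n. a n \<zeta>)" by (rule SUP_upper2[rotated]) simp
    qed
  qed
  finally have sup: "(SUP n. \<integral>\<^sup>+\<zeta>. a n \<zeta> \<partial>\<nu>) = \<infinity>" using total_gain_infinite[of l'] l' by (simp add: top_unique)
  define l where "l = \<kappa> + 1"
  obtain g where g: "total_gain l = ennreal g" "0 \<le> g"
    using total_gain_finite[of l] unfolding l_def by (cases "total_gain (\<kappa> + 1)") auto
  have "ennreal ((l - l') * \<bar>B\<bar> + g) < (SUP n. \<integral>\<^sup>+\<zeta>. a n \<zeta> \<partial>\<nu>)" unfolding sup by simp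
  then obtain n where n: "ennreal ((l - l') * \<bar>B\<bar> + g) < (\<integral>\<^sup>+\<zeta>. a n \<zeta> \<partial>\<nu>)" by (auto simp: less_SUP_iff)
  obtain x0 where x0: "\<forall>y\<in>K n. \<Psi> y \<le> \<Psi> x0" using usc_attains_sup[OF usc K] by blast
  have Sge: "0 \<le> gain l' (S n \<zeta>) \<zeta>" for \<zeta> unfolding Sg by simp
  have Sle: "\<Psi> (S n \<zeta>) \<le> \<bar>\<Psi> x0\<bar> + \<bar>\<Psi> \<zeta>\<bar>" for \<zeta>
    using x0 TK[of n \<zeta>] unfolding S_def by (auto intro: order_trans)
  have cb: "l' * dist (S n \<zeta>) \<zeta> powr p \<le> \<bar>\<Psi> x0\<bar> + 2 * \<bar>\<Psi> \<zeta>\<bar>" for \<zeta>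
    using Sge[of \<zeta>] Sle[of \<zeta>] unfolding gain_def by auto
  have i1: "integrable \<nu> (\<lambda>\<zeta>. \<bar>\<Psi> x0\<bar> + 2 * \<bar>\<Psi> \<zeta>\<bar>)" using int by auto
  have i2: "integrable \<nu> (\<lambda>\<zeta>. l' * dist (S n \<zeta>) \<zeta> powr p)"
    using cb l' by (intro Bochner_Integration.integrable_bound[OF i1]) auto
  then have i2': "integrable \<nu> (\<lambda>\<zeta>. dist (S n \<zeta>) \<zeta> powr p)" using l' by auto
  then have fin: "map_cost (S n) < \<infinity>"
    unfolding map_cost_def by (auto simp: real_integrable_def less_top)
  have i3: "integrable \<nu> (\<lambda>\<zeta>. \<Psi> (S n \<zeta>))"
  proof (intro Bochner_Integration.integrable_bound[OF i1] AE_I2)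
    fix \<zeta>
    have "0 \<le> l' * dist (S n \<zeta>) \<zeta> powr p" using l' by auto
    then have "\<Psi> \<zeta> \<le> \<Psi> (S n \<zeta>)" using Sge[of \<zeta>] unfolding gain_def by auto
    then show "norm (\<Psi> (S n \<zeta>)) \<le> norm (\<bar>\<Psi> x0\<bar> + 2 * \<bar>\<Psi> \<zeta>\<bar>)" using Sle[of \<zeta>] by auto
  qed simp
  have "0 \<le> (\<integral>\<zeta>. gain l' (S n \<zeta>) \<zeta> \<partial>\<nu>)" using Sge by (intro integral_nonneg_AE) auto
  also have "(\<integral>\<zeta>. gain l' (S n \<zeta>) \<zeta> \<partial>\<nu>) = (\<integral>\<zeta>. \<Psi> (S n \<zeta>) \<partial>\<nu>) - (\<integral>\<zeta>. \<Psi> \<zeta> \<partial>\<nu>) - l' * (\<integral>\<zeta>. dist (S n \<zeta>) \<zeta> powr p \<partial>\<nu>)"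
    unfolding gain_def using i2' i3 int by simp
  also have "(\<integral>\<zeta>. dist (S n \<zeta>) \<zeta> powr p \<partial>\<nu>) = enn2real (map_cost (S n))"
    unfolding map_cost_def by (rule integral_eq_nn_integral) auto
  finally have val: "(\<integral>\<zeta>. \<Psi> \<zeta> \<partial>\<nu>) + l' * enn2real (map_cost (S n)) \<le> (\<integral>\<zeta>. \<Psi> (S n \<zeta>) \<partial>\<nu>)" by simp
  obtain c where c: "map_cost (S n) = ennreal c" "0 \<le> c" using fin by (cases "map_cost (S n)") auto
  have ll: "0 \<le> l - l'" unfolding l_def using l' by simp
  have "(\<integral>\<^sup>+\<zeta>. a n \<zeta> \<partial>\<nu>) \<le> (\<integral>\<^sup>+\<zeta>. ennreal (l - l') * ennreal (dist (S n \<zeta>) \<zeta> powr p) + max_gain l \<zeta> \<partial>\<nu>)"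
  proof (rule nn_integral_mono)
    fix \<zeta>
    have "a n \<zeta> \<le> ennreal ((l - l') * dist (S n \<zeta>) \<zeta> powr p + max 0 (gain l (S n \<zeta>) \<zeta>))"
      unfolding a_def gain_shift[of l' _ _ l] by (intro ennreal_leI) auto
    also have "\<dots> = ennreal (l - l') * ennreal (dist (S n \<zeta>) \<zeta> powr p) + ennreal (gain l (S n \<zeta>) \<zeta>)"
      using ll by (simp add: ennreal_plus ennreal_mult max_def ennreal_neg)
    also have "\<dots> \<le> ennreal (l - l') * ennreal (dist (S n \<zeta>) \<zeta> powr p) + max_gain l \<zeta>"
      by (intro add_left_mono gain_le_max_gain)
    finally show "a n \<zeta> \<le> ennreal (l - l') * ennreal (dist (S n \<zeta>) \<zeta> powr p) + max_gain l \<zeta>" .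
  qed
  also have "\<dots> = ennreal (l - l') * map_cost (S n) + total_gain l"
    unfolding map_cost_def total_gain_def by (simp add: nn_integral_add nn_integral_cmult)
  also have "\<dots> = ennreal ((l - l') * c + g)" using c g ll by (simp add: ennreal_plus ennreal_mult)
  finally have "ennreal ((l - l') * \<bar>B\<bar> + g) < ennreal ((l - l') * c + g)" using n by simp
  then have "(l - l') * \<bar>B\<bar> < (l - l') * c" using ll g by (subst (asm) ennreal_less_iff) auto
  then have "B \<le> c" using ll by (auto simp: mult_less_cancel_left)
  then show ?thesis using S[of n] fin i3 val c by (intro bexI[of _ "S n"]) auto
qed

definition near_optimal_pair :: "real \<Rightarrow> real \<Rightarrow> real \<Rightarrow> ('a \<Rightarrow> 'a) \<Rightarrow> ('a \<Rightarrow> 'a) \<Rightarrow> bool" where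
  "near_optimal_pair t \<epsilon> q T\<^sub>1 T\<^sub>2 \<longleftrightarrow> q \<in> {0..1} \<and> T\<^sub>1 \<in> borel \<rightarrow>\<^sub>M borel \<and> T\<^sub>2 \<in> borel \<rightarrow>\<^sub>M borel \<and>
     map_cost T\<^sub>1 < \<infinity> \<and> map_cost T\<^sub>2 < \<infinity> \<and>
     q * enn2real (map_cost T\<^sub>1) + (1 - q) * enn2real (map_cost T\<^sub>2) \<le> t powr p \<and>
     integrable \<nu> (\<lambda>\<zeta>. \<Psi> (T\<^sub>1 \<zeta>)) \<and> integrable \<nu> (\<lambda>\<zeta>. \<Psi> (T\<^sub>2 \<zeta>)) \<and>
     Dual t \<le> ereal (q * (\<integral>\<zeta>. \<Psi> (T\<^sub>1 \<zeta>) \<partial>\<nu>) + (1 - q) * (\<integral>\<zeta>. \<Psi> (T\<^sub>2 \<zeta>) \<partial>\<nu>) + \<epsilon>)"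

lemma dual_value_real:
  assumes "m \<in> Minimizers t"
  shows "Dual t = ereal ((\<integral>\<zeta>. \<Psi> \<zeta> \<partial>\<nu>) + m * t powr p + enn2real (total_gain m))"
  unfolding dual_value_minimizer[OF assms] dual_excess_def using dual_minimizer_finite[OF assms]
  by (cases "total_gain m") (auto simp: enn2ereal_ennreal ennreal_plus[symmetric] simp del: ennreal_plus)

text \<open>If the growth rate itself is the minimizer, argmin maps for slightly larger multipliers respect
  the budget, and sending a small fraction of the mass far away uses up what is left of it.\<close>

lemma near_optimal_pair_exists:
  assumes t: "0 < t" and \<epsilon>: "0 < \<epsilon>"
  shows "\<exists>q T\<^sub>1 T\<^sub>2. near_optimal_pair t \<epsilon> q T\<^sub>1 T\<^sub>2"
proof -
  obtain m where m: "m \<in> Minimizers t" using dual_minimizer_exists[OF t] by blast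
  note fin = dual_minimizer_finite[OF m]
  show ?thesis
  proof (cases "\<kappa> < m")
    case True
    then obtain q T\<^sub>1 T\<^sub>2 where S: "complementary_pair t m q T\<^sub>1 T\<^sub>2" using complementary_pair_above_growth_rate[OF m] by blast
    have "near_optimal_pair t \<epsilon> q T\<^sub>1 T\<^sub>2"
      using S complementary_pair_value[OF S t] \<epsilon> unfolding near_optimal_pair_def complementary_pair_def
      by (auto simp flip: complementary_pair_value(3)[OF S t])
    then show ?thesis by blast
  next
    case False
    then have mk: "m = \<kappa>" using fin by simp
    define G where "G l = enn2real (total_gain l)" for l
    have "(\<lambda>n. total_gain (\<kappa> + 1 / Suc n)) \<longlonglongrightarrow> total_gain \<kappa>"
      by (subst total_gain_right_continuous[of \<kappa>], rule LIMSEQ_SUP)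
         (auto simp: incseq_def intro!: total_gain_antimono divide_left_mono)
    then have "(\<lambda>n. G (\<kappa> + 1 / Suc n)) \<longlonglongrightarrow> G \<kappa>"
      unfolding G_def using fin mk by (intro tendsto_enn2real) (auto simp: less_top)
    then have "eventually (\<lambda>n. G \<kappa> - \<epsilon> / 3 < G (\<kappa> + 1 / Suc n)) sequentially"
      using \<epsilon> by (intro order_tendstoD(1)) auto
    then obtain n where "G \<kappa> - \<epsilon> / 3 < G (\<kappa> + 1 / Suc n)" by (auto simp: eventually_sequentially)
    then obtain l where l: "\<kappa> < l" "G \<kappa> - \<epsilon> / 3 < G l" using that[of "\<kappa> + 1 / Suc n"] by (metis less_add_same_cancel1 of_nat_0_less_iff zero_less_Suc zero_less_divide_1_iff)
    have l0: "0 \<le> l" "total_gain l < \<infinity>" using l \<kappa>_nonneg total_gain_finite by auto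
    obtain N where N: "N \<in> borel \<rightarrow>\<^sub>M borel" and Na: "\<And>\<zeta>. Argmin l \<zeta> \<noteq> {} \<Longrightarrow>
       N \<zeta> \<in> Argmin l \<zeta> \<and> D_lower l \<zeta> = ennreal (dist (N \<zeta>) \<zeta> powr p)"
      using nearest_argmin_selection by blast
    have NA: "AE \<zeta> in \<nu>. N \<zeta> \<in> Argmin l \<zeta>"
      using AE_argmin_exists[OF l(1)] by eventually_elim (use Na in blast)
    have "map_cost N = (\<integral>\<^sup>+\<zeta>. D_lower l \<zeta> \<partial>\<nu>)"
      unfolding map_cost_def by (rule nn_integral_cong_AE, use AE_argmin_exists[OF l(1)] in eventually_elim) (use Na in simp)
    then have "map_cost N \<le> ennreal (t powr p)" using cost_above_minimizer[OF m, of l] l mk by simp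
    then obtain C where C: "map_cost N = ennreal C" "0 \<le> C" "C \<le> t powr p"
      by (cases "map_cost N") (auto simp: top_unique)
    have "map_cost N < \<infinity>" using C by simp
    note vN = integral_along_argmin[OF l0 N NA this]
    have vN2: "(\<integral>\<zeta>. \<Psi> (N \<zeta>) \<partial>\<nu>) = (\<integral>\<zeta>. \<Psi> \<zeta> \<partial>\<nu>) + l * C + G l" using vN(2) C unfolding G_def by simp
    have dv: "Dual t = ereal ((\<integral>\<zeta>. \<Psi> \<zeta> \<partial>\<nu>) + \<kappa> * t powr p + G \<kappa>)"
      using dual_value_real[OF m] mk unfolding G_def by simp
    show ?thesis
    proof (cases "\<kappa> = 0")
      case True
      have "0 \<le> l * C" using l0 C by simp
      then have "near_optimal_pair t \<epsilon> 1 N N"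
        unfolding near_optimal_pair_def dv using N C vN(1) vN2 True l(2) \<epsilon> by simp
      then show ?thesis by blast
    next
      case False
      then have k0: "0 < \<kappa>" using \<kappa>_nonneg by simp
      have tp: "0 < t powr p" using t by simp
      \<comment> \<open>a price below \<open>\<kappa>\<close> at which valuing the whole budget loses at most \<open>\<epsilon> / 3\<close>\<close>
      define l' where "l' = \<kappa> - min (\<kappa> / 2) (\<epsilon> / (3 * t powr p))"
      have l'1: "0 < l'" "l' < \<kappa>" unfolding l'_def using k0 \<epsilon> tp by (auto simp: min_def)
      have "(\<kappa> - l') * t powr p \<le> \<epsilon> / (3 * t powr p) * t powr p"
        unfolding l'_def using tp by (intro mult_right_mono) auto
      also have "\<dots> = \<epsilon> / 3" using tp by simp
      finally have l'2: "(\<kappa> - l') * t powr p \<le> \<epsilon> / 3" .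
      have G0: "0 \<le> G l" unfolding G_def by simp
      \<comment> \<open>a cost this large makes the fraction \<open>q\<close> of moved mass forgo at most \<open>\<epsilon> / 3\<close> of the gain \<open>G l\<close>\<close>
      define B where "B = t powr p + 1 + 3 * t powr p * G l / \<epsilon>"
      obtain S where S: "S \<in> borel \<rightarrow>\<^sub>M borel" "map_cost S < \<infinity>" "B \<le> enn2real (map_cost S)"
        "integrable \<nu> (\<lambda>\<zeta>. \<Psi> (S \<zeta>))" "(\<integral>\<zeta>. \<Psi> \<zeta> \<partial>\<nu>) + l' * enn2real (map_cost S) \<le> (\<integral>\<zeta>. \<Psi> (S \<zeta>) \<partial>\<nu>)"
        using far_profitable_map[OF l'1] by blast
      define c where "c = enn2real (map_cost S)"
      have "0 \<le> 3 * t powr p * G l / \<epsilon>" using tp G0 \<epsilon> by simp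
      then have c: "t powr p < c" "3 * t powr p * G l / \<epsilon> \<le> c" using S(3) tp unfolding B_def c_def by linarith+
      define q where "q = (t powr p - C) / (c - C)"
      have q: "0 \<le> q" "q \<le> 1" "q * (c - C) = t powr p - C"
        unfolding q_def using C c by (auto simp: field_simps)
      have qC: "q * c + (1 - q) * C = t powr p" using q(3) by (simp add: algebra_simps)
      have "0 \<le> (1 - q) * C" using q C by simp
      then have "q * c \<le> t powr p" using qC by simp
      then have "q * (3 * t powr p * G l / \<epsilon>) \<le> t powr p"
        using mult_left_mono[OF c(2) q(1)] by simp
      then have "t powr p * (3 * q * G l) \<le> t powr p * \<epsilon>" using \<epsilon> by (simp add: field_simps)
      then have qG: "q * G l \<le> \<epsilon> / 3" using tp by simp
      have "q * ((\<integral>\<zeta>. \<Psi> \<zeta> \<partial>\<nu>) + l' * c) \<le> q * (\<integral>\<zeta>. \<Psi> (S \<zeta>) \<partial>\<nu>)"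
        using S(5) q unfolding c_def by (intro mult_left_mono) auto
      moreover have "(1 - q) * ((\<integral>\<zeta>. \<Psi> \<zeta> \<partial>\<nu>) + l' * C + G l) \<le> (1 - q) * (\<integral>\<zeta>. \<Psi> (N \<zeta>) \<partial>\<nu>)"
        unfolding vN2 using q C l l'1 by (intro mult_left_mono add_mono mult_right_mono) auto
      moreover have "q * ((\<integral>\<zeta>. \<Psi> \<zeta> \<partial>\<nu>) + l' * c) + (1 - q) * ((\<integral>\<zeta>. \<Psi> \<zeta> \<partial>\<nu>) + l' * C + G l) =
        (\<integral>\<zeta>. \<Psi> \<zeta> \<partial>\<nu>) + l' * (q * c + (1 - q) * C) + G l - q * G l" by (simp add: algebra_simps)
      ultimately have "(\<integral>\<zeta>. \<Psi> \<zeta> \<partial>\<nu>) + l' * t powr p + G l - q * G l \<le> q * (\<integral>\<zeta>. \<Psi> (S \<zeta>) \<partial>\<nu>) + (1 - q) * (\<integral>\<zeta>. \<Psi> (N \<zeta>) \<partial>\<nu>)"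
        unfolding qC by linarith
      moreover have "\<kappa> * t powr p = (\<kappa> - l') * t powr p + l' * t powr p" by (simp add: algebra_simps)
      ultimately have "(\<integral>\<zeta>. \<Psi> \<zeta> \<partial>\<nu>) + \<kappa> * t powr p + G \<kappa> \<le> q * (\<integral>\<zeta>. \<Psi> (S \<zeta>) \<partial>\<nu>) + (1 - q) * (\<integral>\<zeta>. \<Psi> (N \<zeta>) \<partial>\<nu>) + \<epsilon>"
        using l'2 qG l(2) by linarith
      then have "near_optimal_pair t \<epsilon> q S N"
        unfolding near_optimal_pair_def dv using N S C vN(1) q qC[unfolded c_def] by simp
      then show ?thesis by blast
    qed
  qed
qed

lemma strong_duality:
  assumes t: "0 < t"
  shows "Primal t = Dual t"
proof (rule antisym[OF primal_le_dual[OF t] ereal_le_epsilon2])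
  fix \<epsilon> :: real assume "0 < \<epsilon>"
  then obtain q T\<^sub>1 T\<^sub>2 where M: "near_optimal_pair t \<epsilon> q T\<^sub>1 T\<^sub>2" using near_optimal_pair_exists[OF t] by blast
  then have q: "q \<in> {0..1}" and T: "T\<^sub>1 \<in> borel \<rightarrow>\<^sub>M borel" "T\<^sub>2 \<in> borel \<rightarrow>\<^sub>M borel"
    and C: "map_cost T\<^sub>1 < \<infinity>" "map_cost T\<^sub>2 < \<infinity>"
    and le: "q * enn2real (map_cost T\<^sub>1) + (1 - q) * enn2real (map_cost T\<^sub>2) \<le> t powr p"
    and i: "integrable \<nu> (\<lambda>\<zeta>. \<Psi> (T\<^sub>1 \<zeta>))" "integrable \<nu> (\<lambda>\<zeta>. \<Psi> (T\<^sub>2 \<zeta>))"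
    and v: "Dual t \<le> ereal (q * (\<integral>\<zeta>. \<Psi> (T\<^sub>1 \<zeta>) \<partial>\<nu>) + (1 - q) * (\<integral>\<zeta>. \<Psi> (T\<^sub>2 \<zeta>) \<partial>\<nu>) + \<epsilon>)"
    unfolding near_optimal_pair_def by auto
  let ?\<mu> = "mixture q (push \<nu> T\<^sub>1) (push \<nu> T\<^sub>2)"
  have "?\<mu> \<in> primal_feasible p \<nu> t" by (rule mixture_feasible(1)[OF t q T C le])
  then have "ereal_integral ?\<mu> (\<lambda>\<xi>. ereal (\<Psi> \<xi>)) \<le> Primal t"
    unfolding primal_value_def by (rule SUP_upper)
  then have "ereal (q * (\<integral>\<zeta>. \<Psi> (T\<^sub>1 \<zeta>) \<partial>\<nu>) + (1 - q) * (\<integral>\<zeta>. \<Psi> (T\<^sub>2 \<zeta>) \<partial>\<nu>)) + ereal \<epsilon> \<le> Primal t + ereal \<epsilon>"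
    unfolding ereal_integral_mixture_push[OF \<nu> T q \<Psi>_borel i] by (rule add_right_mono)
  then show "Dual t \<le> Primal t + ereal \<epsilon>" using v by simp
qed

section \<open>Mass and cost of a worst case\<close>

lemma worst_case_parts:
  assumes t: "0 < t" and w: "Worst t \<mu>" and m: "m \<in> Minimizers t"
  obtains u v where "0 \<le> u" "0 \<le> v" "(\<integral>\<^sup>+\<xi>. ennreal (\<Psi> \<xi>) \<partial>\<mu>) = ennreal u" "(\<integral>\<^sup>+\<xi>. ennreal (- \<Psi> \<xi>) \<partial>\<mu>) = ennreal v"
    "u - v = (\<integral>\<zeta>. \<Psi> \<zeta> \<partial>\<nu>) + m * t powr p + enn2real (total_gain m)"
proof -
  have "ereal_integral \<mu> (\<lambda>\<xi>. ereal (\<Psi> \<xi>)) = Dual t"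
    using w strong_duality[OF t] unfolding worst_case_def by auto
  then have "enn2ereal (\<integral>\<^sup>+\<xi>. ennreal (\<Psi> \<xi>) \<partial>\<mu>) - enn2ereal (\<integral>\<^sup>+\<xi>. ennreal (- \<Psi> \<xi>) \<partial>\<mu>)
     = ereal ((\<integral>\<zeta>. \<Psi> \<zeta> \<partial>\<nu>) + m * t powr p + enn2real (total_gain m))"
    unfolding dual_value_real[OF m] ereal_integral_def by simp
  then show ?thesis using that
    by (cases "\<integral>\<^sup>+\<xi>. ennreal (\<Psi> \<xi>) \<partial>\<mu>"; cases "\<integral>\<^sup>+\<xi>. ennreal (- \<Psi> \<xi>) \<partial>\<mu>") (auto simp: enn2ereal_ennreal)
qed

text \<open>Along couplings whose cost tends to the budget, the total slack tends to zero.
  On a compact set of targets that misses every argmin set the slack is positive, so such couplings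
  carry little mass there.\<close>

lemma worst_case_mass_compact:
  assumes t: "0 < t" and w: "Worst t \<mu>" and m: "m \<in> Minimizers t" and K: "compact K"
  shows "emeasure \<mu> K \<le> emeasure \<nu> {\<zeta>. Argmin m \<zeta> \<inter> K \<noteq> {}}"
proof -
  note fin = dual_minimizer_finite[OF m]
  have \<mu>: "\<mu> \<in> borel_probs" "Wpp p \<mu> \<nu> \<le> ennreal (t powr p)"
    using w primal_feasible_iff[OF t] unfolding worst_case_def by auto
  obtain a b where ab: "0 \<le> a" "0 \<le> b" "(\<integral>\<^sup>+\<zeta>. ennreal (\<Psi> \<zeta>) \<partial>\<nu>) = ennreal a" "(\<integral>\<^sup>+\<zeta>. ennreal (- \<Psi> \<zeta>) \<partial>\<nu>) = ennreal b"
    "(\<integral>\<zeta>. \<Psi> \<zeta> \<partial>\<nu>) = a - b" by (rule integrable_parts[OF int])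
  obtain g where g: "total_gain m = ennreal g" "0 \<le> g" using fin by (cases "total_gain m") auto
  obtain u v where uv: "0 \<le> u" "0 \<le> v" "(\<integral>\<^sup>+\<xi>. ennreal (\<Psi> \<xi>) \<partial>\<mu>) = ennreal u" "(\<integral>\<^sup>+\<xi>. ennreal (- \<Psi> \<xi>) \<partial>\<mu>) = ennreal v"
    "u - v = a - b + m * t powr p + g"
    using worst_case_parts[OF t w m] unfolding ab(5) g(1) enn2real_ennreal[OF g(2)] .
  have \<gamma>_ex: "\<exists>\<gamma>\<in>couplings \<mu> \<nu>. transport_cost p \<gamma> < ennreal (t powr p + e)" if "0 < e" for e
  proof -
    have "Wpp p \<mu> \<nu> < ennreal (t powr p + e)" using \<mu>(2) that by (auto simp: ennreal_less_iff intro: le_less_trans)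
    then show ?thesis unfolding Wpp_def by (auto simp: INF_less_iff)
  qed
  define G where "G n = {(\<xi>, \<zeta>). \<forall>\<eta>. gain m \<eta> \<zeta> \<le> gain m \<xi> \<zeta> + 1 / Suc n}" for n :: nat
  define H where "H n = {\<zeta>. \<exists>\<xi>\<in>K. (\<xi>, \<zeta>) \<in> G n}" for n
  have H [measurable]: "H n \<in> sets borel" for n
    unfolding H_def using closed_projection[OF closed_near_argmin_graph[of m "1 / Suc n", folded G_def] K] by simp
  have le: "emeasure \<mu> K \<le> emeasure \<nu> (H n)" for n
  proof (rule ennreal_le_epsilon)
    fix e :: real assume e: "0 < e"
    define \<delta> where "\<delta> = 1 / real (Suc n)"
    have \<delta>: "0 < \<delta>" unfolding \<delta>_def by simp
    \<comment> \<open>excess cost \<open>e'\<close> leaves total slack at most \<open>\<delta> * e\<close>, hence mass at most \<open>e\<close> on pairs with slack \<open>\<delta>\<close>\<close>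
    define e' where "e' = \<delta> * e / (m + 1)"
    have e': "0 < e'" "m * e' \<le> \<delta> * e" unfolding e'_def using fin(2) e \<delta> by (auto simp: field_simps)
    obtain \<gamma> where \<gamma>: "\<gamma> \<in> couplings \<mu> \<nu>" "transport_cost p \<gamma> < ennreal (t powr p + e')" using \<gamma>_ex[OF e'(1)] by blast
    note \<gamma>' = couplingsD(1-7)[OF \<gamma>(1)] and fs = couplingsD(4,5)[OF \<gamma>(1)] and sp = couplingsD(2)[OF \<gamma>(1)]
    interpret \<gamma>: prob_space \<gamma> by (rule \<gamma>'(3))
    have Kb: "K \<in> sets borel" using K by (simp add: compact_imp_closed)
    define B where "B = fst -` K \<inter> snd -` (- H n)"
    have s1: "fst -` K \<in> sets \<gamma>" "snd -` H n \<in> sets \<gamma>" "snd -` (- H n) \<in> sets \<gamma>"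
      using measurable_sets[OF fs(1) Kb] measurable_sets[OF fs(2) H[of n]] measurable_sets[OF fs(2), of "- H n"] sp by auto
    then have B: "B \<in> sets \<gamma>" unfolding B_def by auto
    have Bg: "\<exists>\<eta>. gain m \<xi> \<zeta> + \<delta> \<le> gain m \<eta> \<zeta>" if "(\<xi>, \<zeta>) \<in> B" for \<xi> \<zeta>
    proof -
      have "(\<xi>, \<zeta>) \<notin> G n" using that unfolding B_def H_def by auto
      then show ?thesis unfolding G_def \<delta>_def by (auto simp: not_le intro: less_imp_le)
    qed
    have "ennreal u + ennreal b + ennreal \<delta> * emeasure \<gamma> B \<le> ennreal v + ennreal a + (ennreal m * transport_cost p \<gamma> + ennreal g)"
      using weak_duality_slack[OF \<mu>(1) \<gamma>(1) fin(2), of \<delta> B] Bg B \<gamma>'(1) \<delta> uv ab g by simp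
    also have "\<dots> \<le> ennreal v + ennreal a + (ennreal m * ennreal (t powr p + e') + ennreal g)"
      using \<gamma>(2) by (intro add_mono mult_left_mono) auto
    also have "\<dots> = ennreal (v + a + (m * (t powr p + e') + g))"
      using uv ab g fin(2) e' by (simp add: ennreal_plus ennreal_mult)
    also have "ennreal u + ennreal b + ennreal \<delta> * emeasure \<gamma> B = ennreal (u + b + \<delta> * measure \<gamma> B)"
      using uv ab \<delta> by (simp add: \<gamma>.emeasure_eq_measure ennreal_plus ennreal_mult)
    finally have "u + b + \<delta> * measure \<gamma> B \<le> v + a + (m * (t powr p + e') + g)"
      using uv ab g fin(2) e' by (subst (asm) ennreal_le_iff) auto
    then have "\<delta> * measure \<gamma> B \<le> m * e'" using uv(5) by (simp add: algebra_simps)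
    then have "\<delta> * measure \<gamma> B \<le> \<delta> * e" using e'(2) by linarith
    then have "measure \<gamma> B \<le> e" using \<delta> by simp
    have "emeasure \<mu> K = emeasure \<gamma> (fst -` K)"
      unfolding \<gamma>'(6)[symmetric] using fs(1) Kb sp by (simp add: emeasure_distr)
    also have "\<dots> \<le> emeasure \<gamma> (snd -` H n \<union> B)"
      using s1 B by (intro emeasure_mono) (auto simp: B_def)
    also have "\<dots> \<le> emeasure \<gamma> (snd -` H n) + emeasure \<gamma> B" using s1 B by (intro emeasure_subadditive) auto
    also have "emeasure \<gamma> (snd -` H n) = emeasure \<nu> (H n)"
      by (subst \<gamma>'(7)[symmetric]) (use fs(2) H sp in \<open>simp add: emeasure_distr\<close>)
    also have "emeasure \<gamma> B \<le> ennreal e" using \<open>measure \<gamma> B \<le> e\<close> by (simp add: \<gamma>.emeasure_eq_measure ennreal_leI)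
    finally show "emeasure \<mu> K \<le> emeasure \<nu> (H n) + ennreal e" by (simp add: add_left_mono)
  qed
  have "decseq H"
    unfolding decseq_def
  proof (intro allI impI subsetI)
    fix i j :: nat and \<zeta> assume ij: "i \<le> j" and "\<zeta> \<in> H j"
    then obtain \<xi> where \<xi>: "\<xi> \<in> K" "\<forall>\<eta>. gain m \<eta> \<zeta> \<le> gain m \<xi> \<zeta> + 1 / real (Suc j)"
      unfolding H_def G_def by auto
    have "1 / real (Suc j) \<le> 1 / real (Suc i)" using ij by (intro divide_left_mono) auto
    then have "\<forall>\<eta>. gain m \<eta> \<zeta> \<le> gain m \<xi> \<zeta> + 1 / real (Suc i)" using \<xi>(2) by (meson add_left_mono order_trans)
    then show "\<zeta> \<in> H i" unfolding H_def G_def using \<xi>(1) by auto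
  qed
  then have "(INF n. emeasure \<nu> (H n)) = emeasure \<nu> (\<Inter>n. H n)"
    by (intro INF_emeasure_decseq) auto
  moreover have "emeasure \<mu> K \<le> (INF n. emeasure \<nu> (H n))" using le by (intro INF_greatest)
  moreover have "(\<Inter>n. H n) \<subseteq> {\<zeta>. Argmin m \<zeta> \<inter> K \<noteq> {}}"
  proof
    fix \<zeta> assume "\<zeta> \<in> (\<Inter>n. H n)"
    then have ex: "\<exists>\<xi>\<in>K. \<forall>\<eta>. gain m \<eta> \<zeta> \<le> gain m \<xi> \<zeta> + 1 / Suc n" for n unfolding H_def G_def by auto
    then have "K \<noteq> {}" by blast
    then obtain x where x: "x \<in> K" "\<forall>y\<in>K. gain m y \<zeta> \<le> gain m x \<zeta>"
      using usc_attains_sup[OF usc_gain_target K] by blast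
    have "gain m \<eta> \<zeta> \<le> gain m x \<zeta>" for \<eta>
    proof (rule field_le_epsilon)
      fix e :: real assume "0 < e"
      then obtain n where n: "1 / real (Suc n) < e" using nat_approx_posE by blast
      obtain \<xi> where "\<xi> \<in> K" "gain m \<eta> \<zeta> \<le> gain m \<xi> \<zeta> + 1 / Suc n" using ex[of n] by blast
      then show "gain m \<eta> \<zeta> \<le> gain m x \<zeta> + e" using x(2) n by force
    qed
    then have "x \<in> Argmin m \<zeta>" by (simp add: argmin_iff)
    then show "\<zeta> \<in> {\<zeta>. Argmin m \<zeta> \<inter> K \<noteq> {}}" using x(1) by auto
  qed
  then have "emeasure \<nu> (\<Inter>n. H n) \<le> emeasure \<nu> {\<zeta>. Argmin m \<zeta> \<inter> K \<noteq> {}}"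
    using hit_measurableD(2)[OF hit_measurable_argmin K] by (intro emeasure_mono) auto
  ultimately show ?thesis by simp
qed

text \<open>Compact sets exhaust the mass of any Borel set.\<close>

lemma worst_case_mass:
  assumes t: "0 < t" and w: "Worst t \<mu>" and m: "m \<in> Minimizers t"
    and A: "A \<in> sets borel" and E: "E \<in> sets borel" "\<And>\<zeta>. Argmin m \<zeta> \<inter> A \<noteq> {} \<Longrightarrow> \<zeta> \<in> E"
  shows "emeasure \<mu> A \<le> emeasure \<nu> E"
proof -
  have \<mu>: "\<mu> \<in> borel_probs" using w unfolding worst_case_def primal_feasible_def by auto
  interpret \<mu>: prob_space \<mu> using \<mu> by (rule borel_probsD)
  have "emeasure \<mu> A = (SUP K \<in> {K. K \<subseteq> A \<and> compact K}. emeasure \<mu> K)"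
    by (rule inner_regular) (use borel_probsD[OF \<mu>] A in auto)
  also have "\<dots> \<le> emeasure \<nu> E"
  proof (rule SUP_least, clarify)
    fix K assume "K \<subseteq> A" "compact K"
    then have "{\<zeta>. Argmin m \<zeta> \<inter> K \<noteq> {}} \<subseteq> E" using E(2) by blast
    then have "emeasure \<nu> {\<zeta>. Argmin m \<zeta> \<inter> K \<noteq> {}} \<le> emeasure \<nu> E" using E(1) by (intro emeasure_mono) auto
    then show "emeasure \<mu> K \<le> emeasure \<nu> E"
      using worst_case_mass_compact[OF t w m \<open>compact K\<close>] by simp
  qed
  finally show ?thesis .
qed

lemma worst_case_argmin_nonempty:
  assumes "0 < t" "Worst t \<mu>" "m \<in> Minimizers t"
  shows "AE \<zeta> in \<nu>. Argmin m \<zeta> \<noteq> {}"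
proof -
  have \<mu>: "\<mu> \<in> borel_probs" using assms(2) unfolding worst_case_def primal_feasible_def by auto
  interpret \<mu>: prob_space \<mu> using \<mu> by (rule borel_probsD)
  have "1 = emeasure \<mu> UNIV" using \<mu>.emeasure_space_1 borel_probsD(3)[OF \<mu>] by simp
  also have "\<dots> \<le> emeasure \<nu> {\<zeta>. Argmin m \<zeta> \<noteq> {}}"
    by (rule worst_case_mass[OF assms]) (auto simp: argmin_nonempty_measurable)
  finally have "prob {\<zeta>. Argmin m \<zeta> \<noteq> {}} = 1"
    by (simp add: emeasure_eq_measure antisym)
  then show ?thesis using prob_eq_1[of "{\<zeta>. Argmin m \<zeta> \<noteq> {}}"] by simp
qed

text \<open>On the argmin set of \<open>\<zeta>\<close> the value \<open>\<Psi> \<xi>\<close> is an increasing function of the cost, so mass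
  domination turns into stochastic domination of the extreme values of \<open>\<Psi>\<close> over the argmin sets.\<close>

lemma argmin_value:
  assumes "\<xi> \<in> Argmin m \<zeta>"
  shows "\<Psi> \<xi> = \<Psi> \<zeta> + m * dist \<xi> \<zeta> powr p + enn2real (max_gain m \<zeta>)"
  using argmin_max_gain[OF assms] by (simp add: gain_def)

lemma integrable_max_gain:
  assumes "m \<in> Minimizers t"
  shows "integrable \<nu> (\<lambda>\<zeta>. enn2real (max_gain m \<zeta>))"
    and "(\<integral>\<zeta>. enn2real (max_gain m \<zeta>) \<partial>\<nu>) = enn2real (total_gain m)"
proof -
  note fin = dual_minimizer_finite[OF assms]
  have g: "(\<integral>\<^sup>+\<zeta>. ennreal (enn2real (max_gain m \<zeta>)) \<partial>\<nu>) = total_gain m"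
    unfolding total_gain_def
    by (intro nn_integral_cong_AE, use AE_max_gain_finite[OF fin(3)] in eventually_elim) simp
  then show "integrable \<nu> (\<lambda>\<zeta>. enn2real (max_gain m \<zeta>))" using fin(3) by (intro integrableI_nonneg) auto
  show "(\<integral>\<zeta>. enn2real (max_gain m \<zeta>) \<partial>\<nu>) = enn2real (total_gain m)"
    unfolding g[symmetric] by (rule integral_eq_nn_integral) auto
qed

lemma worst_case_D0_upper_ge:
  assumes t: "0 < t" and w: "Worst t \<mu>" and m: "m \<in> Minimizers t" and m0: "0 < m"
  shows "ennreal (t powr p) \<le> (\<integral>\<^sup>+\<zeta>. D_upper m \<zeta> \<partial>\<nu>)"
proof (cases "(\<integral>\<^sup>+\<zeta>. D_upper m \<zeta> \<partial>\<nu>) = \<infinity>")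
  case False
  have \<mu>: "\<mu> \<in> borel_probs" using w unfolding worst_case_def primal_feasible_def by auto
  obtain u v where uv: "0 \<le> u" "0 \<le> v" "(\<integral>\<^sup>+\<xi>. ennreal (\<Psi> \<xi>) \<partial>\<mu>) = ennreal u" "(\<integral>\<^sup>+\<xi>. ennreal (- \<Psi> \<xi>) \<partial>\<mu>) = ennreal v"
    "u - v = (\<integral>\<zeta>. \<Psi> \<zeta> \<partial>\<nu>) + m * t powr p + enn2real (total_gain m)" using worst_case_parts[OF t w m] .
  define U where "U \<zeta> = enn2real (D_upper m \<zeta>)" for \<zeta>
  define N where "N = {\<zeta>. D_upper m \<zeta> = \<infinity>}"
  have [measurable]: "U \<in> borel_measurable borel" "N \<in> sets borel" unfolding U_def N_def by measurable
  have AE_fin: "AE \<zeta> in \<nu>. D_upper m \<zeta> \<noteq> \<infinity>" using False by (intro nn_integral_PInf_AE) auto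
  then have N0: "emeasure \<nu> N = 0" unfolding N_def by (subst (asm) AE_iff_measurable) auto
  have UI: "(\<integral>\<^sup>+\<zeta>. ennreal (U \<zeta>) \<partial>\<nu>) = (\<integral>\<^sup>+\<zeta>. D_upper m \<zeta> \<partial>\<nu>)"
    unfolding U_def by (intro nn_integral_cong_AE, use AE_fin in eventually_elim) (simp add: less_top)
  then have Ui: "integrable \<nu> U" using False by (intro integrableI_nonneg) (auto simp: U_def less_top)
  \<comment> \<open>the largest value of \<open>\<Psi>\<close> on the argmin set of \<open>\<zeta>\<close>\<close>
  define g where "g \<zeta> = \<Psi> \<zeta> + m * U \<zeta> + enn2real (max_gain m \<zeta>)" for \<zeta>
  have [measurable]: "g \<in> borel_measurable borel" unfolding g_def by measurable
  have gi: "integrable \<nu> g" unfolding g_def using int Ui integrable_max_gain[OF m] by auto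
  have tail: "emeasure \<mu> {\<xi>\<in>space \<mu>. s \<le> \<Psi> \<xi>} \<le> emeasure \<nu> {\<zeta>\<in>space \<nu>. s \<le> g \<zeta>}" for s
  proof -
    have "emeasure \<mu> {\<xi>. s \<le> \<Psi> \<xi>} \<le> emeasure \<nu> ({\<zeta>. s \<le> g \<zeta>} \<union> N)"
    proof (rule worst_case_mass[OF t w m])
      fix \<zeta> assume "Argmin m \<zeta> \<inter> {\<xi>. s \<le> \<Psi> \<xi>} \<noteq> {}"
      then obtain \<xi> where \<xi>: "\<xi> \<in> Argmin m \<zeta>" "s \<le> \<Psi> \<xi>" by blast
      show "\<zeta> \<in> {\<zeta>. s \<le> g \<zeta>} \<union> N"
      proof (cases "D_upper m \<zeta> = \<infinity>")
        case False
        then have "ennreal (dist \<xi> \<zeta> powr p) \<le> ennreal (U \<zeta>)"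
          using D0_upper_ge[OF \<xi>(1)] unfolding U_def by (simp add: less_top)
        then have "dist \<xi> \<zeta> powr p \<le> U \<zeta>" by (simp add: U_def)
        then have "m * dist \<xi> \<zeta> powr p \<le> m * U \<zeta>" using m0 by simp
        then show ?thesis using \<xi> argmin_value[OF \<xi>(1)] unfolding g_def by auto
      qed (simp add: N_def)
    qed auto
    also have "\<dots> \<le> emeasure \<nu> {\<zeta>. s \<le> g \<zeta>} + emeasure \<nu> N" by (intro emeasure_subadditive) auto
    finally show ?thesis using N0 borel_probsD(3)[OF \<mu>] by simp
  qed
  note [measurable_cong] = borel_probsD(1)[OF \<mu>]
  note dom = stochastic_dominance_nn_integral[OF borel_probsD(2)[OF \<mu>] prob_space_axioms, of \<Psi> g, OF _ _ tail]
  have d1: "ennreal u \<le> (\<integral>\<^sup>+\<zeta>. ennreal (g \<zeta>) \<partial>\<nu>)" unfolding uv(3)[symmetric] by (rule dom(1)) auto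
  have d2: "(\<integral>\<^sup>+\<zeta>. ennreal (- g \<zeta>) \<partial>\<nu>) \<le> ennreal v" unfolding uv(4)[symmetric] by (rule dom(2)) auto
  have "u - v \<le> (\<integral>\<zeta>. g \<zeta> \<partial>\<nu>)"
  proof -
    have "(\<integral>\<^sup>+\<zeta>. ennreal (g \<zeta>) \<partial>\<nu>) < \<infinity>" using gi by (auto simp: real_integrable_def less_top)
    then have "u \<le> enn2real (\<integral>\<^sup>+\<zeta>. ennreal (g \<zeta>) \<partial>\<nu>)" using d1 uv(1) by (metis enn2real_ennreal enn2real_mono infinity_ennreal_def)
    moreover have "enn2real (\<integral>\<^sup>+\<zeta>. ennreal (- g \<zeta>) \<partial>\<nu>) \<le> v" using d2 uv(2) by (metis enn2real_leI)
    ultimately show ?thesis unfolding real_lebesgue_integral_def[OF gi] by linarith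
  qed
  also have "(\<integral>\<zeta>. g \<zeta> \<partial>\<nu>) = (\<integral>\<zeta>. \<Psi> \<zeta> \<partial>\<nu>) + m * (\<integral>\<zeta>. U \<zeta> \<partial>\<nu>) + enn2real (total_gain m)"
    unfolding g_def using int Ui integrable_max_gain[OF m] by simp
  finally have "m * t powr p \<le> m * (\<integral>\<zeta>. U \<zeta> \<partial>\<nu>)" using uv(5) by simp
  then have "t powr p \<le> (\<integral>\<zeta>. U \<zeta> \<partial>\<nu>)" using m0 by simp
  also have "ennreal (\<integral>\<zeta>. U \<zeta> \<partial>\<nu>) = (\<integral>\<^sup>+\<zeta>. D_upper m \<zeta> \<partial>\<nu>)"
    unfolding UI[symmetric] by (rule nn_integral_eq_integral[OF Ui, symmetric]) (simp add: U_def)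
  finally show ?thesis by (simp add: ennreal_leI)
qed simp

lemma worst_case_D0_lower_le:
  assumes t: "0 < t" and w: "Worst t \<mu>" and m: "m \<in> Minimizers t" and m0: "0 < m"
  shows "(\<integral>\<^sup>+\<zeta>. D_lower m \<zeta> \<partial>\<nu>) \<le> ennreal (t powr p)"
proof -
  have \<mu>: "\<mu> \<in> borel_probs" using w unfolding worst_case_def primal_feasible_def by auto
  obtain u v where uv: "0 \<le> u" "0 \<le> v" "(\<integral>\<^sup>+\<xi>. ennreal (\<Psi> \<xi>) \<partial>\<mu>) = ennreal u" "(\<integral>\<^sup>+\<xi>. ennreal (- \<Psi> \<xi>) \<partial>\<mu>) = ennreal v"
    "u - v = (\<integral>\<zeta>. \<Psi> \<zeta> \<partial>\<nu>) + m * t powr p + enn2real (total_gain m)" using worst_case_parts[OF t w m] .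
  define U where "U \<zeta> = enn2real (D_lower m \<zeta>)" for \<zeta>
  have [measurable]: "U \<in> borel_measurable borel" unfolding U_def by measurable
  have UI: "(\<integral>\<^sup>+\<zeta>. ennreal (U \<zeta>) \<partial>\<nu>) = (\<integral>\<^sup>+\<zeta>. D_lower m \<zeta> \<partial>\<nu>)"
  proof (intro nn_integral_cong_AE, use worst_case_argmin_nonempty[OF t w m] in eventually_elim)
    case (elim \<zeta>)
    then obtain \<xi> where "D_lower m \<zeta> = ennreal (dist \<xi> \<zeta> powr p)" using D0_lower_attained by blast
    then show ?case by (simp add: U_def)
  qed
  \<comment> \<open>the smallest value of \<open>\<Psi>\<close> on the argmin set of \<open>\<zeta>\<close>\<close>
  define g where "g \<zeta> = \<Psi> \<zeta> + m * U \<zeta> + enn2real (max_gain m \<zeta>)" for \<zeta>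
  have [measurable]: "g \<in> borel_measurable borel" unfolding g_def by measurable
  have tail: "emeasure \<mu> {\<xi>\<in>space \<mu>. s \<le> - \<Psi> \<xi>} \<le> emeasure \<nu> {\<zeta>\<in>space \<nu>. s \<le> - g \<zeta>}" for s
  proof -
    have "emeasure \<mu> {\<xi>. s \<le> - \<Psi> \<xi>} \<le> emeasure \<nu> {\<zeta>. s \<le> - g \<zeta>}"
    proof (rule worst_case_mass[OF t w m])
      fix \<zeta> assume "Argmin m \<zeta> \<inter> {\<xi>. s \<le> - \<Psi> \<xi>} \<noteq> {}"
      then obtain \<xi> where \<xi>: "\<xi> \<in> Argmin m \<zeta>" "s \<le> - \<Psi> \<xi>" by blast
      have "enn2real (D_lower m \<zeta>) \<le> dist \<xi> \<zeta> powr p"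
        using D0_lower_le[OF \<xi>(1)] by (intro enn2real_leI) auto
      then have "m * U \<zeta> \<le> m * dist \<xi> \<zeta> powr p" using m0 unfolding U_def by simp
      then show "\<zeta> \<in> {\<zeta>. s \<le> - g \<zeta>}" using \<xi> argmin_value[OF \<xi>(1)] unfolding g_def by auto
    qed auto
    then show ?thesis using borel_probsD(3)[OF \<mu>] by simp
  qed
  note [measurable_cong] = borel_probsD(1)[OF \<mu>]
  note dom = stochastic_dominance_nn_integral[OF borel_probsD(2)[OF \<mu>] prob_space_axioms, of "\<lambda>\<xi>. - \<Psi> \<xi>" "\<lambda>\<zeta>. - g \<zeta>", OF _ _ tail]
  have d1: "ennreal v \<le> (\<integral>\<^sup>+\<zeta>. ennreal (- g \<zeta>) \<partial>\<nu>)" unfolding uv(4)[symmetric] by (rule dom(1)) auto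
  have "(\<integral>\<^sup>+\<zeta>. ennreal (- (- g \<zeta>)) \<partial>\<nu>) \<le> (\<integral>\<^sup>+\<xi>. ennreal (- (- \<Psi> \<xi>)) \<partial>\<mu>)" by (rule dom(2)) auto
  then have d2: "(\<integral>\<^sup>+\<zeta>. ennreal (g \<zeta>) \<partial>\<nu>) \<le> ennreal u" using uv(3) by simp
  have "(\<integral>\<^sup>+\<zeta>. ennreal (- g \<zeta>) \<partial>\<nu>) \<le> (\<integral>\<^sup>+\<zeta>. ennreal (- \<Psi> \<zeta>) \<partial>\<nu>)"
  proof (intro nn_integral_mono ennreal_leI)
    fix \<zeta>
    have "0 \<le> m * U \<zeta>" using m0 by (simp add: U_def)
    moreover have "0 \<le> enn2real (max_gain m \<zeta>)" by (rule enn2real_nonneg)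
    ultimately show "- g \<zeta> \<le> - \<Psi> \<zeta>" unfolding g_def by linarith
  qed
  also have "\<dots> < \<infinity>" using int by (auto simp: real_integrable_def less_top)
  finally have f2: "(\<integral>\<^sup>+\<zeta>. ennreal (- g \<zeta>) \<partial>\<nu>) < \<infinity>" .
  have "(\<integral>\<^sup>+\<zeta>. ennreal (g \<zeta>) \<partial>\<nu>) < \<infinity>" using d2 by (auto intro: le_less_trans)
  then have gi: "integrable \<nu> g" using f2 by (auto simp: real_integrable_def)
  have "integrable \<nu> (\<lambda>\<zeta>. (g \<zeta> - \<Psi> \<zeta> - enn2real (max_gain m \<zeta>)) / m)"
    using gi int integrable_max_gain[OF m] by auto
  moreover have "(\<lambda>\<zeta>. (g \<zeta> - \<Psi> \<zeta> - enn2real (max_gain m \<zeta>)) / m) = U" unfolding g_def using m0 by auto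
  ultimately have Ui: "integrable \<nu> U" by simp
  have "(\<integral>\<zeta>. g \<zeta> \<partial>\<nu>) \<le> u - v"
  proof -
    have "v \<le> enn2real (\<integral>\<^sup>+\<zeta>. ennreal (- g \<zeta>) \<partial>\<nu>)" using d1 uv(2) f2 by (metis enn2real_ennreal enn2real_mono infinity_ennreal_def)
    moreover have "enn2real (\<integral>\<^sup>+\<zeta>. ennreal (g \<zeta>) \<partial>\<nu>) \<le> u" using d2 uv(1) by (metis enn2real_leI)
    ultimately show ?thesis unfolding real_lebesgue_integral_def[OF gi] by linarith
  qed
  moreover have "(\<integral>\<zeta>. g \<zeta> \<partial>\<nu>) = (\<integral>\<zeta>. \<Psi> \<zeta> \<partial>\<nu>) + m * (\<integral>\<zeta>. U \<zeta> \<partial>\<nu>) + enn2real (total_gain m)"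
    unfolding g_def using int Ui integrable_max_gain[OF m] by simp
  ultimately have "m * (\<integral>\<zeta>. U \<zeta> \<partial>\<nu>) \<le> m * t powr p" using uv(5) by simp
  then have "(\<integral>\<zeta>. U \<zeta> \<partial>\<nu>) \<le> t powr p" using m0 by simp
  moreover have "ennreal (\<integral>\<zeta>. U \<zeta> \<partial>\<nu>) = (\<integral>\<^sup>+\<zeta>. D_lower m \<zeta> \<partial>\<nu>)"
    unfolding UI[symmetric] by (rule nn_integral_eq_integral[OF Ui, symmetric]) (simp add: U_def)
  ultimately show ?thesis using ennreal_leI by metis
qed

lemma argmin_set_0: "Argmin 0 \<zeta> = {\<xi>. \<forall>\<xi>'. \<Psi> \<xi>' \<le> \<Psi> \<xi>}"
  by (auto simp: argmin_iff gain_def)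

text \<open>At price \<open>0\<close> every argmin set is the set of maximizers of \<open>\<Psi>\<close>. It carries all mass of a worst case, so
  the nearest maximizer bounds the cost of every coupling from below.\<close>

lemma worst_case_0:
  assumes t: "0 < t" and w: "Worst t \<mu>" and m: "0 \<in> Minimizers t"
  shows "{\<xi>. \<forall>\<xi>'. \<Psi> \<xi>' \<le> \<Psi> \<xi>} \<noteq> {}" "(\<integral>\<^sup>+\<zeta>. D_lower 0 \<zeta> \<partial>\<nu>) \<le> ennreal (t powr p)"
proof -
  let ?M = "{\<xi>. \<forall>\<xi>'. \<Psi> \<xi>' \<le> \<Psi> \<xi>}"
  have \<mu>: "\<mu> \<in> borel_probs" "Wpp p \<mu> \<nu> \<le> ennreal (t powr p)"
    using w primal_feasible_iff[OF t] unfolding worst_case_def by auto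
  have "AE \<zeta> in \<nu>. ?M \<noteq> {}" using worst_case_argmin_nonempty[OF t w m] unfolding argmin_set_0 .
  then show "?M \<noteq> {}" by simp
  have cM: "closed ?M" using argmin_closed[of 0 undefined] unfolding argmin_set_0 .
  have "emeasure \<mu> (- ?M) \<le> emeasure \<nu> {}"
    by (rule worst_case_mass[OF t w m]) (use cM in \<open>auto simp: argmin_set_0\<close>)
  then have \<mu>0: "emeasure \<mu> (- ?M) = 0" by simp
  have "(\<integral>\<^sup>+\<zeta>. D_lower 0 \<zeta> \<partial>\<nu>) \<le> Wpp p \<mu> \<nu>"
    unfolding Wpp_def
  proof (rule INF_greatest)
    fix \<gamma> assume "\<gamma> \<in> couplings \<mu> \<nu>"
    note \<gamma>' = couplingsD[OF this]
    have "AE \<xi> in \<mu>. \<xi> \<in> ?M"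
      by (rule AE_I[OF _ \<mu>0]) (use cM borel_probsD[OF \<mu>(1)] in auto)
    then have "AE x in \<gamma>. fst x \<in> ?M"
      unfolding \<gamma>'(6)[symmetric] using cM \<gamma>'(4) by (subst (asm) AE_distr_iff) auto
    then have "(\<integral>\<^sup>+x. D_lower 0 (snd x) \<partial>\<gamma>) \<le> (\<integral>\<^sup>+x. ennreal (dist (fst x) (snd x) powr p) \<partial>\<gamma>)"
      by (intro nn_integral_mono_AE, eventually_elim) (rule D0_lower_le, simp add: argmin_set_0)
    then show "(\<integral>\<^sup>+\<zeta>. D_lower 0 \<zeta> \<partial>\<nu>) \<le> transport_cost p \<gamma>"
      unfolding transport_cost_def case_prod_beta' by (subst \<gamma>'(9)) auto
  qed
  then show "(\<integral>\<^sup>+\<zeta>. D_lower 0 \<zeta> \<partial>\<nu>) \<le> ennreal (t powr p)" using \<mu>(2) by (rule order_trans)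
qed

section \<open>Existence and structure of worst cases\<close>

lemma complementary_pair_positive_growth_rate:
  assumes "\<kappa> \<in> Minimizers t" "AE \<zeta> in \<nu>. Argmin \<kappa> \<zeta> \<noteq> {}"
    "(\<integral>\<^sup>+\<zeta>. D_lower \<kappa> \<zeta> \<partial>\<nu>) \<le> ennreal (t powr p)" "ennreal (t powr p) \<le> (\<integral>\<^sup>+\<zeta>. D_upper \<kappa> \<zeta> \<partial>\<nu>)"
  shows "\<exists>q T\<^sub>1 T\<^sub>2. complementary_pair t \<kappa> q T\<^sub>1 T\<^sub>2"
  using mixed_argmin_selection[OF assms(2) _ assms(3,4)] assms(1) unfolding complementary_pair_def by fastforce

lemma complementary_pair_zero_growth_rate:
  assumes m: "0 \<in> Minimizers t" and ne: "{\<xi>. \<forall>\<xi>'. \<Psi> \<xi>' \<le> \<Psi> \<xi>} \<noteq> {}"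
    and le: "(\<integral>\<^sup>+\<zeta>. D_lower 0 \<zeta> \<partial>\<nu>) \<le> ennreal (t powr p)"
  shows "\<exists>q T\<^sub>1 T\<^sub>2. complementary_pair t 0 q T\<^sub>1 T\<^sub>2"
proof -
  obtain N where N: "N \<in> borel \<rightarrow>\<^sub>M borel" "\<And>\<zeta>. N \<zeta> \<in> Argmin 0 \<zeta> \<and> D_lower 0 \<zeta> = ennreal (dist (N \<zeta>) \<zeta> powr p)"
    using nearest_argmin_selection[of 0] ne unfolding argmin_set_0 by blast
  have "map_cost N = (\<integral>\<^sup>+\<zeta>. D_lower 0 \<zeta> \<partial>\<nu>)" unfolding map_cost_def using N(2) by simp
  then have le': "map_cost N \<le> ennreal (t powr p)" using le by simp
  then obtain c where "map_cost N = ennreal c" "0 \<le> c" "c \<le> t powr p"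
    by (cases "map_cost N") (auto simp: top_unique)
  then have "complementary_pair t 0 1 N N" unfolding complementary_pair_def using m N by simp
  then show ?thesis by blast
qed

lemma worst_case_iff:
  assumes t: "0 < t"
  shows "(\<exists>\<mu>. Worst t \<mu>) \<longleftrightarrow>
        (\<exists>l\<in>Minimizers t. l > \<kappa>)
      \<or> (\<kappa> > 0 \<and> Minimizers t = {\<kappa>} \<and>
         (AE \<zeta> in \<nu>. Argmin \<kappa> \<zeta> \<noteq> {}) \<and>
         (\<integral>\<^sup>+\<zeta>. D_lower \<kappa> \<zeta> \<partial>\<nu>) \<le> ennreal (t powr p) \<and>
         ennreal (t powr p) \<le> (\<integral>\<^sup>+\<zeta>. D_upper \<kappa> \<zeta> \<partial>\<nu>))
      \<or> (\<kappa> = 0 \<and> Minimizers t = {\<kappa>} \<and>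
         {\<xi>. \<forall>\<xi>'. \<Psi> \<xi>' \<le> \<Psi> \<xi>} \<noteq> {} \<and>
         (\<integral>\<^sup>+\<zeta>. D_lower 0 \<zeta> \<partial>\<nu>) \<le> ennreal (t powr p))" (is "?W \<longleftrightarrow> ?C")
    and "(\<exists>\<mu>. Worst t \<mu>) \<Longrightarrow> \<exists>l q T\<^sub>1 T\<^sub>2. complementary_pair t l q T\<^sub>1 T\<^sub>2"
proof -
  have 1: "?C" if W: "?W"
  proof -
    obtain \<mu> where w: "Worst t \<mu>" using W by blast
    show ?C
    proof (cases "\<exists>l\<in>Minimizers t. l > \<kappa>")
      case False
      then have dm: "Minimizers t = {\<kappa>}"
        using dual_minimizer_exists[OF t] dual_minimizer_finite(1) by force
      then have m: "\<kappa> \<in> Minimizers t" by simp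
      show ?thesis
      proof (cases "\<kappa> = 0")
        case True
        then show ?thesis using worst_case_0[OF t w] dm by simp
      next
        case False
        then have "0 < \<kappa>" using \<kappa>_nonneg by simp
        then show ?thesis
          using worst_case_argmin_nonempty[OF t w m] worst_case_D0_lower_le[OF t w m] worst_case_D0_upper_ge[OF t w m] dm by blast
      qed
    qed blast
  qed
  have 2: "\<exists>l q T\<^sub>1 T\<^sub>2. complementary_pair t l q T\<^sub>1 T\<^sub>2" if ?C
    using that
  proof (elim disjE bexE conjE)
    fix l assume "l \<in> Minimizers t" "\<kappa> < l"
    then show ?thesis using complementary_pair_above_growth_rate by blast
  next
    assume "Minimizers t = {\<kappa>}" "AE \<zeta> in \<nu>. Argmin \<kappa> \<zeta> \<noteq> {}"
      "(\<integral>\<^sup>+\<zeta>. D_lower \<kappa> \<zeta> \<partial>\<nu>) \<le> ennreal (t powr p)" "ennreal (t powr p) \<le> (\<integral>\<^sup>+\<zeta>. D_upper \<kappa> \<zeta> \<partial>\<nu>)"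
    then show ?thesis using complementary_pair_positive_growth_rate[of t] by blast
  next
    assume "Minimizers t = {\<kappa>}" "\<kappa> = 0" "{\<xi>. \<forall>\<xi>'. \<Psi> \<xi>' \<le> \<Psi> \<xi>} \<noteq> {}"
      "(\<integral>\<^sup>+\<zeta>. D_lower 0 \<zeta> \<partial>\<nu>) \<le> ennreal (t powr p)"
    then show ?thesis using complementary_pair_zero_growth_rate[of t] by blast
  qed
  show "?W \<longleftrightarrow> ?C" using 1 2 complementary_pair_worst_case(1)[OF _ t] by blast
  show "\<exists>l q T\<^sub>1 T\<^sub>2. complementary_pair t l q T\<^sub>1 T\<^sub>2" if "\<exists>\<mu>. Worst t \<mu>" using 1 2 that by blast
qed

lemma worst_case_structure:
  assumes t: "0 < t" and W: "\<exists>\<mu>. Worst t \<mu>"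
  shows "\<exists>l\<in>Minimizers t. \<exists>q\<in>{0..1}. \<exists>T\<^sub>1 T\<^sub>2.
         nu_measurable \<nu> T\<^sub>1 \<and> nu_measurable \<nu> T\<^sub>2 \<and>
         (AE \<zeta> in \<nu>. T\<^sub>1 \<zeta> \<in> Argmin l \<zeta> \<and> T\<^sub>2 \<zeta> \<in> Argmin l \<zeta>) \<and>
         (let \<mu> = mixture q (push \<nu> T\<^sub>1) (push \<nu> T\<^sub>2);
              \<gamma> = mixture q (push \<nu> (\<lambda>\<zeta>. (\<zeta>, T\<^sub>1 \<zeta>))) (push \<nu> (\<lambda>\<zeta>. (\<zeta>, T\<^sub>2 \<zeta>)))
          in Worst t \<mu> \<and>
             (l > 0 \<longrightarrow> \<gamma> \<in> couplings \<nu> \<mu> \<and> transport_cost p \<gamma> = Wpp p \<mu> \<nu>))"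
proof -
  obtain l q T\<^sub>1 T\<^sub>2 where S: "complementary_pair t l q T\<^sub>1 T\<^sub>2" using worst_case_iff(2)[OF t W] by blast
  then have "l \<in> Minimizers t" "q \<in> {0..1}" "nu_measurable \<nu> T\<^sub>1" "nu_measurable \<nu> T\<^sub>2"
    "AE \<zeta> in \<nu>. T\<^sub>1 \<zeta> \<in> Argmin l \<zeta> \<and> T\<^sub>2 \<zeta> \<in> Argmin l \<zeta>"
    using nu_measurable_borel[OF \<nu>] unfolding complementary_pair_def by auto
  then show ?thesis unfolding Let_def using complementary_pair_worst_case(1,3)[OF S t] by blast
qed

section \<open>Dual minimizers for small radii\<close>

lemma total_gain_eq_0_iff:
  "total_gain \<kappa> = 0 \<longleftrightarrow> (AE \<zeta> in \<nu>. \<not> ereal (- \<Psi> \<zeta>) > Phi p \<Psi> \<kappa> \<zeta>)"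
proof -
  have "\<not> ereal (- \<Psi> \<zeta>) > Phi p \<Psi> \<kappa> \<zeta> \<longleftrightarrow> max_gain \<kappa> \<zeta> = 0" for \<zeta>
    unfolding Phi_eq by (cases "max_gain \<kappa> \<zeta>") (auto simp: enn2ereal_ennreal zero_ennreal.rep_eq)
  then show ?thesis unfolding total_gain_def by (subst nn_integral_0_iff_AE) auto
qed

text \<open>Without gain at the growth rate there is none at higher prices, and only the budget term remains.\<close>

lemma dual_minimizers_no_gain:
  assumes 0: "total_gain \<kappa> = 0" and t: "0 < t"
  shows "Minimizers t = {\<kappa>}"
proof -
  have ex: "dual_excess t l = ennreal (l * t powr p)" if "\<kappa> \<le> l" for l
    unfolding dual_excess_def using total_gain_antimono[OF that] 0 by simp
  have "l = \<kappa>" if l: "l \<in> Minimizers t" for l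
  proof -
    note fin = dual_minimizer_finite[OF l]
    have "dual_excess t l \<le> dual_excess t \<kappa>" using l \<kappa>_nonneg unfolding dual_minimizers_eq by auto
    then have "l * t powr p \<le> \<kappa> * t powr p" using \<kappa>_nonneg fin by (simp add: ex)
    then show ?thesis using t fin by simp
  qed
  then show ?thesis using dual_minimizer_exists[OF t] by blast
qed

text \<open>The total gain tends to \<open>0\<close> as the price grows, so some price \<open>l\<close> has strictly smaller total gain than \<open>\<kappa>\<close>.
  When the radius is small, the budget term at \<open>l\<close> does not make up for the difference.\<close>

lemma dual_minimizers_small_budget:
  assumes "total_gain \<kappa> \<noteq> 0"
  shows "\<exists>t\<^sub>0>0. \<forall>t. 0 < t \<and> t < t\<^sub>0 \<longrightarrow>
    Minimizers t \<noteq> {} \<and> (\<forall>l\<in>Minimizers t. l > \<kappa>)"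
proof -
  define k where "k = \<kappa> + 1"
  have k: "0 \<le> k" "\<kappa> < k" unfolding k_def using \<kappa>_nonneg by auto
  have "(INF n::nat. total_gain (k + n)) = (\<integral>\<^sup>+\<zeta>. (INF n::nat. max_gain (k + n) \<zeta>) \<partial>\<nu>)"
    unfolding total_gain_def
  proof (rule nn_integral_monotone_convergence_INF_decseq[symmetric, where i = 0])
    show "decseq (\<lambda>n. max_gain (k + real n))"
      by (rule antimonoI, rule le_funI) (auto intro!: max_gain_antimono)
    show "(\<integral>\<^sup>+\<zeta>. max_gain (k + real 0) \<zeta> \<partial>\<nu>) < \<infinity>" using total_gain_finite[OF k(2)] unfolding total_gain_def by simp
  qed simp
  also have "\<dots> = (\<integral>\<^sup>+\<zeta>. 0 \<partial>\<nu>)"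
  proof (rule nn_integral_cong_AE, use AE_max_gain_finite_above in eventually_elim)
    case (elim \<zeta>)
    then show ?case using max_gain_tendsto_0[of k \<zeta>] k by simp
  qed
  finally have "(INF n::nat. total_gain (k + n)) < total_gain \<kappa>" using assms by (simp add: zero_less_iff_neq_zero)
  then obtain n :: nat where n: "total_gain (k + n) < total_gain \<kappa>" by (auto simp: INF_less_iff)
  define l where "l = k + n"
  have l: "0 \<le> l" "total_gain l < total_gain \<kappa>" unfolding l_def using k n by auto
  obtain g where g: "total_gain l = ennreal g" "0 \<le> g" using l(2) by (cases "total_gain l") (auto simp: top_unique)
  obtain r where r: "0 < r" "ennreal (g + r) \<le> total_gain \<kappa>"
  proof (cases "total_gain \<kappa>")
    case (real h)
    then have "g < h" using l(2) g by (simp add: ennreal_less_iff)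
    then show ?thesis using that[of "h - g"] real by simp
  next
    case top then show ?thesis using that[of 1] by simp
  qed
  \<comment> \<open>below this radius the budget term at \<open>l\<close> is smaller than \<open>r\<close>\<close>
  define t0 where "t0 = (r / (l + 1)) powr (1 / p)"
  have t0: "0 < t0" unfolding t0_def using r l by simp
  have "Minimizers t \<noteq> {} \<and> (\<forall>l\<in>Minimizers t. l > \<kappa>)" if t: "0 < t" "t < t0" for t
  proof (intro conjI ballI)
    show "Minimizers t \<noteq> {}" by (rule dual_minimizer_exists[OF t(1)])
    fix m assume m: "m \<in> Minimizers t"
    show "\<kappa> < m"
    proof (rule ccontr)
      assume "\<not> \<kappa> < m"
      then have mk: "m = \<kappa>" using dual_minimizer_finite(1)[OF m] by simp
      have "t powr p \<le> t0 powr p" using t p by (intro powr_mono2) auto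
      also have "\<dots> = r / (l + 1)" unfolding t0_def using p r l by (simp add: powr_powr)
      finally have "l * t powr p \<le> l * (r / (l + 1))" using l by (intro mult_left_mono) auto
      also have "\<dots> < r" using r l by (simp add: field_simps)
      finally have lt: "l * t powr p < r" .
      have "ennreal (g + r) \<le> total_gain \<kappa>" by (rule r)
      also have "\<dots> \<le> dual_excess t \<kappa>" unfolding dual_excess_def by simp
      also have "\<dots> \<le> dual_excess t l" using m mk l unfolding dual_minimizers_eq by auto
      also have "\<dots> = ennreal (l * t powr p + g)" unfolding dual_excess_def using g l by (simp add: ennreal_plus)
      finally have "g + r \<le> l * t powr p + g" using g l by (subst (asm) ennreal_le_iff) auto
      then show False using lt by simp
    qed
  qed
  then show ?thesis using t0 by blast
qed

end

section \<open>Convex spaces\<close>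

text \<open>The vector operations are continuous for \<open>X\<close> and the embedding has a continuous inverse on its
  convex range, so combining points is continuous for the metric.\<close>

lemma convex_combination_map:
  fixes X :: "'v::real_vector topology" and e :: "'a::topological_space \<Rightarrow> 'v"
  assumes X: "tvs_topology X" and e: "embedding_map euclidean X e" and C: "convex (range e)" and q: "q \<in> {0..1}"
  shows "continuous_on UNIV (\<lambda>z. inv e (q *\<^sub>R e (fst z) + (1 - q) *\<^sub>R e (snd z)))"
    and "inj e" "q *\<^sub>R e x + (1 - q) *\<^sub>R e y \<in> range e"
proof -
  have hom: "homeomorphic_map euclidean (subtopology X (range e)) e"
    using e unfolding embedding_map_def by simp
  then obtain g where g: "homeomorphic_maps euclidean (subtopology X (range e)) e g"
    unfolding homeomorphic_map_maps by blast
  then have ge: "g (e x) = x" for x unfolding homeomorphic_maps_def by simp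
  show inj: "inj e" by (rule inj_on_inverseI[of _ g]) (rule ge)
  have inv: "inv e v = g v" if "v \<in> range e" for v using that ge inv_f_f[OF inj] by auto
  show r: "q *\<^sub>R e x + (1 - q) *\<^sub>R e y \<in> range e" for x y
    using C q unfolding convex_def by auto
  have ec: "continuous_map euclidean X e" and gc: "continuous_map (subtopology X (range e)) euclidean g"
    using g unfolding homeomorphic_maps_def continuous_map_in_subtopology by auto
  have add: "continuous_map (prod_topology X X) X (\<lambda>(x, y). x + y)"
    and scale: "continuous_map (prod_topology euclideanreal X) X (\<lambda>(c, x). c *\<^sub>R x)"
    using X unfolding tvs_topology_def by auto
  have s: "continuous_map Z X (\<lambda>z. c *\<^sub>R f z)" if "continuous_map Z X f" for Z :: "('a \<times> 'a) topology" and c f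
  proof -
    have "continuous_map Z (prod_topology euclideanreal X) (\<lambda>z. (c, f z))"
      using that by (intro continuous_map_pairedI) auto
    from continuous_map_compose[OF this scale] show ?thesis by (simp add: o_def)
  qed
  let ?Z = "prod_topology euclidean euclidean :: ('a \<times> 'a) topology"
  have "continuous_map ?Z X (e \<circ> fst)" "continuous_map ?Z X (e \<circ> snd)"
    by (rule continuous_map_compose[OF continuous_map_fst ec] continuous_map_compose[OF continuous_map_snd ec])+
  then have "continuous_map ?Z X (\<lambda>z. e (fst z))" "continuous_map ?Z X (\<lambda>z. e (snd z))"
    by (simp_all only: o_def)
  then have "continuous_map ?Z (prod_topology X X) (\<lambda>z. (q *\<^sub>R e (fst z), (1 - q) *\<^sub>R e (snd z)))"
    by (intro continuous_map_pairedI s)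
  from continuous_map_compose[OF this add]
  have "continuous_map ?Z X (\<lambda>z. q *\<^sub>R e (fst z) + (1 - q) *\<^sub>R e (snd z))" by (simp add: o_def)
  then have "continuous_map ?Z (subtopology X (range e)) (\<lambda>z. q *\<^sub>R e (fst z) + (1 - q) *\<^sub>R e (snd z))"
    using r by (intro continuous_map_into_subtopology) auto
  from continuous_map_compose[OF this gc]
  have "continuous_on UNIV (\<lambda>z. g (q *\<^sub>R e (fst z) + (1 - q) *\<^sub>R e (snd z)))" by (simp add: o_def)
  then show "continuous_on UNIV (\<lambda>z. inv e (q *\<^sub>R e (fst z) + (1 - q) *\<^sub>R e (snd z)))"
    using r inv by simp
qed

lemma mixture_self:
  assumes "q \<in> {0..1}" shows "mixture q M M = M"
proof (rule measure_eqI)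
  fix A assume "A \<in> sets (mixture q M M)"
  then show "emeasure (mixture q M M) A = emeasure M A"
    using assms by (simp add: emeasure_mixture distrib_right[symmetric] ennreal_plus[symmetric] del: ennreal_plus)
qed simp

context transport_problem begin

lemma push_feasible:
  assumes t: "0 < t" and T: "T \<in> borel \<rightarrow>\<^sub>M borel" and C: "map_cost T \<le> ennreal (t powr p)"
  shows "push \<nu> T \<in> primal_feasible p \<nu> t"
proof -
  have q: "(1::real) \<in> {0..1}" by simp
  note mp = mixture_push_coupling[OF \<nu> T T q, unfolded mixture_self[OF q]]
  have "Wpp p (push \<nu> T) \<nu> \<le> map_cost T"
    using mp(4)[of p] unfolding mp(3) map_cost_def[symmetric] by simp
  then show ?thesis using mp(1) C primal_feasible_iff[OF t] by (auto intro: order_trans)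
qed

lemma ereal_integral_push:
  assumes T [measurable]: "T \<in> borel \<rightarrow>\<^sub>M borel"
  shows "ereal_integral (push \<nu> T) (\<lambda>\<xi>. ereal (\<Psi> \<xi>)) = ereal_integral \<nu> (\<lambda>\<zeta>. ereal (\<Psi> (T \<zeta>)))"
  unfolding ereal_integral_def push_borel[OF \<nu> T] by (simp add: nn_integral_distr)

text \<open>Concavity of \<open>\<Psi>\<close> and convexity of the cost make the pointwise combination of two maps no worse than the mixture
  of their images. For the same reason the argmin sets are convex.\<close>

lemma combined_map:
  fixes X :: "'v::real_vector topology" and e :: "'a \<Rightarrow> 'v"
  assumes X: "tvs_topology X" and e: "embedding_map euclidean X e" and C: "convex (range e)"
    and conc: "concave_on (range e) (\<lambda>v. \<Psi> (inv e v))"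
    and conv: "AE \<zeta> in \<nu>. convex_on (range e) (\<lambda>v. dist (inv e v) \<zeta> powr p)"
    and t: "0 < t" and q: "q \<in> {0..1}" and T: "T\<^sub>1 \<in> borel \<rightarrow>\<^sub>M borel" "T\<^sub>2 \<in> borel \<rightarrow>\<^sub>M borel"
    and c: "map_cost T\<^sub>1 < \<infinity>" "map_cost T\<^sub>2 < \<infinity>"
    and le: "q * enn2real (map_cost T\<^sub>1) + (1 - q) * enn2real (map_cost T\<^sub>2) \<le> t powr p"
    and i: "integrable \<nu> (\<lambda>\<zeta>. \<Psi> (T\<^sub>1 \<zeta>))" "integrable \<nu> (\<lambda>\<zeta>. \<Psi> (T\<^sub>2 \<zeta>))"
  shows "\<exists>T\<in>borel \<rightarrow>\<^sub>M borel. push \<nu> T \<in> primal_feasible p \<nu> t \<and>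
    ereal (q * (\<integral>\<zeta>. \<Psi> (T\<^sub>1 \<zeta>) \<partial>\<nu>) + (1 - q) * (\<integral>\<zeta>. \<Psi> (T\<^sub>2 \<zeta>) \<partial>\<nu>)) \<le> ereal_integral (push \<nu> T) (\<lambda>\<xi>. ereal (\<Psi> \<xi>)) \<and>
    (\<forall>l\<ge>0. (AE \<zeta> in \<nu>. T\<^sub>1 \<zeta> \<in> Argmin l \<zeta> \<and> T\<^sub>2 \<zeta> \<in> Argmin l \<zeta>) \<longrightarrow>
        (AE \<zeta> in \<nu>. T \<zeta> \<in> Argmin l \<zeta>))"
proof -
  note cc = convex_combination_map[OF X e C q]
  define T where "T \<zeta> = inv e (q *\<^sub>R e (T\<^sub>1 \<zeta>) + (1 - q) *\<^sub>R e (T\<^sub>2 \<zeta>))" for \<zeta>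
  have Tb [measurable]: "T \<in> borel \<rightarrow>\<^sub>M borel"
    using borel_measurable_continuous_on[OF cc(1) borel_measurable_Pair[OF T]] unfolding T_def by simp
  have inve: "inv e (e x) = x" for x using cc(2) by simp
  have \<Psi>T: "q * \<Psi> (T\<^sub>1 \<zeta>) + (1 - q) * \<Psi> (T\<^sub>2 \<zeta>) \<le> \<Psi> (T \<zeta>)" for \<zeta>
    using concave_onD[OF conc, of "1 - q" "e (T\<^sub>1 \<zeta>)" "e (T\<^sub>2 \<zeta>)"] q unfolding T_def by (simp add: inve)
  have dT: "AE \<zeta> in \<nu>. dist (T \<zeta>) \<zeta> powr p \<le> q * dist (T\<^sub>1 \<zeta>) \<zeta> powr p + (1 - q) * dist (T\<^sub>2 \<zeta>) \<zeta> powr p"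
    using conv
  proof eventually_elim
    case (elim \<zeta>)
    then show ?case
      using convex_onD[OF elim, of "1 - q" "e (T\<^sub>1 \<zeta>)" "e (T\<^sub>2 \<zeta>)"] q unfolding T_def by (simp add: inve)
  qed
  note [measurable] = T
  have "map_cost T \<le> (\<integral>\<^sup>+\<zeta>. ennreal q * ennreal (dist (T\<^sub>1 \<zeta>) \<zeta> powr p) + ennreal (1 - q) * ennreal (dist (T\<^sub>2 \<zeta>) \<zeta> powr p) \<partial>\<nu>)"
    unfolding map_cost_def
    by (rule nn_integral_mono_AE, use dT in eventually_elim)
      (use q in \<open>auto simp: ennreal_plus[symmetric] ennreal_mult[symmetric] intro!: ennreal_leI simp del: ennreal_plus\<close>)
  also have "\<dots> = ennreal q * map_cost T\<^sub>1 + ennreal (1 - q) * map_cost T\<^sub>2"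
    unfolding map_cost_def by (simp add: nn_integral_add nn_integral_cmult)
  also have "\<dots> = ennreal (q * enn2real (map_cost T\<^sub>1) + (1 - q) * enn2real (map_cost T\<^sub>2))"
    using c q by (cases "map_cost T\<^sub>1"; cases "map_cost T\<^sub>2") (auto simp: ennreal_plus ennreal_mult)
  also have "\<dots> \<le> ennreal (t powr p)" by (rule ennreal_leI[OF le])
  finally have feas: "push \<nu> T \<in> primal_feasible p \<nu> t" by (rule push_feasible[OF t Tb])
  define w where "w \<zeta> = q * \<Psi> (T\<^sub>1 \<zeta>) + (1 - q) * \<Psi> (T\<^sub>2 \<zeta>)" for \<zeta>
  have "integrable \<nu> w" unfolding w_def using i by auto
  moreover have "integral\<^sup>L \<nu> w = q * (\<integral>\<zeta>. \<Psi> (T\<^sub>1 \<zeta>) \<partial>\<nu>) + (1 - q) * (\<integral>\<zeta>. \<Psi> (T\<^sub>2 \<zeta>) \<partial>\<nu>)"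
    unfolding w_def using i by simp
  ultimately have "ereal (q * (\<integral>\<zeta>. \<Psi> (T\<^sub>1 \<zeta>) \<partial>\<nu>) + (1 - q) * (\<integral>\<zeta>. \<Psi> (T\<^sub>2 \<zeta>) \<partial>\<nu>)) = ereal_integral \<nu> (\<lambda>\<zeta>. ereal (w \<zeta>))"
    using ereal_integral_real[of \<nu> w] by simp
  also have "\<dots> \<le> ereal_integral \<nu> (\<lambda>\<zeta>. ereal (\<Psi> (T \<zeta>)))"
    unfolding ereal_integral_def
  proof (intro ereal_minus_mono)
    have "w \<zeta> \<le> \<Psi> (T \<zeta>)" for \<zeta> unfolding w_def by (rule \<Psi>T)
    then show "enn2ereal (\<integral>\<^sup>+\<zeta>. e2ennreal (ereal (w \<zeta>)) \<partial>\<nu>) \<le> enn2ereal (\<integral>\<^sup>+\<zeta>. e2ennreal (ereal (\<Psi> (T \<zeta>))) \<partial>\<nu>)"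
      and "enn2ereal (\<integral>\<^sup>+\<zeta>. e2ennreal (- ereal (\<Psi> (T \<zeta>))) \<partial>\<nu>) \<le> enn2ereal (\<integral>\<^sup>+\<zeta>. e2ennreal (- ereal (w \<zeta>)) \<partial>\<nu>)"
      by (auto simp: less_eq_ennreal.rep_eq[symmetric] intro!: nn_integral_mono ennreal_leI)
  qed
  also have "\<dots> = ereal_integral (push \<nu> T) (\<lambda>\<xi>. ereal (\<Psi> \<xi>))" by (rule ereal_integral_push[OF Tb, symmetric])
  finally have val: "ereal (q * (\<integral>\<zeta>. \<Psi> (T\<^sub>1 \<zeta>) \<partial>\<nu>) + (1 - q) * (\<integral>\<zeta>. \<Psi> (T\<^sub>2 \<zeta>) \<partial>\<nu>)) \<le> ereal_integral (push \<nu> T) (\<lambda>\<xi>. ereal (\<Psi> \<xi>))" .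
  have "AE \<zeta> in \<nu>. T \<zeta> \<in> Argmin l \<zeta>"
    if l: "0 \<le> l" and arg: "AE \<zeta> in \<nu>. T\<^sub>1 \<zeta> \<in> Argmin l \<zeta> \<and> T\<^sub>2 \<zeta> \<in> Argmin l \<zeta>" for l
    using arg dT
  proof eventually_elim
    case (elim \<zeta>)
    have "gain l \<eta> \<zeta> \<le> gain l (T \<zeta>) \<zeta>" for \<eta>
    proof -
      have "gain l \<eta> \<zeta> = q * gain l \<eta> \<zeta> + (1 - q) * gain l \<eta> \<zeta>" by (simp add: algebra_simps)
      also have "\<dots> \<le> q * gain l (T\<^sub>1 \<zeta>) \<zeta> + (1 - q) * gain l (T\<^sub>2 \<zeta>) \<zeta>"
        using elim(1) q unfolding argmin_iff by (intro add_mono mult_left_mono) auto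
      also have "\<dots> = (q * \<Psi> (T\<^sub>1 \<zeta>) + (1 - q) * \<Psi> (T\<^sub>2 \<zeta>)) - \<Psi> \<zeta>
          - l * (q * dist (T\<^sub>1 \<zeta>) \<zeta> powr p + (1 - q) * dist (T\<^sub>2 \<zeta>) \<zeta> powr p)"
        unfolding gain_def by (simp add: algebra_simps)
      also have "\<dots> \<le> gain l (T \<zeta>) \<zeta>"
        unfolding gain_def using \<Psi>T[of \<zeta>] mult_left_mono[OF elim(2) l] by linarith
      finally show ?thesis .
    qed
    then show ?case unfolding argmin_iff by blast
  qed
  then show ?thesis using Tb feas val by blast
qed

text \<open>Near-optimal and optimal measures are mixtures of two images of \<open>\<nu>\<close>; both kinds are replaced by the image
  under the combined map.\<close>

lemma convex_case:
  fixes X :: "'v::real_vector topology" and e :: "'a \<Rightarrow> 'v"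
  assumes A: "tvs_topology X" "embedding_map euclidean X e" "convex (range e)"
    "concave_on (range e) (\<lambda>v. \<Psi> (inv e v))"
    "AE \<zeta> in \<nu>. convex_on (range e) (\<lambda>v. dist (inv e v) \<zeta> powr p)"
    and t: "0 < t"
  shows "Dual t =
      (SUP T\<in>{T. nu_measurable \<nu> T \<and> wasserstein p (push \<nu> T) \<nu> \<le> ennreal t}. ereal_integral (push \<nu> T) (\<lambda>\<xi>. ereal (\<Psi> \<xi>)))"
    and "(\<exists>\<mu>. Worst t \<mu>) \<Longrightarrow> \<exists>l\<in>Minimizers t. \<exists>T. nu_measurable \<nu> T \<and>
      Worst t (push \<nu> T) \<and> (AE \<zeta> in \<nu>. T \<zeta> \<in> Argmin l \<zeta>)"
proof -
  let ?S = "{T. nu_measurable \<nu> T \<and> wasserstein p (push \<nu> T) \<nu> \<le> ennreal t}"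
  let ?I = "\<lambda>T. ereal_integral (push \<nu> T) (\<lambda>\<xi>. ereal (\<Psi> \<xi>))"
  show "Dual t = (SUP T\<in>?S. ?I T)"
  proof (rule antisym)
    show "Dual t \<le> (SUP T\<in>?S. ?I T)"
    proof (rule ereal_le_epsilon2)
      fix \<epsilon> :: real assume "0 < \<epsilon>"
      then obtain q T\<^sub>1 T\<^sub>2 where M: "near_optimal_pair t \<epsilon> q T\<^sub>1 T\<^sub>2" using near_optimal_pair_exists[OF t] by blast
      then obtain T where T: "T \<in> borel \<rightarrow>\<^sub>M borel" "push \<nu> T \<in> primal_feasible p \<nu> t"
        "ereal (q * (\<integral>\<zeta>. \<Psi> (T\<^sub>1 \<zeta>) \<partial>\<nu>) + (1 - q) * (\<integral>\<zeta>. \<Psi> (T\<^sub>2 \<zeta>) \<partial>\<nu>)) \<le> ?I T"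
        using combined_map[OF A t, of q T\<^sub>1 T\<^sub>2] unfolding near_optimal_pair_def by blast
      have "T \<in> ?S" using T(2) nu_measurable_borel[OF \<nu> T(1)] unfolding primal_feasible_def by simp
      then have "?I T \<le> (SUP T\<in>?S. ?I T)" by (rule SUP_upper)
      with T(3) have "ereal (q * (\<integral>\<zeta>. \<Psi> (T\<^sub>1 \<zeta>) \<partial>\<nu>) + (1 - q) * (\<integral>\<zeta>. \<Psi> (T\<^sub>2 \<zeta>) \<partial>\<nu>)) \<le> (SUP T\<in>?S. ?I T)"
        by (rule order_trans)
      then have "ereal (q * (\<integral>\<zeta>. \<Psi> (T\<^sub>1 \<zeta>) \<partial>\<nu>) + (1 - q) * (\<integral>\<zeta>. \<Psi> (T\<^sub>2 \<zeta>) \<partial>\<nu>)) + ereal \<epsilon> \<le> (SUP T\<in>?S. ?I T) + ereal \<epsilon>"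
        by (rule add_right_mono)
      moreover have "Dual t \<le> ereal (q * (\<integral>\<zeta>. \<Psi> (T\<^sub>1 \<zeta>) \<partial>\<nu>) + (1 - q) * (\<integral>\<zeta>. \<Psi> (T\<^sub>2 \<zeta>) \<partial>\<nu>) + \<epsilon>)"
        using M unfolding near_optimal_pair_def by blast
      ultimately show "Dual t \<le> (SUP T\<in>?S. ?I T) + ereal \<epsilon>" by simp
    qed
    show "(SUP T\<in>?S. ?I T) \<le> Dual t"
      unfolding strong_duality[OF t, symmetric] primal_value_def
    proof (rule SUP_least)
      fix T assume "T \<in> ?S"
      then have "push \<nu> T \<in> primal_feasible p \<nu> t" unfolding primal_feasible_def using push_in_borel_probs[OF \<nu>] by blast
      then show "?I T \<le> (SUP \<mu>\<in>primal_feasible p \<nu> t. ereal_integral \<mu> (\<lambda>\<xi>. ereal (\<Psi> \<xi>)))" by (rule SUP_upper)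
    qed
  qed
  show "\<exists>l\<in>Minimizers t. \<exists>T. nu_measurable \<nu> T \<and>
      Worst t (push \<nu> T) \<and> (AE \<zeta> in \<nu>. T \<zeta> \<in> Argmin l \<zeta>)" if W: "\<exists>\<mu>. Worst t \<mu>"
  proof -
    obtain l q T\<^sub>1 T\<^sub>2 where S: "complementary_pair t l q T\<^sub>1 T\<^sub>2" using worst_case_iff(2)[OF t W] by blast
    note v = complementary_pair_value[OF S t]
    have l: "l \<in> Minimizers t" and arg: "AE \<zeta> in \<nu>. T\<^sub>1 \<zeta> \<in> Argmin l \<zeta> \<and> T\<^sub>2 \<zeta> \<in> Argmin l \<zeta>"
      using S unfolding complementary_pair_def by auto
    obtain T where T: "T \<in> borel \<rightarrow>\<^sub>M borel" "push \<nu> T \<in> primal_feasible p \<nu> t"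
      "Dual t \<le> ?I T"
      "\<forall>l\<ge>0. (AE \<zeta> in \<nu>. T\<^sub>1 \<zeta> \<in> Argmin l \<zeta> \<and> T\<^sub>2 \<zeta> \<in> Argmin l \<zeta>) \<longrightarrow> (AE \<zeta> in \<nu>. T \<zeta> \<in> Argmin l \<zeta>)"
      using combined_map[OF A t _ _ _ _ _ _ v(1,2)] S unfolding v(3)[symmetric] complementary_pair_def by blast
    have "?I T \<le> Primal t" unfolding primal_value_def by (rule SUP_upper[OF T(2)])
    then have "Worst t (push \<nu> T)" unfolding worst_case_def using T(2,3) strong_duality[OF t] by auto
    moreover have "AE \<zeta> in \<nu>. T \<zeta> \<in> Argmin l \<zeta>" using T(4) arg dual_minimizer_finite(2)[OF l] by blast
    ultimately show ?thesis using l nu_measurable_borel[OF \<nu> T(1)] by blast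
  qed
qed

end

section \<open>Worst-case distributions\<close>

theorem corollary1:
  fixes \<nu> :: "'a::polish_space measure"
    and \<Psi> :: "'a \<Rightarrow> real"
    and p \<theta> \<kappa> :: real
  assumes tot_bdd: "\<And>S :: 'a set. bounded S \<Longrightarrow> totally_bounded S"
    and p: "1 \<le> p"
    and \<nu>: "\<nu> \<in> borel_probs"
    and \<theta>: "0 < \<theta>"
    and usc: "usc \<Psi>"
    and int: "integrable \<nu> \<Psi>"
    and \<kappa>: "growth_rate p \<Psi> \<nu> = ereal \<kappa>"
  shows
    "((\<exists>\<mu>. worst_case p \<Psi> \<nu> \<theta> \<mu>) \<longleftrightarrow>
        (\<exists>l\<in>dual_minimizers p \<Psi> \<nu> \<theta>. l > \<kappa>)
      \<or> (\<kappa> > 0 \<and> dual_minimizers p \<Psi> \<nu> \<theta> = {\<kappa>} \<and>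
         (AE \<zeta> in \<nu>. argmin_set p \<Psi> \<kappa> \<zeta> \<noteq> {}) \<and>
         (\<integral>\<^sup>+\<zeta>. D0_lower p \<Psi> \<kappa> \<zeta> \<partial>completion \<nu>) \<le> ennreal (\<theta> powr p) \<and>
         ennreal (\<theta> powr p) \<le> (\<integral>\<^sup>+\<zeta>. D0_upper p \<Psi> \<kappa> \<zeta> \<partial>completion \<nu>))
      \<or> (\<kappa> = 0 \<and> dual_minimizers p \<Psi> \<nu> \<theta> = {\<kappa>} \<and>
         {\<xi>. \<forall>\<xi>'. \<Psi> \<xi>' \<le> \<Psi> \<xi>} \<noteq> {} \<and>
         (\<integral>\<^sup>+\<zeta>. D0_lower p \<Psi> 0 \<zeta> \<partial>completion \<nu>) \<le> ennreal (\<theta> powr p)))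
   \<and> (if AE \<zeta> in \<nu>. \<not> ereal (- \<Psi> \<zeta>) > Phi p \<Psi> \<kappa> \<zeta>
      then \<forall>t>0. dual_minimizers p \<Psi> \<nu> t = {\<kappa>}
      else \<exists>t\<^sub>0>0. \<forall>t. 0 < t \<and> t < t\<^sub>0 \<longrightarrow>
             dual_minimizers p \<Psi> \<nu> t \<noteq> {} \<and> (\<forall>l\<in>dual_minimizers p \<Psi> \<nu> t. l > \<kappa>))
   \<and> ((\<exists>\<mu>. worst_case p \<Psi> \<nu> \<theta> \<mu>) \<longrightarrow>
      (\<exists>l\<in>dual_minimizers p \<Psi> \<nu> \<theta>. \<exists>q\<in>{0..1}. \<exists>T\<^sub>1 T\<^sub>2.
         nu_measurable \<nu> T\<^sub>1 \<and> nu_measurable \<nu> T\<^sub>2 \<and>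
         (AE \<zeta> in \<nu>. T\<^sub>1 \<zeta> \<in> argmin_set p \<Psi> l \<zeta> \<and> T\<^sub>2 \<zeta> \<in> argmin_set p \<Psi> l \<zeta>) \<and>
         (let \<mu> = mixture q (push \<nu> T\<^sub>1) (push \<nu> T\<^sub>2);
              \<gamma> = mixture q (push \<nu> (\<lambda>\<zeta>. (\<zeta>, T\<^sub>1 \<zeta>))) (push \<nu> (\<lambda>\<zeta>. (\<zeta>, T\<^sub>2 \<zeta>)))
          in worst_case p \<Psi> \<nu> \<theta> \<mu> \<and>
             (l > 0 \<longrightarrow> \<gamma> \<in> couplings \<nu> \<mu> \<and> transport_cost p \<gamma> = Wpp p \<mu> \<nu>))))
     \<comment> \<open>the convex set is the image of the space under the embedding e\<close>
   \<and> (\<forall>(X :: 'v::real_vector topology) (e :: 'a \<Rightarrow> 'v).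
        tvs_topology X \<and> embedding_map euclidean X e \<and> convex (range e) \<and>
        concave_on (range e) (\<lambda>v. \<Psi> (inv e v)) \<and>
        (AE \<zeta> in \<nu>. convex_on (range e) (\<lambda>v. dist (inv e v) \<zeta> powr p))
      \<longrightarrow>
        primal_value p \<Psi> \<nu> \<theta> = dual_value p \<Psi> \<nu> \<theta> \<and>
        dual_value p \<Psi> \<nu> \<theta> =
          (SUP T\<in>{T. nu_measurable \<nu> T \<and> wasserstein p (push \<nu> T) \<nu> \<le> ennreal \<theta>}.
             ereal_integral (push \<nu> T) (\<lambda>\<xi>. ereal (\<Psi> \<xi>))) \<and>
        ((\<exists>\<mu>. worst_case p \<Psi> \<nu> \<theta> \<mu>) \<longrightarrow>
         (\<exists>l\<in>dual_minimizers p \<Psi> \<nu> \<theta>. \<exists>T.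
            nu_measurable \<nu> T \<and> worst_case p \<Psi> \<nu> \<theta> (push \<nu> T) \<and>
            (AE \<zeta> in \<nu>. T \<zeta> \<in> argmin_set p \<Psi> l \<zeta>))))"
proof -
  interpret transport_problem "TYPE('a)" \<nu> \<Psi> p \<kappa>
  proof
    fix S :: "'a set" assume S: "closed S" "bounded S"
    show "compact S" unfolding compact_eq_totally_bounded complete_eq_closed
    proof (intro conjI allI impI S(1))
      fix e :: real assume "0 < e"
      then have "eventually (\<lambda>(x, y). dist x y < e) (uniformity :: ('a \<times> 'a) filter)"
        unfolding eventually_uniformity_metric by auto
      then have "\<exists>k. finite k \<and> (\<forall>s\<in>S. \<exists>x\<in>k. case (x, s) of (x, y) \<Rightarrow> dist x y < e)"
        using tot_bdd[OF S(2)] unfolding totally_bounded_def by (elim allE impE) assumption+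
      then obtain k where "finite k" "\<forall>s\<in>S. \<exists>x\<in>k. dist x s < e" by auto
      then show "\<exists>k. finite k \<and> S \<subseteq> (\<Union>x\<in>k. ball x e)" by (intro exI[of _ k]) auto
    qed
  qed (rule p \<nu> usc int \<kappa>)+
  have small: "if AE \<zeta> in \<nu>. \<not> ereal (- \<Psi> \<zeta>) > Phi p \<Psi> \<kappa> \<zeta>
      then \<forall>t>0. dual_minimizers p \<Psi> \<nu> t = {\<kappa>}
      else \<exists>t\<^sub>0>0. \<forall>t. 0 < t \<and> t < t\<^sub>0 \<longrightarrow>
             dual_minimizers p \<Psi> \<nu> t \<noteq> {} \<and> (\<forall>l\<in>dual_minimizers p \<Psi> \<nu> t. l > \<kappa>)"
    unfolding total_gain_eq_0_iff[symmetric]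
  proof (cases "total_gain \<kappa> = 0")
    case True
    then show "if total_gain \<kappa> = 0 then \<forall>t>0. dual_minimizers p \<Psi> \<nu> t = {\<kappa>}
      else \<exists>t\<^sub>0>0. \<forall>t. 0 < t \<and> t < t\<^sub>0 \<longrightarrow>
             dual_minimizers p \<Psi> \<nu> t \<noteq> {} \<and> (\<forall>l\<in>dual_minimizers p \<Psi> \<nu> t. l > \<kappa>)"
      using dual_minimizers_no_gain by simp
  next
    case False
    then show "if total_gain \<kappa> = 0 then \<forall>t>0. dual_minimizers p \<Psi> \<nu> t = {\<kappa>}
      else \<exists>t\<^sub>0>0. \<forall>t. 0 < t \<and> t < t\<^sub>0 \<longrightarrow>
             dual_minimizers p \<Psi> \<nu> t \<noteq> {} \<and> (\<forall>l\<in>dual_minimizers p \<Psi> \<nu> t. l > \<kappa>)"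
      using dual_minimizers_small_budget[OF False] by (simp only: if_False)
  qed
  have convex: "primal_value p \<Psi> \<nu> \<theta> = dual_value p \<Psi> \<nu> \<theta> \<and>
        dual_value p \<Psi> \<nu> \<theta> =
          (SUP T\<in>{T. nu_measurable \<nu> T \<and> wasserstein p (push \<nu> T) \<nu> \<le> ennreal \<theta>}.
             ereal_integral (push \<nu> T) (\<lambda>\<xi>. ereal (\<Psi> \<xi>))) \<and>
        ((\<exists>\<mu>. worst_case p \<Psi> \<nu> \<theta> \<mu>) \<longrightarrow>
         (\<exists>l\<in>dual_minimizers p \<Psi> \<nu> \<theta>. \<exists>T.
            nu_measurable \<nu> T \<and> worst_case p \<Psi> \<nu> \<theta> (push \<nu> T) \<and>
            (AE \<zeta> in \<nu>. T \<zeta> \<in> argmin_set p \<Psi> l \<zeta>)))"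
    if A: "tvs_topology X \<and> embedding_map euclidean X e \<and> convex (range e) \<and>
        concave_on (range e) (\<lambda>v. \<Psi> (inv e v)) \<and>
        (AE \<zeta> in \<nu>. convex_on (range e) (\<lambda>v. dist (inv e v) \<zeta> powr p))"
    for X :: "'v topology" and e :: "'a \<Rightarrow> 'v"
  proof -
    from A have A': "tvs_topology X" "embedding_map euclidean X e" "convex (range e)"
      "concave_on (range e) (\<lambda>v. \<Psi> (inv e v))"
      "AE \<zeta> in \<nu>. convex_on (range e) (\<lambda>v. dist (inv e v) \<zeta> powr p)" by simp_all
    note c = convex_case[OF A' \<theta>]
    show ?thesis by (rule conjI[OF strong_duality[OF \<theta>] conjI[OF c(1)]], rule impI, erule c(2))
  qed
  show ?thesis
    unfolding nn_integral_completion
    apply (rule conjI[OF worst_case_iff(1)[OF \<theta>] conjI[OF small conjI]])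
     apply (rule impI, erule worst_case_structure[OF \<theta>])
    apply (rule allI, rule allI, rule impI, erule convex)
    done
qed

end
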